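(* Let $(M,F)$ be a Finsler manifold, $x_0,x_1\in M$, $p\in\mathbb{R}\setminus\{0\}$, $c\in\Omega$, let $(c_s)_{s\in(-\epsilon,\epsilon)}\subset\Omega$ be a one-parameter variation of $c$ (with $c_0=c$), and let $X(t)=\frac{\partial c_s}{\partial s}\big|_{s=0}(t)\in T_c\Omega$ be its variation field. Then $$\frac1p\,\frac{dE_p(c_s)}{ds}(0)=-\sum_t g\big(X,\Delta_t(\|\dot c\|^{p-2}\dot c)\big)-\int_0^1\|\dot c\|^{p-4}\,g\Big(X,\ \|\dot c\|^2\,\frac{\nabla\dot c}{dt}+(p-2)\,g\Big(\frac{\nabla\dot c}{dt},\dot c\Big)\dot c\Big)\,dt,$$ where $\Delta_t(\|\dot c\|^{p-2}\dot c)=(\|\dot c\|^{p-2}\dot c)_{t^+}-(\|\dot c\|^{p-2}\dot c)_{t^-}$ is the jump of $\|\dot c\|^{p-2}\dot c$ at the discontinuity point $t\in(0,1)$, and the sum runs over the discontinuity points.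
   Context: $(M,F)$ is a connected $n$-dimensional Finsler manifold: $F:TM\to\mathbb{R}$ satisfies $F(x,y)>0$ for $y\neq0$; $F(x,\lambda y)=|\lambda|F(x,y)$ for all $\lambda\in\mathbb{R}$; $g_{ij}(x,y)=\frac12\frac{\partial^2F^2}{\partial y^i\partial y^j}$ is positive definite (for $y\ne0$); $F$ is $C^\infty$ at every $(x,y)$ with $y\neq0$ and continuous at every $(x,0)$. Along a regular curve $c$, for vector fields $X=X^i\partial_{x^i}$, $Y=Y^i\partial_{x^i}$ along $c$, put $g(X,Y)=g_{ij}(c,\dot c)X^iY^j$ and $\|X\|=\sqrt{g(X,X)}$. Cartan connection: let $\gamma^i_{jk}=\frac12g^{im}\left(\frac{\partial g_{mk}}{\partial x^j}+\frac{\partial g_{jm}}{\partial x^k}-\frac{\partial g_{jk}}{\partial x^m}\right)$, $N^i_j=\frac12\frac{\partial}{\partial y^j}(\gamma^i_{kl}y^ky^l)$, $\frac{\delta}{\delta x^i}=\frac{\partial}{\partial x^i}-N^j_i\frac{\partial}{\partial y^j}$, $L^i_{jk}=\frac12g^{im}\left(\frac{\delta g_{mk}}{\delta x^j}+\frac{\delta g_{jm}}{\delta x^k}-\frac{\delta g_{jk}}{\delta x^m}\right)$, $C^i_{jk}=\frac12g^{im}\frac{\partial g_{mj}}{\partial y^k}$. The covariant derivative along $c$ is $$\frac{\nabla X}{dt}=\Big\{\frac{dX^i}{dt}+X^m\Big[L^i_{mk}(c,\dot c)\dot c^k+C^i_{mk}(c,\dot c)\big(\ddot c^k+N^k_l(c,\dot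 c)\dot c^l\big)\Big]\Big\}\frac{\partial}{\partial x^i}.$$ $\Omega$ is the set of piecewise $C^\infty$ regular curves $c:[0,1]\to M$ with $c(0)=x_0$, $c(1)=x_1$ ($x_0,x_1$ not necessarily distinct). $T_c\Omega$ is the set of continuous, piecewise $C^\infty$ vector fields $X$ along $c$ with $X(0)=X(1)=0$. Variations are continuous in all variables and smooth on $(-\epsilon,\epsilon)\times[t_{k-1},t_k]$ for some subdivision $0=t_0<\dots<t_r=1$. The $p$-energy is $E_p(c)=\int_0^1[g(\dot c,\dot c)]^{p/2}dt=\int_0^1\|\dot c\|^p\,dt$. At a point $t$ where $\dot c$ is discontinuous, the expression $g(X,\Delta_t(\|\dot c\|^{p-2}\dot c))$ means the right limit minus the left limit at $t$ of $g(X,\|\dot c\|^{p-2}\dot c)$, each computed with $g_{ij}(c,\dot c)$ at the corresponding one-sided velocity. *)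

theory Defs
  imports "HOL-Analysis.Analysis"
begin

section \<open>Smooth maps between Euclidean spaces\<close>

text \<open>Intended for open \<open>S\<close> only: \<open>frechet_derivative f (at x) v\<close> is the derivative of
  \<open>f\<close> at \<open>x\<close> in the direction \<open>v\<close>, and \<open>Ck_on k S f\<close> says that all iterated directional
  derivatives of order at most \<open>k\<close> exist and are continuous on \<open>S\<close>.\<close>

primrec Ck_on :: "nat \<Rightarrow> 'a::euclidean_space set \<Rightarrow> ('a \<Rightarrow> 'b::euclidean_space) \<Rightarrow> bool" where
  "Ck_on 0 S f \<longleftrightarrow> continuous_on S f"
| "Ck_on (Suc k) S f \<longleftrightarrow>
     (\<forall>x\<in>S. f differentiable (at x)) \<and>
     (\<forall>v. Ck_on k S (\<lambda>x. frechet_derivative f (at x) v))"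

definition smooth_on :: "'a::euclidean_space set \<Rightarrow> ('a \<Rightarrow> 'b::euclidean_space) \<Rightarrow> bool" where
  "smooth_on S f \<longleftrightarrow> (\<forall>k. Ck_on k S f)"


section \<open>Smooth manifolds\<close>

text \<open>A chart is a pair of its domain and its coordinate map; the values of the coordinate map
  outside the domain are irrelevant. The dimension is \<open>CARD('n)\<close>. An atlas need not be maximal.\<close>

type_synonym ('a, 'n) chart = "'a set \<times> ('a \<Rightarrow> real^'n)"

definition charts_at :: "('a, 'n::finite) chart set \<Rightarrow> 'a \<Rightarrow> ('a, 'n) chart set" where
  "charts_at A x = {\<kappa> \<in> A. x \<in> fst \<kappa>}"

definition chart_inv :: "('a, 'n::finite) chart \<Rightarrow> real^'n \<Rightarrow> 'a" where
  "chart_inv \<kappa> = inv_into (fst \<kappa>) (snd \<kappa>)"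

definition transition :: "('a, 'n::finite) chart \<Rightarrow> ('a, 'n) chart \<Rightarrow> real^'n \<Rightarrow> real^'n" where
  "transition \<kappa> \<kappa>' = snd \<kappa>' \<circ> chart_inv \<kappa>"

definition smooth_atlas :: "'a topology \<Rightarrow> ('a, 'n::finite) chart set \<Rightarrow> bool" where
  "smooth_atlas M A \<longleftrightarrow>
     (\<forall>\<kappa>\<in>A. openin M (fst \<kappa>) \<and> open (snd \<kappa> ` fst \<kappa>) \<and>
        homeomorphic_map (subtopology M (fst \<kappa>)) (top_of_set (snd \<kappa> ` fst \<kappa>)) (snd \<kappa>)) \<and>
     (\<Union>\<kappa>\<in>A. fst \<kappa>) = topspace M \<and>
     (\<forall>\<kappa>\<in>A. \<forall>\<kappa>'\<in>A. smooth_on (snd \<kappa> ` (fst \<kappa> \<inter> fst \<kappa>')) (transition \<kappa> \<kappa>'))"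

definition connected_manifold :: "'a topology \<Rightarrow> ('a, 'n::finite) chart set \<Rightarrow> bool" where
  "connected_manifold M A \<longleftrightarrow>
     Hausdorff_space M \<and> second_countable M \<and> connected_space M \<and> smooth_atlas M A"

text \<open>Smoothness of a map from an arbitrary subset \<open>S\<close> of a Euclidean space (such as a closed
  interval or a closed strip) into \<open>M\<close>: near each point the coordinate representation extends to a
  smooth map on an open set.\<close>

definition smooth_map ::
    "'a topology \<Rightarrow> ('a, 'n::finite) chart set \<Rightarrow> 'e::euclidean_space set \<Rightarrow> ('e \<Rightarrow> 'a) \<Rightarrow> bool" where
  "smooth_map M A S f \<longleftrightarrow>
     f ` S \<subseteq> topspace M \<and>
     (\<forall>x\<in>S. \<forall>\<kappa>\<in>charts_at A (f x). \<exists>W h. open W \<and> x \<in> W \<and> smooth_on W h \<and>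
        (\<forall>z\<in>W \<inter> S. f z \<in> fst \<kappa> \<and> h z = snd \<kappa> (f z)))"


section \<open>Tangent vectors\<close>

text \<open>A tangent vector at \<open>x\<close> is the family of its component vectors in all charts around \<open>x\<close>,
  subject to the transformation law; it is set to 0 at the other charts so that equality of
  tangent vectors is equality of functions.\<close>

type_synonym ('a, 'n) tvec = "('a, 'n) chart \<Rightarrow> real^'n"

definition tangent_space :: "('a, 'n::finite) chart set \<Rightarrow> 'a \<Rightarrow> ('a, 'n) tvec set" where
  "tangent_space A x = {v.
     (\<forall>\<kappa>\<in>charts_at A x. \<forall>\<kappa>'\<in>charts_at A x.
        v \<kappa>' = frechet_derivative (transition \<kappa> \<kappa>') (at (snd \<kappa> x)) (v \<kappa>)) \<and>
     (\<forall>\<kappa>. \<kappa> \<notin> charts_at A x \<longrightarrow> v \<kappa> = 0)}"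

definition tvec_zero :: "('a, 'n::finite) tvec" where
  "tvec_zero = (\<lambda>\<kappa>. 0)"

definition tvec_add :: "('a, 'n::finite) tvec \<Rightarrow> ('a, 'n) tvec \<Rightarrow> ('a, 'n) tvec" where
  "tvec_add v w = (\<lambda>\<kappa>. v \<kappa> + w \<kappa>)"

definition tvec_scale :: "real \<Rightarrow> ('a, 'n::finite) tvec \<Rightarrow> ('a, 'n) tvec" where
  "tvec_scale a v = (\<lambda>\<kappa>. a *\<^sub>R v \<kappa>)"

text \<open>The tangent vector \<open>y\<^sup>i \<partial>/\<partial>x\<^sup>i\<close> at \<open>x\<close>, where \<open>x\<^sup>i\<close> are the coordinates of the chart \<open>\<kappa>\<close>.\<close>

definition tvec_of :: "('a, 'n::finite) chart set \<Rightarrow> ('a, 'n) chart \<Rightarrow> 'a \<Rightarrow> real^'n \<Rightarrow> ('a, 'n) tvec"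
  where
  "tvec_of A \<kappa> x y = (\<lambda>\<kappa>'. if \<kappa>' \<in> charts_at A x
     then frechet_derivative (transition \<kappa> \<kappa>') (at (snd \<kappa> x)) y else 0)"

text \<open>Velocity at time \<open>t\<close> of a curve with parameter set \<open>S\<close> (one-sided at an end point of \<open>S\<close>).
  Its value is meaningless where the curve is not differentiable.\<close>

definition velocity ::
    "('a, 'n::finite) chart set \<Rightarrow> real set \<Rightarrow> (real \<Rightarrow> 'a) \<Rightarrow> real \<Rightarrow> ('a, 'n) tvec" where
  "velocity A S c t = (\<lambda>\<kappa>. if \<kappa> \<in> charts_at A (c t)
     then vector_derivative (\<lambda>\<tau>. snd \<kappa> (c \<tau>)) (at t within S) else 0)"


section \<open>Coordinate expressions for a Finsler function\<close>

text \<open>Partial derivative in the direction of the \<open>i\<close>-th coordinate.\<close>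

definition pd :: "'n::finite \<Rightarrow> (real^'n \<Rightarrow> real) \<Rightarrow> real^'n \<Rightarrow> real" where
  "pd i f x = frechet_derivative f (at x) (axis i 1)"

text \<open>In this section \<open>\<Phi> u y\<close> is the Finsler function in local coordinates, where \<open>u\<close> stands for
  \<open>(x\<^sup>i)\<close> and \<open>y\<close> for \<open>(y\<^sup>i)\<close>. The index arguments appear in the order: upper index first, then
  the lower ones.\<close>

type_synonym 'n local_finsler = "real^'n \<Rightarrow> real^'n \<Rightarrow> real"

definition g_low :: "'n::finite local_finsler \<Rightarrow> real^'n \<Rightarrow> real^'n \<Rightarrow> real^'n^'n" where
  "g_low \<Phi> u y = (\<chi> i j. 1/2 * pd i (pd j (\<lambda>y'. (\<Phi> u y')\<^sup>2)) y)"

definition g_up :: "'n::finite local_finsler \<Rightarrow> real^'n \<Rightarrow> real^'n \<Rightarrow> real^'n^'n" where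
  "g_up \<Phi> u y = matrix_inv (g_low \<Phi> u y)"

definition gamma_coeff ::
    "'n::finite local_finsler \<Rightarrow> 'n \<Rightarrow> 'n \<Rightarrow> 'n \<Rightarrow> real^'n \<Rightarrow> real^'n \<Rightarrow> real" where
  "gamma_coeff \<Phi> i j k u y = 1/2 * (\<Sum>m\<in>UNIV. g_up \<Phi> u y $ i $ m *
     (pd j (\<lambda>u'. g_low \<Phi> u' y $ m $ k) u
      + pd k (\<lambda>u'. g_low \<Phi> u' y $ j $ m) u
      - pd m (\<lambda>u'. g_low \<Phi> u' y $ j $ k) u))"

definition N_coeff :: "'n::finite local_finsler \<Rightarrow> 'n \<Rightarrow> 'n \<Rightarrow> real^'n \<Rightarrow> real^'n \<Rightarrow> real" where
  "N_coeff \<Phi> i j u y = 1/2 *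
     pd j (\<lambda>y'. \<Sum>k\<in>UNIV. \<Sum>l\<in>UNIV. gamma_coeff \<Phi> i k l u y' * y' $ k * y' $ l) y"

text \<open>The derivation \<open>\<delta>/\<delta>x\<^sup>i\<close>.\<close>

definition delta_deriv ::
    "'n::finite local_finsler \<Rightarrow> 'n \<Rightarrow> (real^'n \<Rightarrow> real^'n \<Rightarrow> real) \<Rightarrow> real^'n \<Rightarrow> real^'n \<Rightarrow> real" where
  "delta_deriv \<Phi> i f u y =
     pd i (\<lambda>u'. f u' y) u - (\<Sum>j\<in>UNIV. N_coeff \<Phi> j i u y * pd j (\<lambda>y'. f u y') y)"

definition L_coeff ::
    "'n::finite local_finsler \<Rightarrow> 'n \<Rightarrow> 'n \<Rightarrow> 'n \<Rightarrow> real^'n \<Rightarrow> real^'n \<Rightarrow> real" where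
  "L_coeff \<Phi> i j k u y = 1/2 * (\<Sum>m\<in>UNIV. g_up \<Phi> u y $ i $ m *
     (delta_deriv \<Phi> j (\<lambda>u' y'. g_low \<Phi> u' y' $ m $ k) u y
      + delta_deriv \<Phi> k (\<lambda>u' y'. g_low \<Phi> u' y' $ j $ m) u y
      - delta_deriv \<Phi> m (\<lambda>u' y'. g_low \<Phi> u' y' $ j $ k) u y))"

definition C_coeff ::
    "'n::finite local_finsler \<Rightarrow> 'n \<Rightarrow> 'n \<Rightarrow> 'n \<Rightarrow> real^'n \<Rightarrow> real^'n \<Rightarrow> real" where
  "C_coeff \<Phi> i j k u y = 1/2 * (\<Sum>m\<in>UNIV. g_up \<Phi> u y $ i $ m *
     pd k (\<lambda>y'. g_low \<Phi> u y' $ m $ j) y)"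


section \<open>Finsler manifolds\<close>

text \<open>\<open>F x v\<close> is the value of the Finsler function at the tangent vector \<open>v\<close> at \<open>x\<close>.\<close>

type_synonym ('a, 'n) finsler_fun = "'a \<Rightarrow> ('a, 'n) tvec \<Rightarrow> real"

definition F_loc ::
    "('a, 'n::finite) chart set \<Rightarrow> ('a, 'n) finsler_fun \<Rightarrow> ('a, 'n) chart \<Rightarrow> 'n local_finsler" where
  "F_loc A F \<kappa> u y = F (chart_inv \<kappa> u) (tvec_of A \<kappa> (chart_inv \<kappa> u) y)"

definition finsler_manifold ::
    "'a topology \<Rightarrow> ('a, 'n::finite) chart set \<Rightarrow> ('a, 'n) finsler_fun \<Rightarrow> bool" where
  "finsler_manifold M A F \<longleftrightarrow>
     connected_manifold M A \<and>
     (\<forall>x\<in>topspace M. \<forall>v\<in>tangent_space A x. v \<noteq> tvec_zero \<longrightarrow> F x v > 0) \<and>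
     (\<forall>x\<in>topspace M. \<forall>v\<in>tangent_space A x. \<forall>a. F x (tvec_scale a v) = \<bar>a\<bar> * F x v) \<and>
     (\<forall>\<kappa>\<in>A. \<forall>u\<in>snd \<kappa> ` fst \<kappa>. \<forall>y. y \<noteq> 0 \<longrightarrow>
        (\<forall>w. w \<noteq> 0 \<longrightarrow>
           (\<Sum>i\<in>UNIV. \<Sum>j\<in>UNIV. g_low (F_loc A F \<kappa>) u y $ i $ j * w $ i * w $ j) > 0)) \<and>
     (\<forall>\<kappa>\<in>A. smooth_on ((snd \<kappa> ` fst \<kappa>) \<times> (- {0})) (\<lambda>(u, y). F_loc A F \<kappa> u y)) \<and>
     (\<forall>\<kappa>\<in>A. \<forall>u\<in>snd \<kappa> ` fst \<kappa>. isCont (\<lambda>(u', y). F_loc A F \<kappa> u' y) (u, 0))"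

text \<open>Quantities that do not depend on the chart are evaluated in an arbitrarily chosen one.\<close>

definition some_chart :: "('a, 'n::finite) chart set \<Rightarrow> 'a \<Rightarrow> ('a, 'n) chart" where
  "some_chart A x = (SOME \<kappa>. \<kappa> \<in> charts_at A x)"

text \<open>\<open>g_inner A F x v X Y\<close> is \<open>g\<^sub>i\<^sub>j(x, v) X\<^sup>i Y\<^sup>j\<close>.\<close>

definition g_inner ::
    "('a, 'n::finite) chart set \<Rightarrow> ('a, 'n) finsler_fun \<Rightarrow> 'a \<Rightarrow>
     ('a, 'n) tvec \<Rightarrow> ('a, 'n) tvec \<Rightarrow> ('a, 'n) tvec \<Rightarrow> real" where
  "g_inner A F x v X Y = (let \<kappa> = some_chart A x in
     \<Sum>i\<in>UNIV. \<Sum>j\<in>UNIV. g_low (F_loc A F \<kappa>) (snd \<kappa> x) (v \<kappa>) $ i $ j * X \<kappa> $ i * Y \<kappa> $ j)"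


section \<open>Geometry along a curve\<close>

text \<open>From here on a curve \<open>c\<close> is parametrised by \<open>{0..1}\<close>; its values elsewhere are irrelevant.
  A vector field along \<open>c\<close> is a function from the parameter to tangent vectors.\<close>

abbreviation cdot :: "('a, 'n::finite) chart set \<Rightarrow> (real \<Rightarrow> 'a) \<Rightarrow> real \<Rightarrow> ('a, 'n) tvec" where
  "cdot A c \<equiv> velocity A {0..1} c"

definition g_along ::
    "('a, 'n::finite) chart set \<Rightarrow> ('a, 'n) finsler_fun \<Rightarrow> (real \<Rightarrow> 'a) \<Rightarrow> real \<Rightarrow>
     ('a, 'n) tvec \<Rightarrow> ('a, 'n) tvec \<Rightarrow> real" where
  "g_along A F c t X Y = g_inner A F (c t) (cdot A c t) X Y"

definition norm_along ::
    "('a, 'n::finite) chart set \<Rightarrow> ('a, 'n) finsler_fun \<Rightarrow> (real \<Rightarrow> 'a) \<Rightarrow> real \<Rightarrow>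
     ('a, 'n) tvec \<Rightarrow> real" where
  "norm_along A F c t X = sqrt (g_along A F c t X X)"

definition speed ::
    "('a, 'n::finite) chart set \<Rightarrow> ('a, 'n) finsler_fun \<Rightarrow> (real \<Rightarrow> 'a) \<Rightarrow> real \<Rightarrow> real" where
  "speed A F c t = norm_along A F c t (cdot A c t)"

text \<open>The covariant derivative \<open>\<nabla>X/dt\<close> of the Cartan connection.\<close>

definition covariant_deriv ::
    "('a, 'n::finite) chart set \<Rightarrow> ('a, 'n) finsler_fun \<Rightarrow> (real \<Rightarrow> 'a) \<Rightarrow>
     (real \<Rightarrow> ('a, 'n) tvec) \<Rightarrow> real \<Rightarrow> ('a, 'n) tvec" where
  "covariant_deriv A F c X t = (\<lambda>\<kappa>. if \<kappa> \<in> charts_at A (c t) then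
     (let \<Phi> = F_loc A F \<kappa>;
          u = snd \<kappa> (c t);
          c1 = cdot A c t \<kappa>;
          c2 = vector_derivative (\<lambda>\<tau>. cdot A c \<tau> \<kappa>) (at t within {0..1});
          X1 = vector_derivative (\<lambda>\<tau>. X \<tau> \<kappa>) (at t within {0..1})
      in \<chi> i. X1 $ i + (\<Sum>m\<in>UNIV. X t \<kappa> $ m *
           ((\<Sum>k\<in>UNIV. L_coeff \<Phi> i m k u c1 * c1 $ k)
            + (\<Sum>k\<in>UNIV. C_coeff \<Phi> i m k u c1 *
                (c2 $ k + (\<Sum>l\<in>UNIV. N_coeff \<Phi> k l u c1 * c1 $ l))))))
     else 0)"


section \<open>Piecewise smooth curves, variations and the energy\<close>

definition subdivision :: "(nat \<Rightarrow> real) \<Rightarrow> nat \<Rightarrow> bool" where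
  "subdivision \<tau> r \<longleftrightarrow> \<tau> 0 = 0 \<and> \<tau> r = 1 \<and> (\<forall>k<r. \<tau> k < \<tau> (Suc k))"

text \<open>The set \<open>\<Omega>\<close>. At the points of the subdivision both one-sided velocities must be nonzero.\<close>

definition Omega ::
    "'a topology \<Rightarrow> ('a, 'n::finite) chart set \<Rightarrow> 'a \<Rightarrow> 'a \<Rightarrow> (real \<Rightarrow> 'a) set" where
  "Omega M A x0 x1 = {c.
     continuous_map (top_of_set {0..1}) M c \<and> c 0 = x0 \<and> c 1 = x1 \<and>
     (\<exists>\<tau> r. subdivision \<tau> r \<and>
        (\<forall>k<r. smooth_map M A {\<tau> k..\<tau> (Suc k)} c \<and>
           (\<forall>t\<in>{\<tau> k..\<tau> (Suc k)}. velocity A {\<tau> k..\<tau> (Suc k)} c t \<noteq> tvec_zero)))}"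

text \<open>\<open>\<Gamma> s\<close> is the curve \<open>c\<^sub>s\<close>, for \<open>s\<close> between \<open>-\<epsilon>\<close> and \<open>\<epsilon>\<close>.\<close>

definition variation ::
    "'a topology \<Rightarrow> ('a, 'n::finite) chart set \<Rightarrow> 'a \<Rightarrow> 'a \<Rightarrow> (real \<Rightarrow> 'a) \<Rightarrow> real \<Rightarrow>
     (real \<Rightarrow> real \<Rightarrow> 'a) \<Rightarrow> bool" where
  "variation M A x0 x1 c \<epsilon> \<Gamma> \<longleftrightarrow>
     \<epsilon> > 0 \<and>
     (\<forall>s\<in>{-\<epsilon><..<\<epsilon>}. \<Gamma> s \<in> Omega M A x0 x1) \<and>
     (\<forall>t\<in>{0..1}. \<Gamma> 0 t = c t) \<and>
     continuous_map (top_of_set ({-\<epsilon><..<\<epsilon>} \<times> {0..1})) M (\<lambda>(s, t). \<Gamma> s t) \<and>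
     (\<exists>\<tau> r. subdivision \<tau> r \<and>
        (\<forall>k<r. smooth_map M A ({-\<epsilon><..<\<epsilon>} \<times> {\<tau> k..\<tau> (Suc k)}) (\<lambda>(s, t). \<Gamma> s t)))"

definition variation_field ::
    "('a, 'n::finite) chart set \<Rightarrow> real \<Rightarrow> (real \<Rightarrow> real \<Rightarrow> 'a) \<Rightarrow> real \<Rightarrow> ('a, 'n) tvec" where
  "variation_field A \<epsilon> \<Gamma> t = velocity A {-\<epsilon><..<\<epsilon>} (\<lambda>s. \<Gamma> s t) 0"

definition p_energy ::
    "('a, 'n::finite) chart set \<Rightarrow> ('a, 'n) finsler_fun \<Rightarrow> real \<Rightarrow> (real \<Rightarrow> 'a) \<Rightarrow> real" where
  "p_energy A F p c =
     integral {0..1} (\<lambda>t. g_along A F c t (cdot A c t) (cdot A c t) powr (p/2))"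

text \<open>The points of \<open>(0,1)\<close> where the velocity, in coordinates around the point, is
  discontinuous. For a piecewise smooth curve this is where the one-sided velocities differ, since
  otherwise the curve is continuously differentiable near the point.\<close>

definition velocity_jumps :: "('a, 'n::finite) chart set \<Rightarrow> (real \<Rightarrow> 'a) \<Rightarrow> real set" where
  "velocity_jumps A c =
     {t \<in> {0<..<1}. \<not> isCont (\<lambda>\<tau>. cdot A c \<tau> (some_chart A (c t))) t}"

text \<open>\<open>g(X, \<Delta>\<^sub>t(\<parallel>c'\<parallel>\<^sup>p\<^sup>-\<^sup>2 c'))\<close>: right limit minus left limit of the scalar
  \<open>g(X, \<parallel>c'\<parallel>\<^sup>p\<^sup>-\<^sup>2 c')\<close>, where \<open>g\<close> is taken at the velocity on the respective side.\<close>

definition jump_term ::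
    "('a, 'n::finite) chart set \<Rightarrow> ('a, 'n) finsler_fun \<Rightarrow> real \<Rightarrow> (real \<Rightarrow> 'a) \<Rightarrow>
     (real \<Rightarrow> ('a, 'n) tvec) \<Rightarrow> real \<Rightarrow> real" where
  "jump_term A F p c X t = (let
     h = (\<lambda>\<tau>. g_along A F c \<tau> (X \<tau>) (tvec_scale (speed A F c \<tau> powr (p - 2)) (cdot A c \<tau>)))
     in Lim (at_right t) h - Lim (at_left t) h)"

definition variation_integrand ::
    "('a, 'n::finite) chart set \<Rightarrow> ('a, 'n) finsler_fun \<Rightarrow> real \<Rightarrow> (real \<Rightarrow> 'a) \<Rightarrow>
     (real \<Rightarrow> ('a, 'n) tvec) \<Rightarrow> real \<Rightarrow> real" where
  "variation_integrand A F p c X t = (let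
     V = cdot A c t;
     D = covariant_deriv A F c (cdot A c) t
     in speed A F c t powr (p - 4) *
        g_along A F c t (X t)
          (tvec_add (tvec_scale ((speed A F c t)\<^sup>2) D)
                    (tvec_scale ((p - 2) * g_along A F c t D V) V)))"

end

theory Submission
  imports Defs
begin

text \<open>
  In a chart write \<open>E = F\<^sup>2 / 2\<close> as a function of \<open>(x, y)\<close>. By homogeneity, contracting the Cartan
  connection with the velocity removes \<open>C\<close> and \<open>N\<close>, and lowering the index of the covariant
  derivative \<open>D\<close> of the velocity leaves the Euler-Lagrange expression of \<open>E\<close>:
  \<open>g(w, D) = d/dt (E\<^sub>y w) - E\<^sub>x w\<close> for constant \<open>w\<close>; moreover \<open>g(D, c') = dE/dt\<close>. Hence, with the
  momentum \<open>\<mu> = F\<^sup>p\<^sup>-\<^sup>2 g(X, c')\<close>, at every time where the curve is smooth the integrand of the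
  theorem equals \<open>d\<mu>/dt - (1/p) \<partial>\<^sub>s F\<^sup>p\<close>; the symmetry of the mixed derivatives of the variation enters
  here. Since \<open>\<mu>\<close> and \<open>F\<^sup>p\<close> are independent of charts, this pointwise identity may be checked in any
  chart, and the covariant derivative never has to be compared between charts. Integrating over
  the pieces of a subdivision and differentiating \<open>F\<^sup>p\<close> under the integral sign leaves the
  increments of \<open>\<mu>\<close>, which add up to minus its jumps, because \<open>X\<close> vanishes at both ends.
\<close>

section \<open>Iterated directional derivatives\<close>

text \<open>The obstacles sit at the edges of the pieces. At a subdivision point
  \<open>cdot\<close>, a derivative within \<open>{0..1}\<close>, may have no meaning, so each piece
  \<open>{a..b}\<close> carries its own velocity \<open>V\<close>, taken within
  \<open>{a..b}\<close>. It is matched with \<open>cdot\<close> only in the open interval; the ends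
  are discarded as null sets in the integrals and reached as limits in the jumps. The regularity of
  each \<open>\<Gamma> s\<close> refers to a subdivision that may change with s and has to be
  carried over to the single subdivision of the variation. Subdivision points need not be jumps
  either: where the velocity is continuous, the momenta of the two adjacent pieces agree.
  \<open>g_inner\<close> is evaluated in a chart chosen anew at every point, so its continuity in t
  is not visible. The remedy: g(X, v), taken at the vector v itself, is the derivative at a = 0 of
  \<open>F(v + a X)\<^sup>2 / 2\<close>, an expression free of charts, so the metric tensor is never
  transformed. Powers of F are written \<open>(2 * energy) powr (q / 2)\<close>, which reduces all
  differentiation to that of \<open>energy\<close>, smooth off the zero section.\<close>

abbreviation dderiv :: "'a::real_normed_vector \<Rightarrow> ('a \<Rightarrow> 'b::real_normed_vector) \<Rightarrow> 'a \<Rightarrow> 'b" where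
  "dderiv v f \<equiv> (\<lambda>x. frechet_derivative f (at x) v)"

lemma Ck_on_Suc_has_derivative:
  "Ck_on (Suc k) S f \<Longrightarrow> x \<in> S \<Longrightarrow> (f has_derivative frechet_derivative f (at x)) (at x)"
  by (simp add: frechet_derivative_works)

lemma Ck_on_Suc_imp: "Ck_on (Suc k) S f \<Longrightarrow> Ck_on k S f"
proof (induction k arbitrary: f)
  case 0
  then show ?case
    by (auto intro!: continuous_at_imp_continuous_on differentiable_imp_continuous_within)
next
  case (Suc k)
  have "Ck_on k S (dderiv v f)" for v
    using Suc.prems Suc.IH by (simp only: Ck_on.simps) blast
  moreover have "\<forall>x\<in>S. f differentiable (at x)"
    using Suc.prems by simp
  ultimately show ?case
    by simp
qed

lemma Ck_on_antimono: "Ck_on k S f \<Longrightarrow> j \<le> k \<Longrightarrow> Ck_on j S f"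
proof (induction k)
  case (Suc k)
  then show ?case
    by (metis Ck_on_Suc_imp le_Suc_eq)
qed simp

lemma Ck_on_imp_continuous_on: "Ck_on k S f \<Longrightarrow> continuous_on S f"
  using Ck_on_antimono[of k S f 0] by simp

text \<open>On an open set the values of a function fix its Frechet derivatives, so the induction
  can pass to the derivatives. This permits replacing a derivative by its formula when the formula
  is known on S only.\<close>

lemma Ck_on_cong:
  assumes "open S" "\<And>x. x \<in> S \<Longrightarrow> f x = g x" "Ck_on k S f"
  shows "Ck_on k S g"
  using assms(2,3)
proof (induction k arbitrary: f g)
  case 0
  then show ?case
    using continuous_on_cong[of S S f g] by simp
next
  case (Suc k)
  have d: "(g has_derivative frechet_derivative f (at x)) (at x)" if "x \<in> S" for x
    using Ck_on_Suc_has_derivative[OF Suc.prems(2) that] Suc.prems(1) \<open>open S\<close> that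
    by (meson has_derivative_transform_within_open)
  then have "frechet_derivative f (at x) = frechet_derivative g (at x)" if "x \<in> S" for x
    using that frechet_derivative_at by blast
  then have "Ck_on k S (dderiv v g)" for v
    using Suc.IH[of "dderiv v f" "dderiv v g"] Suc.prems by simp
  with d show ?case
    by (auto simp: differentiable_def)
qed

section \<open>Closure of C^k functions under sums and products\<close>

lemma Ck_on_const: "Ck_on k S (\<lambda>_. c)"
  by (induction k arbitrary: c) auto

lemma Ck_on_add:
  assumes "open S" "Ck_on k S f" "Ck_on k S g"
  shows "Ck_on k S (\<lambda>x. f x + g x)"
  using assms(2,3)
proof (induction k arbitrary: f g)
  case 0
  then show ?case by (simp add: continuous_on_add)
next
  case (Suc k)
  have d: "((\<lambda>x. f x + g x) has_derivative
      (\<lambda>v. frechet_derivative f (at x) v + frechet_derivative g (at x) v)) (at x)" if "x \<in> S" for x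
    using Ck_on_Suc_has_derivative that Suc.prems by (blast intro: has_derivative_add)
  have "Ck_on k S (dderiv v (\<lambda>x. f x + g x))" for v
  proof (rule Ck_on_cong[OF \<open>open S\<close>])
    show "Ck_on k S (\<lambda>x. dderiv v f x + dderiv v g x)"
      using Suc by simp
  qed (use frechet_derivative_at[OF d] in \<open>simp add: fun_eq_iff\<close>)
  with d show ?case
    by (auto simp: differentiable_def)
qed

lemma Ck_on_mult:
  fixes f g :: "'a::euclidean_space \<Rightarrow> real"
  assumes "open S" "Ck_on k S f" "Ck_on k S g"
  shows "Ck_on k S (\<lambda>x. f x * g x)"
  using assms(2,3)
proof (induction k arbitrary: f g)
  case 0
  then show ?case by (simp add: continuous_on_mult)
next
  case (Suc k)
  have d: "((\<lambda>x. f x * g x) has_derivative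
      (\<lambda>v. f x * frechet_derivative g (at x) v + frechet_derivative f (at x) v * g x)) (at x)"
    if "x \<in> S" for x
    using Ck_on_Suc_has_derivative that Suc.prems by (blast intro: has_derivative_mult)
  have "Ck_on k S (dderiv v (\<lambda>x. f x * g x))" for v
  proof (rule Ck_on_cong[OF \<open>open S\<close>])
    \<comment> \<open>The product rule also contains the undifferentiated factors, whose order is
      lowered from \<open>Suc k\<close> to \<open>k\<close>.\<close>
    have "Ck_on k S f" "Ck_on k S g"
      using Suc.prems Ck_on_Suc_imp by blast+
    then show "Ck_on k S (\<lambda>x. f x * dderiv v g x + dderiv v f x * g x)"
      using Suc by (intro Ck_on_add \<open>open S\<close>) auto
  qed (use frechet_derivative_at[OF d] in \<open>simp add: fun_eq_iff\<close>)
  with d show ?case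
    by (auto simp: differentiable_def)
qed

lemma has_vector_derivative_compose_frechet:
  assumes "f differentiable (at (z t))" "(z has_vector_derivative z') (at t within T)"
  shows "((\<lambda>t. f (z t)) has_vector_derivative frechet_derivative f (at (z t)) z') (at t within T)"
proof -
  have d: "(f has_derivative frechet_derivative f (at (z t))) (at (z t))"
    using assms(1) frechet_derivative_works by blast
  have "((\<lambda>t. f (z t)) has_derivative (\<lambda>h. frechet_derivative f (at (z t)) (h *\<^sub>R z'))) (at t within T)"
    by (rule has_derivative_compose[OF assms(2)[unfolded has_vector_derivative_def] d])
  then show ?thesis
    unfolding has_vector_derivative_def
    using linear_cmul[OF linear_frechet_derivative[OF assms(1)]] by simp
qed

text \<open>The mean value inequality is applied twice: in q to the derivative of f along v, then in
  s to the increment of f along w. The statement favours one order of differentiation; exchanging v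
  and w gives the other.\<close>

lemma second_difference_bound:
  fixes f :: "'a::euclidean_space \<Rightarrow> 'b::euclidean_space"
  assumes S: "open S" "x \<in> S" and f: "Ck_on 2 S f" and "e > 0"
  shows "\<exists>\<delta>>0. \<forall>t. 0 < t \<and> t < \<delta> \<longrightarrow>
    norm (f (x + t *\<^sub>R v + t *\<^sub>R w) - f (x + t *\<^sub>R v) - f (x + t *\<^sub>R w) + f x
      - (t * t) *\<^sub>R dderiv w (dderiv v f) x) \<le> t * t * e"
proof -
  let ?A = "dderiv w (dderiv v f) x"
  have f1: "Ck_on (Suc 1) S f" and f2: "Ck_on (Suc 0) S (dderiv v f)"
    and f3: "Ck_on 0 S (dderiv w (dderiv v f))"
    using f by (simp_all add: numeral_2_eq_2)
  from f3 have "isCont (dderiv w (dderiv v f)) x"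
    using S continuous_on_eq_continuous_at by auto
  then obtain r0 where r0: "r0 > 0" "\<And>z. dist z x < r0 \<Longrightarrow> dist (dderiv w (dderiv v f) z) ?A < e"
    using \<open>e > 0\<close> unfolding continuous_at_eps_delta by blast
  obtain r1 where r1: "r1 > 0" "ball x r1 \<subseteq> S"
    using S open_contains_ball by blast
  define r where "r = min r0 r1"
  have r: "r > 0" "\<And>z. z \<in> ball x r \<Longrightarrow> z \<in> S \<and> norm (dderiv w (dderiv v f) z - ?A) \<le> e"
    using r0 r1 by (auto simp: r_def dist_commute dist_norm less_imp_le)
  \<comment> \<open>This keeps the parallelogram with sides \<open>t *\<^sub>R v\<close> and
    \<open>t *\<^sub>R w\<close> inside the ball of radius r; the summand 1 covers v = w =
    0.\<close>
  define \<delta> where "\<delta> = r / (norm v + norm w + 1)"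
  have "\<delta> > 0"
    using r by (auto simp: \<delta>_def intro!: divide_pos_pos add_nonneg_pos)
  have in_ball: "x + s *\<^sub>R v + q *\<^sub>R w \<in> ball x r" if "0 \<le> s" "s \<le> t" "0 \<le> q" "q \<le> t" "t < \<delta>" for s q t
  proof -
    have "norm (s *\<^sub>R v + q *\<^sub>R w) \<le> t * norm v + t * norm w"
      using that by (intro norm_triangle_le add_mono) (auto intro!: mult_right_mono)
    also have "\<dots> \<le> t * (norm v + norm w + 1)"
      using that by (simp add: algebra_simps)
    also have "\<dots> < \<delta> * (norm v + norm w + 1)"
      using that by (intro mult_strict_right_mono) (auto intro: add_nonneg_pos)
    also have "\<dots> = r"
      unfolding \<delta>_def using add_nonneg_pos[of "norm v + norm w" 1] by (simp add: field_simps)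
    finally show ?thesis
      by (metis add.assoc dist_add_cancel dist_commute dist_norm add_diff_cancel_left' mem_ball)
  qed
  have "norm (f (x + t *\<^sub>R v + t *\<^sub>R w) - f (x + t *\<^sub>R v) - f (x + t *\<^sub>R w) + f x - (t * t) *\<^sub>R ?A)
      \<le> t * t * e" if t: "0 < t" "t < \<delta>" for t
  proof -
    have dv: "norm (dderiv v f (x + s *\<^sub>R v + t *\<^sub>R w) - dderiv v f (x + s *\<^sub>R v) - t *\<^sub>R ?A) \<le> t * e"
      if s: "s \<in> {0..t}" for s
    proof -
      let ?k = "\<lambda>q. dderiv v f (x + s *\<^sub>R v + q *\<^sub>R w) - q *\<^sub>R ?A"
      have "norm (?k t - ?k 0) \<le> e * norm (t - 0)"
      proof (rule differentiable_bound[where S = "{0..t}"])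
        fix q assume q: "q \<in> {0..t}"
        have zS: "x + s *\<^sub>R v + q *\<^sub>R w \<in> S"
          using in_ball[of s t q] r(2) q s t by auto
        have "((\<lambda>q. dderiv v f (x + s *\<^sub>R v + q *\<^sub>R w)) has_vector_derivative
            dderiv w (dderiv v f) (x + s *\<^sub>R v + q *\<^sub>R w)) (at q within {0..t})"
          using f2 zS by (intro has_vector_derivative_compose_frechet) (auto intro!: derivative_eq_intros)
        then show "(?k has_derivative (\<lambda>h. h *\<^sub>R (dderiv w (dderiv v f) (x + s *\<^sub>R v + q *\<^sub>R w) - ?A)))
            (at q within {0..t})"
          unfolding has_vector_derivative_def[symmetric] by (auto intro!: derivative_eq_intros)
        have "norm (dderiv w (dderiv v f) (x + s *\<^sub>R v + q *\<^sub>R w) - ?A) \<le> e"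
          using in_ball[of s t q] r(2) q s t by auto
        then show "onorm (\<lambda>h. h *\<^sub>R (dderiv w (dderiv v f) (x + s *\<^sub>R v + q *\<^sub>R w) - ?A)) \<le> e"
          by (intro onorm_le) (simp add: mult.commute[of _ "norm _"] mult_right_mono)
      qed (use t in auto)
      then show ?thesis
        using t by (simp add: algebra_simps)
    qed
    let ?g = "\<lambda>s. f (x + s *\<^sub>R v + t *\<^sub>R w) - f (x + s *\<^sub>R v) - (s * t) *\<^sub>R ?A"
    have "norm (?g t - ?g 0) \<le> (t * e) * norm (t - 0)"
    proof (rule differentiable_bound[where S = "{0..t}"])
      fix s assume s: "s \<in> {0..t}"
      have zS: "x + s *\<^sub>R v + t *\<^sub>R w \<in> S" "x + s *\<^sub>R v \<in> S"
        using in_ball[of s t t] in_ball[of s t 0] r(2) s t by auto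
      have "((\<lambda>s. f (x + s *\<^sub>R v + t *\<^sub>R w)) has_vector_derivative
            dderiv v f (x + s *\<^sub>R v + t *\<^sub>R w)) (at s within {0..t})"
          "((\<lambda>s. f (x + s *\<^sub>R v)) has_vector_derivative dderiv v f (x + s *\<^sub>R v)) (at s within {0..t})"
        using f1 zS by (intro has_vector_derivative_compose_frechet; auto intro!: derivative_eq_intros)+
      then show "(?g has_derivative (\<lambda>h. h *\<^sub>R (dderiv v f (x + s *\<^sub>R v + t *\<^sub>R w) - dderiv v f (x + s *\<^sub>R v) - t *\<^sub>R ?A)))
            (at s within {0..t})"
        unfolding has_vector_derivative_def[symmetric] by (auto intro!: derivative_eq_intros)
      show "onorm (\<lambda>h. h *\<^sub>R (dderiv v f (x + s *\<^sub>R v + t *\<^sub>R w) - dderiv v f (x + s *\<^sub>R v) - t *\<^sub>R ?A)) \<le> t * e"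
        using dv[OF s] by (intro onorm_le) (simp add: mult.commute[of _ "norm _"] mult_right_mono)
    qed (use t in auto)
    moreover have "?g t - ?g 0 = f (x + t *\<^sub>R v + t *\<^sub>R w) - f (x + t *\<^sub>R v) - f (x + t *\<^sub>R w) + f x - (t * t) *\<^sub>R ?A"
      by (simp add: algebra_simps)
    ultimately show ?thesis
      using t by (simp only: mult_ac) simp
  qed
  with \<open>\<delta> > 0\<close> show ?thesis by blast
qed

text \<open>The second difference is unchanged when v and w are exchanged, and after division by
  \<open>t * t\<close> both mixed derivatives are its limit as t tends to 0.\<close>

lemma dderiv_commute:
  fixes f :: "'a::euclidean_space \<Rightarrow> 'b::euclidean_space"
  assumes S: "open S" "x \<in> S" and f: "Ck_on 2 S f"
  shows "dderiv v (dderiv w f) x = dderiv w (dderiv v f) x"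
proof -
  let ?A = "dderiv v (dderiv w f) x" and ?B = "dderiv w (dderiv v f) x"
  have "norm (?A - ?B) \<le> 0 + e" if "e > 0" for e
  proof -
    have "e / 2 > 0" using that by simp
    obtain d1 where d1: "d1 > 0" "\<And>t. 0 < t \<Longrightarrow> t < d1 \<Longrightarrow>
        norm (f (x + t *\<^sub>R v + t *\<^sub>R w) - f (x + t *\<^sub>R v) - f (x + t *\<^sub>R w) + f x
        - (t * t) *\<^sub>R ?B) \<le> t * t * (e / 2)"
      using second_difference_bound[OF S f \<open>e / 2 > 0\<close>, of v w] by blast
    obtain d2 where d2: "d2 > 0" "\<And>t. 0 < t \<Longrightarrow> t < d2 \<Longrightarrow>
        norm (f (x + t *\<^sub>R w + t *\<^sub>R v) - f (x + t *\<^sub>R w) - f (x + t *\<^sub>R v) + f x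
        - (t * t) *\<^sub>R ?A) \<le> t * t * (e / 2)"
      using second_difference_bound[OF S f \<open>e / 2 > 0\<close>, of w v] by blast
    define t where "t = min d1 d2 / 2"
    have t: "0 < t" "t < d1" "t < d2"
      using d1(1) d2(1) by (auto simp: t_def)
    have "norm ((t * t) *\<^sub>R (?A - ?B)) = norm
        ((f (x + t *\<^sub>R v + t *\<^sub>R w) - f (x + t *\<^sub>R v) - f (x + t *\<^sub>R w) + f x - (t * t) *\<^sub>R ?B)
        - (f (x + t *\<^sub>R w + t *\<^sub>R v) - f (x + t *\<^sub>R w) - f (x + t *\<^sub>R v) + f x - (t * t) *\<^sub>R ?A))"
      by (rule arg_cong[where f = norm]) (simp add: algebra_simps)
    also have "\<dots> \<le> t * t * (e / 2) + t * t * (e / 2)"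
      using d1(2)[OF t(1,2)] d2(2)[OF t(1,3)] by (meson add_mono norm_triangle_ineq4 order_trans)
    finally have "(t * t) * norm (?A - ?B) \<le> (t * t) * e"
      unfolding norm_scaleR by (simp add: mult_ac)
    then show ?thesis
      using t by (metis add_0 mult_le_cancel_left_pos mult_pos_pos)
  qed
  then have "norm (?A - ?B) \<le> 0"
    by (rule field_le_epsilon)
  then show ?thesis by simp
qed

lemma frechet_derivative_eq_sum_Basis:
  fixes f :: "'a::euclidean_space \<Rightarrow> 'b::real_normed_vector"
  assumes "f differentiable (at x)"
  shows "frechet_derivative f (at x) w = (\<Sum>b\<in>Basis. (w \<bullet> b) *\<^sub>R frechet_derivative f (at x) b)"
proof -
  have lin: "linear (frechet_derivative f (at x))"
    using assms by (rule linear_frechet_derivative)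
  have "frechet_derivative f (at x) w = frechet_derivative f (at x) (\<Sum>b\<in>Basis. (w \<bullet> b) *\<^sub>R b)"
    by (simp add: euclidean_representation)
  then show ?thesis
    by (simp add: linear_sum[OF lin] linear_cmul[OF lin])
qed

text \<open>\<open>Ck_on\<close> speaks of fixed directions only; a moving direction is expanded in
  the basis, with continuous coefficients.\<close>

lemma continuous_on_dderiv_compose:
  fixes f :: "'a::euclidean_space \<Rightarrow> 'b::euclidean_space"
  assumes "Ck_on (Suc k) Z f" "continuous_on T z" "continuous_on T w" "\<And>t. t \<in> T \<Longrightarrow> z t \<in> Z"
  shows "continuous_on T (\<lambda>t. frechet_derivative f (at (z t)) (w t))"
proof -
  have "continuous_on Z (dderiv b f)" for b
    using assms(1) Ck_on_imp_continuous_on[of k Z "dderiv b f"] by simp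
  then have c: "continuous_on T (\<lambda>t. frechet_derivative f (at (z t)) b)" for b
    using continuous_on_compose2[of Z "dderiv b f" T z] assms(2,4) by blast
  have "continuous_on T (\<lambda>t. \<Sum>b\<in>Basis. (w t \<bullet> b) *\<^sub>R frechet_derivative f (at (z t)) b)"
    by (intro continuous_intros c assms(3))
  moreover have "frechet_derivative f (at (z t)) (w t) = (\<Sum>b\<in>Basis. (w t \<bullet> b) *\<^sub>R frechet_derivative f (at (z t)) b)"
    if "t \<in> T" for t
    using assms(1,4) that by (intro frechet_derivative_eq_sum_Basis) auto
  ultimately show ?thesis
    by (metis (no_types, lifting) continuous_on_cong)
qed

text \<open>Expanding the moving direction in the basis gives a product rule: one term from the
  motion of the base point with the direction frozen at \<open>w t\<close>, one from the motion of
  the direction.\<close>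

lemma has_vector_derivative_frechet_along:
  fixes f :: "'a::euclidean_space \<Rightarrow> 'b::euclidean_space"
  assumes Z: "open Z" and f: "Ck_on 2 Z f" and T: "open T" "t \<in> T" "\<And>\<tau>. \<tau> \<in> T \<Longrightarrow> z \<tau> \<in> Z"
    and z: "(z has_vector_derivative z') (at t)" and w: "(w has_vector_derivative w') (at t)"
  shows "((\<lambda>\<tau>. frechet_derivative f (at (z \<tau>)) (w \<tau>)) has_vector_derivative
    dderiv z' (dderiv (w t) f) (z t) + dderiv w' f (z t)) (at t)"
proof -
  have f1: "f differentiable (at (z \<tau>))" if "\<tau> \<in> T" for \<tau>
    using f T(3)[OF that] by (simp add: numeral_2_eq_2)
  have f2: "dderiv b f differentiable (at (z t))" for b
    using f T(3)[OF T(2)] by (simp add: numeral_2_eq_2)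
  let ?B = "\<lambda>b. dderiv b f"
  have "((\<lambda>\<tau>. (w \<tau> \<bullet> b) *\<^sub>R ?B b (z \<tau>)) has_vector_derivative
      (w t \<bullet> b) *\<^sub>R dderiv z' (?B b) (z t) + (w' \<bullet> b) *\<^sub>R ?B b (z t)) (at t)" for b
  proof -
    have "((\<lambda>\<tau>. w \<tau> \<bullet> b) has_real_derivative (w' \<bullet> b)) (at t)"
      using bounded_linear.has_vector_derivative[OF bounded_linear_inner_left w]
      by (simp add: has_real_derivative_iff_has_vector_derivative)
    from has_vector_derivative_scaleR[OF this has_vector_derivative_compose_frechet[OF f2 z]]
    show ?thesis .
  qed
  then have "((\<lambda>\<tau>. \<Sum>b\<in>Basis. (w \<tau> \<bullet> b) *\<^sub>R ?B b (z \<tau>)) has_vector_derivative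
      (\<Sum>b\<in>Basis. (w t \<bullet> b) *\<^sub>R dderiv z' (?B b) (z t) + (w' \<bullet> b) *\<^sub>R ?B b (z t))) (at t)"
    by (intro has_vector_derivative_sum)
  \<comment> \<open>The coefficients are constants here, so the sum is the derivative along
    \<open>z'\<close> of the single function \<open>dderiv (w t) f\<close>.\<close>
  moreover have "(\<Sum>b\<in>Basis. (w t \<bullet> b) *\<^sub>R dderiv z' (?B b) (z t)) = dderiv z' (dderiv (w t) f) (z t)"
  proof -
    have "((\<lambda>x. \<Sum>b\<in>Basis. (w t \<bullet> b) *\<^sub>R ?B b x) has_derivative
        (\<lambda>v. \<Sum>b\<in>Basis. (w t \<bullet> b) *\<^sub>R frechet_derivative (?B b) (at (z t)) v)) (at (z t))"
      using f2 frechet_derivative_works by (intro has_derivative_sum has_derivative_scaleR_right) blast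
    then have "(dderiv (w t) f has_derivative
        (\<lambda>v. \<Sum>b\<in>Basis. (w t \<bullet> b) *\<^sub>R frechet_derivative (?B b) (at (z t)) v)) (at (z t))"
    proof (rule has_derivative_transform_within_open[OF _ Z])
      show "(\<Sum>b\<in>Basis. (w t \<bullet> b) *\<^sub>R ?B b x) = dderiv (w t) f x" if "x \<in> Z" for x
        using f that by (subst frechet_derivative_eq_sum_Basis[of f x "w t"]) (simp_all add: numeral_2_eq_2)
    qed (use T in auto)
    from fun_cong[OF frechet_derivative_at[OF this], of z'] show ?thesis by simp
  qed
  moreover have "(\<Sum>b\<in>Basis. (w' \<bullet> b) *\<^sub>R ?B b (z t)) = dderiv w' f (z t)"
    using frechet_derivative_eq_sum_Basis[OF f1[OF T(2)], of w'] by simp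
  ultimately have "((\<lambda>\<tau>. \<Sum>b\<in>Basis. (w \<tau> \<bullet> b) *\<^sub>R ?B b (z \<tau>)) has_vector_derivative
      dderiv z' (dderiv (w t) f) (z t) + dderiv w' f (z t)) (at t)"
    by (simp only: sum.distrib)
  then show ?thesis
  proof (rule has_vector_derivative_transform_within_open[OF _ T(1,2)])
    show "(\<Sum>b\<in>Basis. (w \<tau> \<bullet> b) *\<^sub>R ?B b (z \<tau>)) = frechet_derivative f (at (z \<tau>)) (w \<tau>)" if "\<tau> \<in> T" for \<tau>
      by (rule frechet_derivative_eq_sum_Basis[OF f1[OF that], symmetric])
  qed
qed

lemma continuous_on_local:
  fixes f :: "'a::t2_space \<Rightarrow> 'b::topological_space"
  assumes "\<And>x. x \<in> S \<Longrightarrow> \<exists>W. open W \<and> x \<in> W \<and> continuous_on (W \<inter> S) f"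
  shows "continuous_on S f"
  unfolding continuous_on_eq_continuous_within
proof
  fix x assume x: "x \<in> S"
  from assms[OF this] obtain W where W: "open W" "x \<in> W" "continuous_on (W \<inter> S) f"
    by (elim exE conjE)
  then have "continuous (at x within W \<inter> S) f"
    using x by (simp only: continuous_on_eq_continuous_within) simp
  moreover have "at x within W \<inter> S = at x within S"
    using W(1,2) by (intro at_within_nhd[of x W]) auto
  ultimately show "continuous (at x within S) f"
    by simp
qed

section \<open>Finsler functions in a coordinate domain\<close>

lemma pair_eq_sum_axis:
  fixes v w :: "real^'n::finite"
  shows "(v, w) = (\<Sum>i\<in>UNIV. v $ i *\<^sub>R (axis i 1, 0)) + (\<Sum>i\<in>UNIV. w $ i *\<^sub>R (0, axis i 1))"
proof -
  have "(\<Sum>i\<in>UNIV. x $ i *\<^sub>R axis i 1) = x" for x :: "real^'n"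
    using basis_expansion[of x] by (simp add: scalar_mult_eq_scaleR)
  then show ?thesis
    by (simp add: prod_eq_iff fst_sum snd_sum)
qed

lemma frechet_derivative_pair_eq_sum:
  fixes f :: "(real^'n::finite) \<times> (real^'n) \<Rightarrow> 'b::real_normed_vector"
  assumes "f differentiable (at z)"
  shows "frechet_derivative f (at z) (v, w) =
    (\<Sum>i\<in>UNIV. v $ i *\<^sub>R dderiv (axis i 1, 0) f z) + (\<Sum>i\<in>UNIV. w $ i *\<^sub>R dderiv (0, axis i 1) f z)"
proof -
  have lin: "linear (frechet_derivative f (at z))"
    using assms by (rule linear_frechet_derivative)
  show ?thesis
    by (subst pair_eq_sum_axis) (simp only: linear_sum[OF lin] linear_add[OF lin] linear_cmul[OF lin])
qed

text \<open>The definitions differentiate in one slot, while smoothness is joint in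
  \<open>(u, y)\<close>. This lemma and the next turn a \<open>pd\<close> into a directional
  derivative on the product.\<close>

lemma pd_fst_slice:
  assumes "f differentiable (at (u, y))"
  shows "pd i (\<lambda>u'. f (u', y)) u = dderiv (axis i 1, 0) f (u, y)"
proof -
  have "(f has_derivative frechet_derivative f (at (u, y))) (at (u, y))"
    using assms frechet_derivative_works by blast
  moreover have "((\<lambda>u'. (u', y)) has_derivative (\<lambda>v. (v, 0))) (at u)"
    by (auto intro!: derivative_eq_intros)
  ultimately have "((\<lambda>u'. f (u', y)) has_derivative (\<lambda>v. frechet_derivative f (at (u, y)) (v, 0))) (at u)"
    by (rule has_derivative_compose[rotated])
  then show ?thesis
    unfolding pd_def by (simp add: frechet_derivative_at[symmetric])
qed

lemma pd_snd_slice: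
  assumes "f differentiable (at (u, y))"
  shows "pd i (\<lambda>y'. f (u, y')) y = dderiv (0, axis i 1) f (u, y)"
proof -
  have "(f has_derivative frechet_derivative f (at (u, y))) (at (u, y))"
    using assms frechet_derivative_works by blast
  moreover have "((\<lambda>y'. (u, y')) has_derivative (\<lambda>v. (0, v))) (at y)"
    by (auto intro!: derivative_eq_intros)
  ultimately have "((\<lambda>y'. f (u, y')) has_derivative (\<lambda>v. frechet_derivative f (at (u, y)) (0, v))) (at y)"
    by (rule has_derivative_compose[rotated])
  then show ?thesis
    unfolding pd_def by (simp add: frechet_derivative_at[symmetric])
qed

text \<open>\<open>frechet_derivative\<close> is a choice among the derivatives at x, and functions
  that agree near x have the same ones.\<close>

lemma pd_cong:
  assumes "open S" "x \<in> S" "\<And>z. z \<in> S \<Longrightarrow> f z = g z"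
  shows "pd i f x = pd i g x"
proof -
  have "(f has_derivative D) (at x) \<longleftrightarrow> (g has_derivative D) (at x)" for D
    using assms by (metis has_derivative_transform_within_open)
  then show ?thesis
    unfolding pd_def frechet_derivative_def by presburger
qed

locale finsler_domain =
  fixes \<Phi> :: "'n::finite local_finsler" and U :: "(real^'n) set"
  assumes open_U: "open U"
    and smooth: "smooth_on (U \<times> (- {0})) (\<lambda>(u, y). \<Phi> u y)"
    and homogeneous: "\<And>u y a. u \<in> U \<Longrightarrow> \<Phi> u (a *\<^sub>R y) = \<bar>a\<bar> * \<Phi> u y"
    and positive: "\<And>u y. u \<in> U \<Longrightarrow> y \<noteq> 0 \<Longrightarrow> \<Phi> u y > 0"
    and pos_def: "\<And>u y w. u \<in> U \<Longrightarrow> y \<noteq> 0 \<Longrightarrow> w \<noteq> 0 \<Longrightarrow>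
      (\<Sum>i\<in>UNIV. \<Sum>j\<in>UNIV. g_low \<Phi> u y $ i $ j * w $ i * w $ j) > 0"
begin

text \<open>The factor one half makes the Hessian in y equal to the metric, as
  \<open>g_low_eq\<close> records. The argument is a pair so that iterated derivatives may mix
  positions and directions.\<close>

definition energy :: "(real^'n) \<times> (real^'n) \<Rightarrow> real" where
  "energy z = (\<Phi> (fst z) (snd z))\<^sup>2 / 2"

abbreviation ex :: "'n \<Rightarrow> (real^'n) \<times> (real^'n)" where "ex i \<equiv> (axis i 1, 0)"
abbreviation ey :: "'n \<Rightarrow> (real^'n) \<times> (real^'n)" where "ey i \<equiv> (0, axis i 1)"

lemma open_Z: "open (U \<times> (- {0::real^'n}))"
  using open_U by (intro open_Times) auto

lemma energy_Ck: "Ck_on k (U \<times> (- {0})) energy"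
proof -
  have "Ck_on k (U \<times> (- {0})) (\<lambda>(u, y). \<Phi> u y)"
    using smooth by (simp add: smooth_on_def)
  from Ck_on_mult[OF open_Z Ck_on_const[of _ _ "1/2"] Ck_on_mult[OF open_Z this this]]
  show ?thesis
    by (rule Ck_on_cong[OF open_Z, rotated]) (auto simp: energy_def power2_eq_square)
qed

lemma dderiv_energy_Ck: "Ck_on k (U \<times> (- {0})) (dderiv v energy)"
  using energy_Ck[of "Suc k"] unfolding Ck_on.simps by blast

lemma dderiv2_energy_Ck: "Ck_on k (U \<times> (- {0})) (dderiv w (dderiv v energy))"
  using dderiv_energy_Ck[of "Suc k" v] unfolding Ck_on.simps by blast

lemma energy_differentiable:
  assumes "u \<in> U" "y \<noteq> 0"
  shows "energy differentiable (at (u, y))"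
    "dderiv v energy differentiable (at (u, y))"
    "dderiv w (dderiv v energy) differentiable (at (u, y))"
  using energy_Ck[of 1] dderiv_energy_Ck[of 1] dderiv2_energy_Ck[of 1] assms by simp_all

lemma g_low_eq:
  assumes "u \<in> U" "y \<noteq> 0"
  shows "g_low \<Phi> u y $ i $ j = dderiv (ey i) (dderiv (ey j) energy) (u, y)"
proof -
  have op: "open (- {0::real^'n})" by auto
  have *: "pd j (\<lambda>y'. (\<Phi> u y')\<^sup>2) y' = 2 * dderiv (ey j) energy (u, y')" if "y' \<in> - {0}" for y'
  proof -
    have "((\<lambda>z. (2::real) * energy z) has_derivative (\<lambda>v. 2 * frechet_derivative energy (at (u, y')) v)) (at (u, y'))"
      using energy_differentiable(1)[of u y'] that assms(1) frechet_derivative_works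
      by (auto intro!: derivative_eq_intros)
    from pd_snd_slice[of "\<lambda>z. 2 * energy z" u y' j] frechet_derivative_at[OF this] this
    show ?thesis
      by (auto simp: energy_def differentiable_def fun_eq_iff)
  qed
  have "pd i (pd j (\<lambda>y'. (\<Phi> u y')\<^sup>2)) y = pd i (\<lambda>y'. 2 * dderiv (ey j) energy (u, y')) y"
    by (rule pd_cong[OF op]) (use assms * in auto)
  also have "\<dots> = 2 * dderiv (ey i) (dderiv (ey j) energy) (u, y)"
  proof -
    have "((\<lambda>z. 2 * dderiv (ey j) energy z) has_derivative (\<lambda>v. 2 * frechet_derivative (dderiv (ey j) energy) (at (u, y)) v)) (at (u, y))"
      using energy_differentiable(2)[of u y] assms frechet_derivative_works
      by (auto intro!: derivative_eq_intros)
    from pd_snd_slice[of "\<lambda>z. 2 * dderiv (ey j) energy z" u y i] frechet_derivative_at[OF this] this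
    show ?thesis
      by (auto simp: differentiable_def fun_eq_iff)
  qed
  finally show ?thesis
    by (simp add: g_low_def)
qed

section \<open>Symmetry and homogeneity relations of energy and metric\<close>

lemma energy_dderiv_commute:
  assumes "u \<in> U" "y \<noteq> 0"
  shows "dderiv v (dderiv w energy) (u, y) = dderiv w (dderiv v energy) (u, y)"
  by (rule dderiv_commute[OF open_Z _ energy_Ck]) (use assms in auto)

lemma g_low_sym:
  assumes "u \<in> U" "y \<noteq> 0"
  shows "g_low \<Phi> u y $ i $ j = g_low \<Phi> u y $ j $ i"
  by (simp add: g_low_eq[OF assms] energy_dderiv_commute[OF assms, where v = "ey i" and w = "ey j"])

text \<open>Euler's relation in degree 2: along the ray \<open>a *\<^sub>R y\<close> the energy is
  \<open>a\<^sup>2\<close> times its value at y, and both expressions are differentiated at a =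
  1.\<close>

lemma euler_energy:
  assumes "u \<in> U" "y \<noteq> 0"
  shows "(\<Sum>j\<in>UNIV. y $ j * dderiv (ey j) energy (u, y)) = 2 * energy (u, y)"
proof -
  have "((\<lambda>a::real. (u, a *\<^sub>R y)) has_vector_derivative (0, y)) (at 1)"
    unfolding has_vector_derivative_def by (auto intro!: derivative_eq_intros)
  from has_vector_derivative_compose_frechet[OF _ this, of energy]
  have "((\<lambda>a. energy (u, a *\<^sub>R y)) has_vector_derivative dderiv (0, y) energy (u, y)) (at 1)"
    using energy_differentiable(1)[OF assms] by simp
  moreover have "(\<lambda>a. energy (u, a *\<^sub>R y)) = (\<lambda>a. a\<^sup>2 * energy (u, y))"
    using homogeneous[OF assms(1)] by (auto simp: energy_def power_mult_distrib)
  moreover have "((\<lambda>a. a\<^sup>2 * energy (u, y)) has_vector_derivative 2 * energy (u, y)) (at 1)"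
    unfolding has_real_derivative_iff_has_vector_derivative[symmetric]
    by (auto intro!: derivative_eq_intros)
  ultimately have "dderiv (0, y) energy (u, y) = 2 * energy (u, y)"
    by (metis vector_derivative_unique_at)
  then show ?thesis
    using frechet_derivative_pair_eq_sum[OF energy_differentiable(1)[OF assms], of 0 y] by simp
qed

text \<open>Euler's relation differentiated along v. The subtracted term comes from the coefficients
  y, which move by \<open>snd v\<close>; it vanishes for directions in x.\<close>

lemma dderiv_euler_energy:
  assumes "u \<in> U" "y \<noteq> 0"
  shows "(\<Sum>j\<in>UNIV. y $ j * dderiv v (dderiv (ey j) energy) (u, y)) = 2 * dderiv v energy (u, y) - dderiv (0, snd v) energy (u, y)"
proof -
  let ?f = "\<lambda>z. \<Sum>j\<in>UNIV. snd z $ j * dderiv (ey j) energy z"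
  have d: "(dderiv (ey j) energy has_derivative frechet_derivative (dderiv (ey j) energy) (at (u, y))) (at (u, y))" for j
    using energy_differentiable(2)[OF assms] frechet_derivative_works by blast
  have dF: "(?f has_derivative (\<lambda>v. \<Sum>j\<in>UNIV. y $ j * frechet_derivative (dderiv (ey j) energy) (at (u, y)) v
      + snd v $ j * dderiv (ey j) energy (u, y))) (at (u, y))"
    by (rule derivative_eq_intros d bounded_linear.has_derivative[OF bounded_linear_vec_nth] refl | simp)+
  have *: "(\<Sum>j\<in>UNIV. snd z $ j * dderiv (ey j) energy z) = 2 * energy z" if "z \<in> U \<times> (- {0})" for z
    using that by (cases z) (simp add: euler_energy)
  have "((\<lambda>z. 2 * energy z) has_derivative (\<lambda>v. \<Sum>j\<in>UNIV. y $ j * frechet_derivative (dderiv (ey j) energy) (at (u, y)) v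
      + snd v $ j * dderiv (ey j) energy (u, y))) (at (u, y))"
  proof (rule has_derivative_transform_within_open[OF dF open_Z])
    show "(u, y) \<in> U \<times> - {0}" using assms by simp
  qed (fact *)
  moreover have "((\<lambda>z. 2 * energy z) has_derivative (\<lambda>v. 2 * frechet_derivative energy (at (u, y)) v)) (at (u, y))"
    using energy_differentiable(1)[OF assms] frechet_derivative_works
    by (auto intro!: derivative_eq_intros)
  ultimately have "(\<lambda>v. \<Sum>j\<in>UNIV. y $ j * frechet_derivative (dderiv (ey j) energy) (at (u, y)) v
      + snd v $ j * dderiv (ey j) energy (u, y)) = (\<lambda>v. 2 * frechet_derivative energy (at (u, y)) v)"
    by (rule has_derivative_unique)
  from fun_cong[OF this, of v] show ?thesis
    using frechet_derivative_pair_eq_sum[OF energy_differentiable(1)[OF assms], of 0 "snd v"]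
    by (simp add: sum.distrib)
qed

text \<open>For v in a y-direction the differentiated Euler relation leaves 2 - 1 = 1 copy of the
  first derivative.\<close>

lemma g_low_mult_right:
  assumes "u \<in> U" "y \<noteq> 0"
  shows "(\<Sum>j\<in>UNIV. g_low \<Phi> u y $ i $ j * y $ j) = dderiv (ey i) energy (u, y)"
  using dderiv_euler_energy[OF assms, where v = "ey i"] by (simp add: g_low_eq[OF assms] mult.commute)

lemma g_low_mult_both:
  assumes "u \<in> U" "y \<noteq> 0"
  shows "(\<Sum>i\<in>UNIV. \<Sum>j\<in>UNIV. g_low \<Phi> u y $ i $ j * y $ i * y $ j) = (\<Phi> u y)\<^sup>2"
proof -
  have "(\<Sum>i\<in>UNIV. \<Sum>j\<in>UNIV. g_low \<Phi> u y $ i $ j * y $ i * y $ j) =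
      (\<Sum>i\<in>UNIV. y $ i * (\<Sum>j\<in>UNIV. g_low \<Phi> u y $ i $ j * y $ j))"
    by (simp add: sum_distrib_left mult_ac)
  also have "\<dots> = 2 * energy (u, y)"
    by (simp add: g_low_mult_right[OF assms] euler_energy[OF assms])
  finally show ?thesis
    by (simp add: energy_def)
qed

text \<open>This is \<open>g_low_mult_right\<close> differentiated along v; the subtracted sum is
  due to the motion of y itself.\<close>

lemma sum_dderiv_g_low:
  assumes "u \<in> U" "y \<noteq> 0"
  shows "(\<Sum>j\<in>UNIV. dderiv v (dderiv (ey i) (dderiv (ey j) energy)) (u, y) * y $ j)
    = dderiv v (dderiv (ey i) energy) (u, y) - (\<Sum>j\<in>UNIV. g_low \<Phi> u y $ i $ j * snd v $ j)"
proof -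
  let ?g = "\<lambda>j. dderiv (ey i) (dderiv (ey j) energy)"
  let ?f = "\<lambda>z. \<Sum>j\<in>UNIV. ?g j z * snd z $ j"
  have d: "(?g j has_derivative frechet_derivative (?g j) (at (u, y))) (at (u, y))" for j
    using energy_differentiable(3)[OF assms] frechet_derivative_works by blast
  have *: "(\<Sum>j\<in>UNIV. ?g j z * snd z $ j) = dderiv (ey i) energy z" if "z \<in> U \<times> (- {0})" for z
    using that g_low_mult_right[of "fst z" "snd z"] by (cases z) (simp add: g_low_eq)
  have "(?f has_derivative (\<lambda>v. \<Sum>j\<in>UNIV. ?g j (u, y) * snd v $ j + frechet_derivative (?g j) (at (u, y)) v * y $ j))
      (at (u, y))"
    by (rule derivative_eq_intros d bounded_linear.has_derivative[OF bounded_linear_vec_nth] refl | simp)+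
  then have "(dderiv (ey i) energy has_derivative
      (\<lambda>v. \<Sum>j\<in>UNIV. ?g j (u, y) * snd v $ j + frechet_derivative (?g j) (at (u, y)) v * y $ j)) (at (u, y))"
    by (rule has_derivative_transform_within_open[OF _ open_Z]) (use assms * in auto)
  then have "dderiv v (dderiv (ey i) energy) (u, y) =
      (\<Sum>j\<in>UNIV. ?g j (u, y) * snd v $ j + frechet_derivative (?g j) (at (u, y)) v * y $ j)"
    by (simp add: frechet_derivative_at[symmetric])
  then show ?thesis
    using assms by (simp add: g_low_eq sum.distrib)
qed

lemma pd_fst_g_low:
  assumes "u \<in> U" "y \<noteq> 0"
  shows "pd m (\<lambda>u'. g_low \<Phi> u' y $ i $ j) u = dderiv (ex m) (dderiv (ey i) (dderiv (ey j) energy)) (u, y)"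
proof -
  have "pd m (\<lambda>u'. g_low \<Phi> u' y $ i $ j) u = pd m (\<lambda>u'. dderiv (ey i) (dderiv (ey j) energy) (u', y)) u"
    by (rule pd_cong[OF open_U]) (use assms in \<open>auto simp: g_low_eq\<close>)
  then show ?thesis
    by (simp add: pd_fst_slice[OF energy_differentiable(3)[OF assms]])
qed

lemma pd_snd_g_low:
  assumes "u \<in> U" "y \<noteq> 0"
  shows "pd m (\<lambda>y'. g_low \<Phi> u y' $ i $ j) y = dderiv (ey m) (dderiv (ey i) (dderiv (ey j) energy)) (u, y)"
proof -
  have "pd m (\<lambda>y'. g_low \<Phi> u y' $ i $ j) y = pd m (\<lambda>y'. dderiv (ey i) (dderiv (ey j) energy) (u, y')) y"
    by (rule pd_cong[of "- {0}"]) (use assms in \<open>auto simp: g_low_eq open_Compl\<close>)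
  then show ?thesis
    by (simp add: pd_snd_slice[OF energy_differentiable(3)[OF assms]])
qed

lemma sum_pd_fst_g_low:
  assumes "u \<in> U" "y \<noteq> 0"
  shows "(\<Sum>j\<in>UNIV. pd m (\<lambda>u'. g_low \<Phi> u' y $ i $ j) u * y $ j) = dderiv (ex m) (dderiv (ey i) energy) (u, y)"
  using sum_dderiv_g_low[OF assms, where v = "ex m" and i = i] by (simp add: pd_fst_g_low[OF assms])

text \<open>The Cartan tensor contracted with y vanishes, which reflects that the metric has degree
  0 in y. This one fact later removes both \<open>C_coeff\<close> and
  \<open>N_coeff\<close>.\<close>

lemma sum_pd_snd_g_low:
  assumes "u \<in> U" "y \<noteq> 0"
  shows "(\<Sum>j\<in>UNIV. pd m (\<lambda>y'. g_low \<Phi> u y' $ i $ j) y * y $ j) = 0"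
proof -
  have "(\<Sum>j\<in>UNIV. g_low \<Phi> u y $ i $ j * axis m 1 $ j) = g_low \<Phi> u y $ i $ m"
    by (subst sum.cong[OF refl, of UNIV _ "\<lambda>j. if j = m then g_low \<Phi> u y $ i $ j else 0"]) (auto simp: axis_def)
  then show ?thesis
    using sum_dderiv_g_low[OF assms, where v = "ey m" and i = i] energy_dderiv_commute[OF assms, where v = "ey m" and w = "ey i"] assms
    by (simp add: pd_snd_g_low[OF assms] g_low_eq)
qed

text \<open>Positive definiteness makes the kernel trivial, hence \<open>g_low\<close> invertible;
  \<open>matrix_inv\<close> is a choice and obeys the inverse law only after that.\<close>

lemma g_low_inverse:
  assumes "u \<in> U" "y \<noteq> 0"
  shows "(\<Sum>i\<in>UNIV. g_low \<Phi> u y $ l $ i * (\<Sum>m\<in>UNIV. g_up \<Phi> u y $ i $ m * a m)) = a l"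
proof -
  let ?G = "g_low \<Phi> u y"
  have "x = 0" if "?G *v x = 0" for x
  proof (rule ccontr)
    assume "x \<noteq> 0"
    have "(\<Sum>i\<in>UNIV. \<Sum>j\<in>UNIV. ?G $ i $ j * x $ i * x $ j) = (\<Sum>i\<in>UNIV. x $ i * (?G *v x) $ i)"
      by (simp add: matrix_vector_mult_def sum_distrib_left mult_ac)
    also have "\<dots> = 0"
      by (simp add: that)
    finally show False
      using pos_def[OF assms \<open>x \<noteq> 0\<close>] by simp
  qed
  then have "invertible ?G"
    by (simp add: invertible_left_inverse matrix_left_invertible_ker)
  then have inv: "?G ** g_up \<Phi> u y = mat 1"
    unfolding g_up_def matrix_inv_def invertible_def by (metis (mono_tags, lifting) someI_ex)
  have "(\<Sum>i\<in>UNIV. ?G $ l $ i * (\<Sum>m\<in>UNIV. g_up \<Phi> u y $ i $ m * a m)) = (?G *v (g_up \<Phi> u y *v (\<chi> m. a m))) $ l"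
    by (simp add: matrix_vector_mult_def)
  also have "\<dots> = a l"
    by (simp only: matrix_vector_mul_assoc inv matrix_vector_mul_lid vec_lambda_beta)
  finally show ?thesis .
qed

text \<open>In \<open>delta_deriv\<close> the coefficients \<open>N_coeff\<close> multiply
  y-derivatives of the metric, which the contraction with y kills. The nonlinear connection drops
  out without being evaluated.\<close>

lemma sum_delta_g_low:
  assumes "u \<in> U" "y \<noteq> 0"
  shows "(\<Sum>k\<in>UNIV. delta_deriv \<Phi> m (\<lambda>u' y'. g_low \<Phi> u' y' $ l $ k) u y * y $ k) = dderiv (ex m) (dderiv (ey l) energy) (u, y)"
proof -
  have "(\<Sum>k\<in>UNIV. (\<Sum>j\<in>UNIV. N_coeff \<Phi> j m u y * pd j (\<lambda>y'. g_low \<Phi> u y' $ l $ k) y) * y $ k)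
      = (\<Sum>j\<in>UNIV. N_coeff \<Phi> j m u y * (\<Sum>k\<in>UNIV. pd j (\<lambda>y'. g_low \<Phi> u y' $ l $ k) y * y $ k))"
    by (simp add: sum_distrib_left sum_distrib_right mult.assoc) (rule sum.swap)
  also have "\<dots> = 0"
    by (simp add: sum_pd_snd_g_low[OF assms])
  finally show ?thesis
    unfolding delta_deriv_def
    by (simp add: left_diff_distrib sum_subtractf sum_pd_fst_g_low[OF assms])
qed

lemma delta_g_low_sym:
  assumes "u \<in> U" "y \<noteq> 0"
  shows "delta_deriv \<Phi> m (\<lambda>u' y'. g_low \<Phi> u' y' $ k $ l) u y = delta_deriv \<Phi> m (\<lambda>u' y'. g_low \<Phi> u' y' $ l $ k) u y"
proof -
  have "pd m (\<lambda>u'. g_low \<Phi> u' y $ k $ l) u = pd m (\<lambda>u'. g_low \<Phi> u' y $ l $ k) u"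
    by (rule pd_cong[OF open_U]) (use assms g_low_sym in auto)
  moreover have "pd j (\<lambda>y'. g_low \<Phi> u y' $ k $ l) y = pd j (\<lambda>y'. g_low \<Phi> u y' $ l $ k) y" for j
  proof (rule pd_cong[of "- {0}"])
    show "g_low \<Phi> u y' $ k $ l = g_low \<Phi> u y' $ l $ k" if "y' \<in> - {0}" for y'
      using that assms(1) g_low_sym by blast
  qed (use assms in \<open>auto simp: open_Compl\<close>)
  ultimately show ?thesis
    by (simp add: delta_deriv_def)
qed

text \<open>Under the double contraction with y the first two terms of the Christoffel formula
  become equal, and the third gives \<open>2 * dderiv (ex l) energy\<close>. The factor 1/2 then
  leaves the part of the Euler-Lagrange expression free of second derivatives of the curve, with its
  index raised by \<open>g_up\<close>.\<close>

lemma sum_L_coeff: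
  assumes "u \<in> U" "y \<noteq> 0"
  shows "(\<Sum>m\<in>UNIV. y $ m * (\<Sum>k\<in>UNIV. L_coeff \<Phi> i m k u y * y $ k)) =
    (\<Sum>l\<in>UNIV. g_up \<Phi> u y $ i $ l * (dderiv (y, 0) (dderiv (ey l) energy) (u, y) - dderiv (ex l) energy (u, y)))"
proof -
  let ?d = "\<lambda>m l k. delta_deriv \<Phi> m (\<lambda>u' y'. g_low \<Phi> u' y' $ l $ k) u y"
  have swap3: "(\<Sum>m\<in>UNIV. \<Sum>k\<in>UNIV. \<Sum>l\<in>UNIV. f m k l) = (\<Sum>l\<in>UNIV. \<Sum>m\<in>UNIV. \<Sum>k\<in>UNIV. f m k l)"
    for f :: "'n \<Rightarrow> 'n \<Rightarrow> 'n \<Rightarrow> real"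
  proof -
    have "(\<Sum>m\<in>UNIV. \<Sum>k\<in>UNIV. \<Sum>l\<in>UNIV. f m k l) = (\<Sum>m\<in>UNIV. \<Sum>l\<in>UNIV. \<Sum>k\<in>UNIV. f m k l)"
      by (intro sum.cong refl sum.swap)
    also have "\<dots> = (\<Sum>l\<in>UNIV. \<Sum>m\<in>UNIV. \<Sum>k\<in>UNIV. f m k l)"
      by (rule sum.swap)
    finally show ?thesis .
  qed
  have T: "(\<Sum>m\<in>UNIV. y $ m * dderiv (ex m) (dderiv (ey l) energy) (u, y)) = dderiv (y, 0) (dderiv (ey l) energy) (u, y)" for l
    using frechet_derivative_pair_eq_sum[OF energy_differentiable(2)[OF assms, where v = "ey l"], where v = "y" and w = "0"] by simp
  have 1: "(\<Sum>m\<in>UNIV. \<Sum>k\<in>UNIV. y $ m * y $ k * ?d m l k) = dderiv (y, 0) (dderiv (ey l) energy) (u, y)" for l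
  proof -
    have "(\<Sum>m\<in>UNIV. \<Sum>k\<in>UNIV. y $ m * y $ k * ?d m l k) = (\<Sum>m\<in>UNIV. y $ m * (\<Sum>k\<in>UNIV. ?d m l k * y $ k))"
      by (simp add: sum_distrib_left mult_ac)
    then show ?thesis
      by (simp add: sum_delta_g_low[OF assms] T)
  qed
  have 2: "(\<Sum>m\<in>UNIV. \<Sum>k\<in>UNIV. y $ m * y $ k * ?d k m l) = dderiv (y, 0) (dderiv (ey l) energy) (u, y)" for l
  proof -
    have "(\<Sum>m\<in>UNIV. \<Sum>k\<in>UNIV. y $ m * y $ k * ?d k m l) = (\<Sum>m\<in>UNIV. \<Sum>k\<in>UNIV. y $ m * y $ k * ?d k l m)"
      by (simp add: delta_g_low_sym[OF assms])
    also have "\<dots> = (\<Sum>m\<in>UNIV. \<Sum>k\<in>UNIV. y $ m * y $ k * ?d m l k)"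
      by (subst sum.swap) (simp add: mult_ac)
    finally show ?thesis
      using 1 by simp
  qed
  have 3: "(\<Sum>m\<in>UNIV. \<Sum>k\<in>UNIV. y $ m * y $ k * ?d l m k) = 2 * dderiv (ex l) energy (u, y)" for l
  proof -
    have "(\<Sum>m\<in>UNIV. \<Sum>k\<in>UNIV. y $ m * y $ k * ?d l m k) = (\<Sum>m\<in>UNIV. y $ m * (\<Sum>k\<in>UNIV. ?d l m k * y $ k))"
      by (simp add: sum_distrib_left mult_ac)
    also have "\<dots> = (\<Sum>m\<in>UNIV. y $ m * dderiv (ex l) (dderiv (ey m) energy) (u, y))"
      by (simp only: sum_delta_g_low[OF assms])
    \<comment> \<open>\<open>ex l\<close> has no y-component, so the subtracted term of the
      differentiated Euler relation is zero.\<close>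
    also have "\<dots> = 2 * dderiv (ex l) energy (u, y)"
      using dderiv_euler_energy[OF assms, where v = "ex l"]
        linear_0[OF linear_frechet_derivative[OF energy_differentiable(1)[OF assms]]]
      by (simp add: zero_prod_def)
    finally show ?thesis .
  qed
  have "(\<Sum>m\<in>UNIV. y $ m * (\<Sum>k\<in>UNIV. L_coeff \<Phi> i m k u y * y $ k)) =
      (\<Sum>m\<in>UNIV. \<Sum>k\<in>UNIV. \<Sum>l\<in>UNIV. 1 / 2 * g_up \<Phi> u y $ i $ l * (y $ m * y $ k * (?d m l k + ?d k m l - ?d l m k)))"
    unfolding L_coeff_def by (simp add: sum_distrib_left sum_distrib_right mult_ac)
  also have "\<dots> = (\<Sum>l\<in>UNIV. \<Sum>m\<in>UNIV. \<Sum>k\<in>UNIV. 1 / 2 * g_up \<Phi> u y $ i $ l * (y $ m * y $ k * (?d m l k + ?d k m l - ?d l m k)))"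
    by (rule swap3)
  also have "\<dots> = (\<Sum>l\<in>UNIV. 1 / 2 * g_up \<Phi> u y $ i $ l *
      ((\<Sum>m\<in>UNIV. \<Sum>k\<in>UNIV. y $ m * y $ k * ?d m l k) + (\<Sum>m\<in>UNIV. \<Sum>k\<in>UNIV. y $ m * y $ k * ?d k m l)
        - (\<Sum>m\<in>UNIV. \<Sum>k\<in>UNIV. y $ m * y $ k * ?d l m k)))"
    by (simp only: sum_distrib_left sum.distrib sum_subtractf distrib_left right_diff_distrib)
  also have "\<dots> = (\<Sum>l\<in>UNIV. g_up \<Phi> u y $ i $ l * (dderiv (y, 0) (dderiv (ey l) energy) (u, y) - dderiv (ex l) energy (u, y)))"
    unfolding 1 2 3 by (intro sum.cong refl) (simp add: field_simps)
  finally show ?thesis .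
qed

text \<open>The vector b is arbitrary so that it can absorb everything to which
  \<open>C_coeff\<close> is applied, the second derivative of the curve and the
  \<open>N_coeff\<close> terms together.\<close>

lemma sum_C_coeff:
  assumes "u \<in> U" "y \<noteq> 0"
  shows "(\<Sum>m\<in>UNIV. y $ m * (\<Sum>k\<in>UNIV. C_coeff \<Phi> i m k u y * b k)) = 0"
proof -
  have "(\<Sum>m\<in>UNIV. y $ m * (\<Sum>k\<in>UNIV. C_coeff \<Phi> i m k u y * b k)) =
      (\<Sum>k\<in>UNIV. b k * (\<Sum>m\<in>UNIV. y $ m * C_coeff \<Phi> i m k u y))"
    by (simp add: sum_distrib_left mult_ac) (rule sum.swap)
  moreover have "(\<Sum>m\<in>UNIV. y $ m * C_coeff \<Phi> i m k u y) = 0" for k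
  proof -
    have "(\<Sum>m\<in>UNIV. y $ m * C_coeff \<Phi> i m k u y) =
        (\<Sum>l\<in>UNIV. 1 / 2 * g_up \<Phi> u y $ i $ l * (\<Sum>m\<in>UNIV. pd k (\<lambda>y'. g_low \<Phi> u y' $ l $ m) y * y $ m))"
      unfolding C_coeff_def by (simp add: sum_distrib_left mult_ac) (rule sum.swap)
    then show ?thesis
      by (simp add: sum_pd_snd_g_low[OF assms])
  qed
  ultimately show ?thesis by simp
qed

text \<open>The component formula of \<open>covariant_deriv\<close> for the velocity field in one
  chart, with position u, velocity y and second derivative a as independent variables. It follows
  \<open>covariant_deriv\<close> literally, so that the two can be identified by rewriting.\<close>

definition acceleration :: "real^'n \<Rightarrow> real^'n \<Rightarrow> real^'n \<Rightarrow> real^'n" where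
  "acceleration u y a = (\<chi> i. a $ i + (\<Sum>m\<in>UNIV. y $ m *
     ((\<Sum>k\<in>UNIV. L_coeff \<Phi> i m k u y * y $ k)
      + (\<Sum>k\<in>UNIV. C_coeff \<Phi> i m k u y * (a $ k + (\<Sum>l\<in>UNIV. N_coeff \<Phi> k l u y * y $ l))))))"

definition g_form :: "real^'n \<Rightarrow> real^'n \<Rightarrow> real^'n \<Rightarrow> real^'n \<Rightarrow> real" where
  "g_form u y v w = (\<Sum>i\<in>UNIV. \<Sum>j\<in>UNIV. g_low \<Phi> u y $ i $ j * v $ i * w $ j)"

section \<open>Lowering the index of the acceleration\<close>

lemma g_form_eq: "g_form u y v w = (\<Sum>i\<in>UNIV. v $ i * (\<Sum>j\<in>UNIV. g_low \<Phi> u y $ i $ j * w $ j))"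
  by (simp add: g_form_def sum_distrib_left mult_ac)

lemma g_form_add: "g_form u y v (w + w') = g_form u y v w + g_form u y v w'"
  by (simp add: g_form_def distrib_left sum.distrib)

lemma g_form_scale: "g_form u y v (r *\<^sub>R w) = r * g_form u y v w"
  by (simp add: g_form_def sum_distrib_left mult_ac)

text \<open>The Hessian contracted once with y is a first derivative, so the momentum involves no
  second derivative of the energy.\<close>

lemma g_form_velocity:
  assumes "u \<in> U" "y \<noteq> 0"
  shows "g_form u y w y = dderiv (0, w) energy (u, y)"
  using frechet_derivative_pair_eq_sum[OF energy_differentiable(1)[OF assms], of 0 w]
  by (simp add: g_form_eq g_low_mult_right[OF assms])

lemma g_form_sym:
  assumes "u \<in> U" "y \<noteq> 0"
  shows "g_form u y v w = g_form u y w v"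
  unfolding g_form_def
proof (subst sum.swap, intro sum.cong refl)
  fix i j
  show "g_low \<Phi> u y $ j $ i * v $ j * w $ i = g_low \<Phi> u y $ i $ j * w $ i * v $ j"
    by (simp add: g_low_sym[OF assms, of j i])
qed

text \<open>Lowering the index cancels the \<open>g_up\<close> of \<open>sum_L_coeff\<close>. What
  remains is the Euler-Lagrange operator of the energy for a path with velocity y and second
  derivative a.\<close>

lemma g_form_acceleration:
  assumes "u \<in> U" "y \<noteq> 0"
  shows "g_form u y w (acceleration u y a) = dderiv (y, a) (dderiv (0, w) energy) (u, y) - dderiv (w, 0) energy (u, y)"
proof -
  let ?A = "\<lambda>l. dderiv (y, 0) (dderiv (ey l) energy) (u, y) - dderiv (ex l) energy (u, y)"
  have acc: "acceleration u y a $ j = a $ j + (\<Sum>l\<in>UNIV. g_up \<Phi> u y $ j $ l * ?A l)" for j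
  proof -
    have "(\<Sum>m\<in>UNIV. y $ m * (K m + K' m)) = (\<Sum>m\<in>UNIV. y $ m * K m) + (\<Sum>m\<in>UNIV. y $ m * K' m)" for K K' :: "'n \<Rightarrow> real"
      by (simp only: distrib_left sum.distrib)
    then show ?thesis
      unfolding acceleration_def
      by (simp only: vec_lambda_beta sum_L_coeff[OF assms]
          sum_C_coeff[OF assms, of j "\<lambda>k. a $ k + (\<Sum>l\<in>UNIV. N_coeff \<Phi> k l u y * y $ l)"] add_0_right)
  qed
  have lin: "linear (frechet_derivative (dderiv (ey i) energy) (at (u, y)))" for i
    using linear_frechet_derivative[OF energy_differentiable(2)[OF assms]] .
  have "g_form u y w (acceleration u y a) = (\<Sum>i\<in>UNIV. w $ i *
      (\<Sum>j\<in>UNIV. g_low \<Phi> u y $ i $ j * a $ j + g_low \<Phi> u y $ i $ j * (\<Sum>l\<in>UNIV. g_up \<Phi> u y $ j $ l * ?A l)))"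
    by (simp only: g_form_eq acc distrib_left)
  also have "\<dots> = (\<Sum>i\<in>UNIV. w $ i * ((\<Sum>j\<in>UNIV. g_low \<Phi> u y $ i $ j * a $ j) + ?A i))"
    by (simp only: sum.distrib g_low_inverse[OF assms])
  also have "\<dots> = (\<Sum>i\<in>UNIV. w $ i * (dderiv (y, a) (dderiv (ey i) energy) (u, y) - dderiv (ex i) energy (u, y)))"
  proof -
    have "(\<Sum>j\<in>UNIV. g_low \<Phi> u y $ i $ j * a $ j) + dderiv (y, 0) (dderiv (ey i) energy) (u, y)
        = dderiv (y, a) (dderiv (ey i) energy) (u, y)" for i
    proof -
      have "(\<Sum>j\<in>UNIV. g_low \<Phi> u y $ i $ j * a $ j) = (\<Sum>j\<in>UNIV. a $ j * dderiv (ey j) (dderiv (ey i) energy) (u, y))"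
      proof (intro sum.cong refl)
        fix j
        show "g_low \<Phi> u y $ i $ j * a $ j = a $ j * dderiv (ey j) (dderiv (ey i) energy) (u, y)"
          using g_low_sym[OF assms, of i j] g_low_eq[OF assms, of j i] by simp
      qed
      also have "\<dots> = dderiv (0, a) (dderiv (ey i) energy) (u, y)"
        using frechet_derivative_pair_eq_sum[OF energy_differentiable(2)[OF assms, where v = "ey i"], where v = "0" and w = "a"] by simp
      finally show ?thesis
        using linear_add[OF lin[of i], of "(0, a)" "(y, 0)"] by simp
    qed
    then show ?thesis
      by (simp add: add_diff_eq)
  qed
  \<comment> \<open>Linearity in the direction is at hand for the outer derivative only. The
    derivatives are exchanged, the sum over i is collected into \<open>(0, w)\<close>, and the order
    is restored at the end.\<close>
  also have "\<dots> = (\<Sum>i\<in>UNIV. w $ i * dderiv (ey i) (dderiv (y, a) energy) (u, y)) - (\<Sum>i\<in>UNIV. w $ i * dderiv (ex i) energy (u, y))"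
    by (simp only: right_diff_distrib sum_subtractf energy_dderiv_commute[OF assms, where v = "(y, a)"])
  also have "\<dots> = dderiv (0, w) (dderiv (y, a) energy) (u, y) - dderiv (w, 0) energy (u, y)"
    using frechet_derivative_pair_eq_sum[OF energy_differentiable(2)[OF assms, where v = "(y, a)"], where v = "0" and w = "w"]
      frechet_derivative_pair_eq_sum[OF energy_differentiable(1)[OF assms], of w 0] by simp
  finally show ?thesis
    by (simp only: energy_dderiv_commute[OF assms, where v = "(0, w)"])
qed

text \<open>For w = y the Euler relation turns the second derivative into 2 dE(y, a) - dE(0, a).
  Subtracting dE(y, 0) leaves one copy of dE(y, a), the rate of change of the energy along the
  curve.\<close>

lemma g_form_acceleration_velocity:
  assumes "u \<in> U" "y \<noteq> 0"
  shows "g_form u y (acceleration u y a) y = dderiv (y, a) energy (u, y)"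
proof -
  have "dderiv (y, a) (dderiv (0, y) energy) (u, y) = dderiv (0, y) (dderiv (y, a) energy) (u, y)"
    by (rule energy_dderiv_commute[OF assms])
  also have "\<dots> = (\<Sum>j\<in>UNIV. y $ j * dderiv (ey j) (dderiv (y, a) energy) (u, y))"
    using frechet_derivative_pair_eq_sum[OF energy_differentiable(2)[OF assms, where v = "(y, a)"], where v = "0" and w = "y"] by simp
  also have "\<dots> = (\<Sum>j\<in>UNIV. y $ j * dderiv (y, a) (dderiv (ey j) energy) (u, y))"
    by (simp only: energy_dderiv_commute[OF assms, where v = "(y, a)"])
  also have "\<dots> = 2 * dderiv (y, a) energy (u, y) - dderiv (0, a) energy (u, y)"
    using dderiv_euler_energy[OF assms, where v = "(y, a)"] by simp
  finally have "g_form u y y (acceleration u y a) =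
      2 * dderiv (y, a) energy (u, y) - (dderiv (0, a) energy (u, y) + dderiv (y, 0) energy (u, y))"
    using g_form_acceleration[OF assms] by simp
  also have "dderiv (0, a) energy (u, y) + dderiv (y, 0) energy (u, y) = dderiv (y, a) energy (u, y)"
    using linear_add[OF linear_frechet_derivative[OF energy_differentiable(1)[OF assms]], of "(0, a)" "(y, 0)"] by simp
  finally show ?thesis
    using g_form_sym[OF assms] by simp
qed

section \<open>Powers of F and the derivative of the momentum\<close>

lemma energy_pos:
  assumes "u \<in> U" "y \<noteq> 0"
  shows "energy (u, y) > 0"
  using positive[OF assms] by (simp add: energy_def)

lemma powr_energy:
  assumes "u \<in> U" "y \<noteq> 0"
  shows "\<Phi> u y powr q = (2 * energy (u, y)) powr (q / 2)"
proof -
  have "(2 * energy (u, y)) = \<Phi> u y powr 2"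
    using positive[OF assms] by (simp add: energy_def)
  then show ?thesis
    by (simp only: powr_powr) simp
qed

lemma has_vector_derivative_powr_energy:
  assumes "u \<in> U" "y \<noteq> 0" and z: "(z has_vector_derivative z') (at t)" "z t = (u, y)"
  shows "((\<lambda>\<tau>. (2 * energy (z \<tau>)) powr (q / 2)) has_real_derivative
    q * \<Phi> u y powr (q - 2) * dderiv z' energy (u, y)) (at t)"
proof -
  have "((\<lambda>\<tau>. energy (z \<tau>)) has_real_derivative dderiv z' energy (u, y)) (at t)"
    using has_vector_derivative_compose_frechet[OF _ z(1), of energy] energy_differentiable(1)[OF assms(1,2)] z(2)
    by (simp add: has_real_derivative_iff_has_vector_derivative)
  from DERIV_fun_powr[OF DERIV_cmult[OF this, of 2], of "q / 2"]
  have "((\<lambda>\<tau>. (2 * energy (z \<tau>)) powr (q / 2)) has_real_derivative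
     q / 2 * (2 * energy (u, y)) powr (q / 2 - 1) * (2 * dderiv z' energy (u, y))) (at t)"
    using energy_pos[OF assms(1,2)] z(2) by simp
  moreover have "q / 2 - 1 = (q - 2) / 2"
    by (simp add: field_simps)
  ultimately show ?thesis
    by (simp only: powr_energy[OF assms(1,2)]) (simp add: mult_ac)
qed

text \<open>By the product rule and \<open>g_form_acceleration\<close>, with D the acceleration, the
  derivative of E_y w is g(w, D) + E_x w + E_y b. The last two terms form the derivative of the
  energy along \<open>(w t, b)\<close>, which becomes the variation of the Lagrangian. The power of
  F contributes the term with the factor \<open>p - 2\<close>.\<close>

lemma momentum_has_vector_derivative:
  assumes uy: "u \<in> U" "y \<noteq> 0" and T: "open T" "t \<in> T" "\<And>\<tau>. \<tau> \<in> T \<Longrightarrow> z \<tau> \<in> U \<times> (- {0})"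
    and z: "(z has_vector_derivative (y, a)) (at t)" "z t = (u, y)"
    and w: "(w has_vector_derivative b) (at t)"
  shows "((\<lambda>\<tau>. (2 * energy (z \<tau>)) powr ((p - 2) / 2) * frechet_derivative energy (at (z \<tau>)) (0, w \<tau>)) has_real_derivative
     \<Phi> u y powr (p - 4) * g_form u y (w t) ((\<Phi> u y)\<^sup>2 *\<^sub>R acceleration u y a
         + ((p - 2) * g_form u y (acceleration u y a) y) *\<^sub>R y)
     + \<Phi> u y powr (p - 2) * dderiv (w t, b) energy (u, y)) (at t)"
proof -
  have "((\<lambda>\<tau>. (0::real^'n, w \<tau>)) has_vector_derivative (0, b)) (at t)"
    using w by (intro has_vector_derivative_Pair) auto
  from has_vector_derivative_frechet_along[OF open_Z energy_Ck T z(1) this]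
  have 1: "((\<lambda>\<tau>. frechet_derivative energy (at (z \<tau>)) (0, w \<tau>)) has_real_derivative
      dderiv (y, a) (dderiv (0, w t) energy) (u, y) + dderiv (0, b) energy (u, y)) (at t)"
    by (simp add: has_real_derivative_iff_has_vector_derivative z(2))
  \<comment> \<open>The derivative of the power carries the exponent \<open>p - 4\<close>, the other
    terms \<open>p - 2\<close>; splitting off the square yields the common factor with exponent
    \<open>p - 4\<close>.\<close>
  have sq: "\<Phi> u y powr (p - 2) = \<Phi> u y powr (p - 4) * (\<Phi> u y)\<^sup>2"
    using positive[OF uy] by (simp add: powr_add[symmetric] flip: powr_numeral)
  have "dderiv (w t, b) energy (u, y) = dderiv (w t, 0) energy (u, y) + dderiv (0, b) energy (u, y)"
    using linear_add[OF linear_frechet_derivative[OF energy_differentiable(1)[OF uy]], of "(w t, 0)" "(0, b)"] by simp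
  moreover have "(2 * energy (u, y)) powr ((p - 2) / 2) = \<Phi> u y powr (p - 2)"
    using powr_energy[OF uy] by simp
  moreover have "\<Phi> u y powr (p - 2 - 2) = \<Phi> u y powr (p - 4)"
    by (rule arg_cong[of _ _ "\<lambda>q. \<Phi> u y powr q"]) simp
  ultimately show ?thesis
    using DERIV_mult[OF has_vector_derivative_powr_energy[OF uy z, of "p - 2"] 1]
    by (simp only: z(2) g_form_add g_form_scale g_form_acceleration[OF uy] g_form_acceleration_velocity[OF uy]
        g_form_velocity[OF uy, where w = "w t"] sq) (simp add: algebra_simps)
qed

end

section \<open>Charts and tangent vectors\<close>

text \<open>Smoothness on a set with edges is given by a local extension h only. Composing h with a
  path inside the set yields the derivatives along the path, one-sided ones included.\<close>

lemma has_vector_derivative_line_extension: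
  assumes "open W" "\<gamma> t \<in> W" "h differentiable (at (\<gamma> t))"
    and l: "(\<gamma> has_vector_derivative d) (at t within T)" and "t \<in> T"
    and eq: "\<And>\<tau>. \<tau> \<in> T \<Longrightarrow> \<gamma> \<tau> \<in> W \<Longrightarrow> h (\<gamma> \<tau>) = g \<tau>"
  shows "(g has_vector_derivative frechet_derivative h (at (\<gamma> t)) d) (at t within T)"
    and "\<forall>\<^sub>F \<tau> in at t within T. \<gamma> \<tau> \<in> W"
proof -
  have "continuous (at t within T) \<gamma>"
    using l has_vector_derivative_continuous by blast
  then show ev: "\<forall>\<^sub>F \<tau> in at t within T. \<gamma> \<tau> \<in> W"
    using \<open>open W\<close> \<open>\<gamma> t \<in> W\<close> unfolding continuous_within by (rule topological_tendstoD)
  have "((\<lambda>\<tau>. h (\<gamma> \<tau>)) has_vector_derivative frechet_derivative h (at (\<gamma> t)) d) (at t within T)"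
    by (rule has_vector_derivative_compose_frechet[OF assms(3) l])
  then show "(g has_vector_derivative frechet_derivative h (at (\<gamma> t)) d) (at t within T)"
    unfolding has_vector_derivative_def
  proof (rule has_derivative_transform_eventually)
    show "\<forall>\<^sub>F \<tau> in at t within T. h (\<gamma> \<tau>) = g \<tau>"
      using ev eventually_at_filter eq by (auto simp: eventually_at_filter elim!: eventually_mono)
  qed (use assms in auto)
qed

text \<open>Nontriviality of \<open>at t within T\<close> makes the derivative unique. Staying in
  each chart near t makes the coordinate expression meaningful, since a coordinate map is arbitrary
  off its domain.\<close>

definition curve_differentiable :: "('a, 'n::finite) chart set \<Rightarrow> real set \<Rightarrow> (real \<Rightarrow> 'a) \<Rightarrow> real \<Rightarrow> bool" where
  "curve_differentiable A T c t \<longleftrightarrow> t \<in> T \<and> at t within T \<noteq> bot \<and> (\<forall>\<kappa>\<in>charts_at A (c t).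
     (\<forall>\<^sub>F \<tau> in at t within T. c \<tau> \<in> fst \<kappa>) \<and> (\<lambda>\<tau>. snd \<kappa> (c \<tau>)) differentiable (at t within T))"

text \<open>Used with \<gamma> a coordinate line of the strip, for the velocities in s and in t, or
  the identity, for a single curve.\<close>

lemma smooth_map_curve_differentiable:
  assumes f: "smooth_map M A S f" and "t \<in> T" "at t within T \<noteq> bot"
    and l: "\<And>\<tau>. \<tau> \<in> T \<Longrightarrow> \<gamma> \<tau> \<in> S" "(\<gamma> has_vector_derivative d) (at t within T)"
    and c: "\<And>\<tau>. \<tau> \<in> T \<Longrightarrow> c \<tau> = f (\<gamma> \<tau>)"
  shows "curve_differentiable A T c t"
  unfolding curve_differentiable_def
proof (intro conjI ballI assms(2,3))
  fix \<kappa> assume "\<kappa> \<in> charts_at A (c t)"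
  then obtain W h where W: "open W" "\<gamma> t \<in> W" "smooth_on W h" "\<forall>z\<in>W \<inter> S. f z \<in> fst \<kappa> \<and> h z = snd \<kappa> (f z)"
    using f l(1)[OF \<open>t \<in> T\<close>] c[OF \<open>t \<in> T\<close>] unfolding smooth_map_def by metis
  have "Ck_on 1 W h"
    using W(3) by (simp add: smooth_on_def)
  then have "h differentiable (at (\<gamma> t))"
    using W(2) by simp
  note line = has_vector_derivative_line_extension[OF W(1,2) this l(2) \<open>t \<in> T\<close>, of "\<lambda>\<tau>. snd \<kappa> (c \<tau>)"]
  have eq: "h (\<gamma> \<tau>) = snd \<kappa> (c \<tau>)" "c \<tau> \<in> fst \<kappa>" if "\<tau> \<in> T" "\<gamma> \<tau> \<in> W" for \<tau>
    using W(4) that l(1) c by auto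
  show "(\<lambda>\<tau>. snd \<kappa> (c \<tau>)) differentiable (at t within T)"
    using line(1) eq(1) differentiableI_vector by blast
  show "\<forall>\<^sub>F \<tau> in at t within T. c \<tau> \<in> fst \<kappa>"
    using line(2)[OF eq(1)] eq(2) by (auto simp: eventually_at_filter elim!: eventually_mono)
qed

lemma velocity_eq_vector_derivative:
  assumes "curve_differentiable A T c t" "\<kappa> \<in> charts_at A (c t)"
  shows "((\<lambda>\<tau>. snd \<kappa> (c \<tau>)) has_vector_derivative velocity A T c t \<kappa>) (at t within T)"
  using assms unfolding curve_differentiable_def velocity_def by (simp add: vector_derivative_works)

lemma velocity_eqI:
  assumes "\<kappa> \<in> charts_at A (c t)" "at t within T \<noteq> bot"
    "((\<lambda>\<tau>. snd \<kappa> (c \<tau>)) has_vector_derivative d) (at t within T)"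
  shows "velocity A T c t \<kappa> = d"
  using assms vector_derivative_within by (simp add: velocity_def) blast

text \<open>Serves to compare velocities belonging to two different intervals through a smaller
  interval inside both.\<close>

lemma velocity_subset:
  assumes "curve_differentiable A T c t" "T' \<subseteq> T" "at t within T' \<noteq> bot"
  shows "velocity A T' c t = velocity A T c t"
proof
  fix \<kappa>
  show "velocity A T' c t \<kappa> = velocity A T c t \<kappa>"
  proof (cases "\<kappa> \<in> charts_at A (c t)")
    case True
    then show ?thesis
      using velocity_eq_vector_derivative[OF assms(1) True] assms(2,3)
      by (intro velocity_eqI) (auto intro: has_vector_derivative_within_subset)
  qed (simp add: velocity_def)
qed

locale finsler =
  fixes M :: "'a topology" and A :: "('a, 'n::finite) chart set" and F :: "('a, 'n) finsler_fun"
  assumes finsler: "finsler_manifold M A F"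
begin

lemma atlas: "smooth_atlas M A"
  using finsler by (simp add: finsler_manifold_def connected_manifold_def)

section \<open>Charts, transition maps and tangent spaces\<close>

lemma chartD:
  assumes "\<kappa> \<in> A"
  shows "openin M (fst \<kappa>)" "open (snd \<kappa> ` fst \<kappa>)"
    "homeomorphic_map (subtopology M (fst \<kappa>)) (top_of_set (snd \<kappa> ` fst \<kappa>)) (snd \<kappa>)"
  using atlas assms by (simp_all add: smooth_atlas_def)

lemma charts_at_ne: "x \<in> topspace M \<Longrightarrow> \<exists>\<kappa>. \<kappa> \<in> charts_at A x"
  using atlas unfolding smooth_atlas_def charts_at_def by blast

lemma charts_atD: "\<kappa> \<in> charts_at A x \<Longrightarrow> \<kappa> \<in> A \<and> x \<in> fst \<kappa>"
  by (simp add: charts_at_def)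

lemma charts_at_topspace: "\<kappa> \<in> charts_at A x \<Longrightarrow> x \<in> topspace M"
  using charts_atD chartD(1) openin_subset by blast

lemma some_chart: "x \<in> topspace M \<Longrightarrow> some_chart A x \<in> charts_at A x"
  unfolding some_chart_def using charts_at_ne someI_ex[of "\<lambda>\<kappa>. \<kappa> \<in> charts_at A x"] by blast

lemma inj_on_chart: "\<kappa> \<in> A \<Longrightarrow> inj_on (snd \<kappa>) (fst \<kappa>)"
  using homeomorphic_imp_injective_map[OF chartD(3)] openin_subset[OF chartD(1)]
  by (simp add: Int_absorb1)

lemma chart_inv_chart: "\<kappa> \<in> A \<Longrightarrow> x \<in> fst \<kappa> \<Longrightarrow> chart_inv \<kappa> (snd \<kappa> x) = x"
  by (simp add: chart_inv_def inj_on_chart)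

lemma open_chart_image:
  assumes "\<kappa> \<in> A" "openin M V"
  shows "open (snd \<kappa> ` (fst \<kappa> \<inter> V))"
proof -
  have "openin (subtopology M (fst \<kappa>)) (fst \<kappa> \<inter> V)"
    using assms by (simp add: openin_subtopology_Int2)
  then have "openin (top_of_set (snd \<kappa> ` fst \<kappa>)) (snd \<kappa> ` (fst \<kappa> \<inter> V))"
    using homeomorphic_imp_open_map[OF chartD(3)[OF assms(1)]] by (simp add: open_map_def)
  then show ?thesis
    using chartD(2)[OF assms(1)] openin_open_trans by blast
qed

lemma transition_chart: "\<kappa> \<in> A \<Longrightarrow> x \<in> fst \<kappa> \<Longrightarrow> transition \<kappa> \<kappa>' (snd \<kappa> x) = snd \<kappa>' x"
  by (simp add: transition_def chart_inv_chart)

lemma transition_has_derivative: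
  assumes "\<kappa> \<in> charts_at A x" "\<kappa>' \<in> charts_at A x"
  shows "(transition \<kappa> \<kappa>' has_derivative frechet_derivative (transition \<kappa> \<kappa>') (at (snd \<kappa> x))) (at (snd \<kappa> x))"
proof -
  have "smooth_on (snd \<kappa> ` (fst \<kappa> \<inter> fst \<kappa>')) (transition \<kappa> \<kappa>')"
    using atlas charts_atD[OF assms(1)] charts_atD[OF assms(2)] by (simp add: smooth_atlas_def)
  then have "Ck_on 1 (snd \<kappa> ` (fst \<kappa> \<inter> fst \<kappa>')) (transition \<kappa> \<kappa>')"
    by (simp add: smooth_on_def)
  then show ?thesis
    using assms charts_atD[OF assms(1)] charts_atD[OF assms(2)]
    by (intro Ck_on_Suc_has_derivative[of 0 "snd \<kappa> ` (fst \<kappa> \<inter> fst \<kappa>')"]) auto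
qed

text \<open>Chain rule on the overlap of \<kappa> and \<open>\<kappa>'\<close>, where the composite
  of two transitions is the third. It makes \<open>tvec_of\<close> obey the transformation
  law.\<close>

lemma transition_cocycle:
  assumes "\<kappa> \<in> charts_at A x" "\<kappa>' \<in> charts_at A x" "\<kappa>'' \<in> charts_at A x"
  shows "frechet_derivative (transition \<kappa> \<kappa>'') (at (snd \<kappa> x)) y =
    frechet_derivative (transition \<kappa>' \<kappa>'') (at (snd \<kappa>' x)) (frechet_derivative (transition \<kappa> \<kappa>') (at (snd \<kappa> x)) y)"
proof -
  let ?V = "snd \<kappa> ` (fst \<kappa> \<inter> fst \<kappa>')"
  have \<kappa>: "\<kappa> \<in> A" "\<kappa>' \<in> A" "x \<in> fst \<kappa>" "x \<in> fst \<kappa>'"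
    using charts_atD[OF assms(1)] charts_atD[OF assms(2)] by auto
  have "((\<lambda>u. transition \<kappa>' \<kappa>'' (transition \<kappa> \<kappa>' u)) has_derivative
      (\<lambda>y. frechet_derivative (transition \<kappa>' \<kappa>'') (at (snd \<kappa>' x)) (frechet_derivative (transition \<kappa> \<kappa>') (at (snd \<kappa> x)) y)))
      (at (snd \<kappa> x))"
    by (rule has_derivative_compose[OF transition_has_derivative[OF assms(1,2)]])
      (use transition_has_derivative[OF assms(2,3)] transition_chart \<kappa> in simp)
  then have "(transition \<kappa> \<kappa>'' has_derivative
      (\<lambda>y. frechet_derivative (transition \<kappa>' \<kappa>'') (at (snd \<kappa>' x)) (frechet_derivative (transition \<kappa> \<kappa>') (at (snd \<kappa> x)) y)))
      (at (snd \<kappa> x))"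
  proof (rule has_derivative_transform_within_open)
    show "open ?V"
      using open_chart_image \<kappa> chartD(1) by blast
  qed (use \<kappa> in \<open>auto simp: transition_chart\<close>)
  from fun_cong[OF frechet_derivative_at[OF this]] show ?thesis by simp
qed

lemma transition_refl:
  assumes "\<kappa> \<in> charts_at A x"
  shows "frechet_derivative (transition \<kappa> \<kappa>) (at (snd \<kappa> x)) y = y"
proof -
  have \<kappa>: "\<kappa> \<in> A" "x \<in> fst \<kappa>"
    using charts_atD[OF assms(1)] by auto
  have "((\<lambda>u. u) has_derivative (\<lambda>y. y)) (at (snd \<kappa> x))"
    by simp
  then have "(transition \<kappa> \<kappa> has_derivative (\<lambda>y. y)) (at (snd \<kappa> x))"
    by (rule has_derivative_transform_within_open[OF _ chartD(2)[OF \<kappa>(1)]]) (use \<kappa> in \<open>auto simp: transition_chart\<close>)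
  from fun_cong[OF frechet_derivative_at[OF this]] show ?thesis by simp
qed

lemma transition_linear:
  "\<kappa> \<in> charts_at A x \<Longrightarrow> \<kappa>' \<in> charts_at A x \<Longrightarrow> linear (frechet_derivative (transition \<kappa> \<kappa>') (at (snd \<kappa> x)))"
  using transition_has_derivative has_derivative_linear by blast

lemma tangent_spaceD:
  assumes "v \<in> tangent_space A x" "\<kappa> \<in> charts_at A x" "\<kappa>' \<in> charts_at A x"
  shows "frechet_derivative (transition \<kappa> \<kappa>') (at (snd \<kappa> x)) (v \<kappa>) = v \<kappa>'"
  using assms unfolding tangent_space_def mem_Collect_eq by metis

lemma tangent_space_outside: "v \<in> tangent_space A x \<Longrightarrow> \<kappa> \<notin> charts_at A x \<Longrightarrow> v \<kappa> = 0"
  unfolding tangent_space_def by blast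

lemma tangent_spaceI:
  assumes "\<And>\<kappa> \<kappa>'. \<kappa> \<in> charts_at A x \<Longrightarrow> \<kappa>' \<in> charts_at A x \<Longrightarrow>
      frechet_derivative (transition \<kappa> \<kappa>') (at (snd \<kappa> x)) (v \<kappa>) = v \<kappa>'"
    and "\<And>\<kappa>. \<kappa> \<notin> charts_at A x \<Longrightarrow> v \<kappa> = 0"
  shows "v \<in> tangent_space A x"
  unfolding tangent_space_def mem_Collect_eq using assms(1)[symmetric] assms(2) by blast

lemma tvec_of_tangent: "\<kappa> \<in> charts_at A x \<Longrightarrow> tvec_of A \<kappa> x y \<in> tangent_space A x"
  by (rule tangent_spaceI) (simp_all add: tvec_of_def transition_cocycle[symmetric])

lemma tvec_of_chart: "\<kappa> \<in> charts_at A x \<Longrightarrow> tvec_of A \<kappa> x y \<kappa> = y"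
  by (simp add: tvec_of_def transition_refl)

lemma tvec_of_tangent_chart:
  assumes "v \<in> tangent_space A x" "\<kappa> \<in> charts_at A x"
  shows "tvec_of A \<kappa> x (v \<kappa>) = v"
  using assms by (simp add: tvec_of_def fun_eq_iff tangent_spaceD tangent_space_outside)

lemma tangent_add:
  assumes "v \<in> tangent_space A x" "w \<in> tangent_space A x"
  shows "tvec_add v w \<in> tangent_space A x"
  by (rule tangent_spaceI)
    (simp_all add: tvec_add_def linear_add[OF transition_linear] assms[THEN tangent_spaceD] assms[THEN tangent_space_outside])

lemma tangent_scale:
  assumes "v \<in> tangent_space A x"
  shows "tvec_scale a v \<in> tangent_space A x"
  by (rule tangent_spaceI)
    (simp_all add: tvec_scale_def linear_cmul[OF transition_linear] assms[THEN tangent_spaceD] assms[THEN tangent_space_outside])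

lemma tangent_nonzero:
  assumes "v \<in> tangent_space A x" "v \<noteq> tvec_zero" "\<kappa> \<in> charts_at A x"
  shows "v \<kappa> \<noteq> 0"
proof
  assume "v \<kappa> = 0"
  then have "v = tvec_of A \<kappa> x 0"
    using tvec_of_tangent_chart[OF assms(1,3)] by simp
  also have "\<dots> = tvec_zero"
    using linear_0[OF transition_linear[OF assms(3)]] by (auto simp: tvec_of_def tvec_zero_def fun_eq_iff)
  finally show False
    using assms(2) by simp
qed

lemma F_loc_chart:
  assumes "v \<in> tangent_space A x" "\<kappa> \<in> charts_at A x"
  shows "F_loc A F \<kappa> (snd \<kappa> x) (v \<kappa>) = F x v"
  using charts_atD[OF assms(2)] by (simp add: F_loc_def chart_inv_chart tvec_of_tangent_chart[OF assms])

lemma finsler_domain_chart: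
  assumes "\<kappa> \<in> A"
  shows "finsler_domain (F_loc A F \<kappa>) (snd \<kappa> ` fst \<kappa>)"
proof
  note F = finsler[unfolded finsler_manifold_def, THEN conjunct2]
  note F_pos = F[THEN conjunct1, rule_format]
    and F_hom = F[THEN conjunct2, THEN conjunct1, rule_format]
    and F_pos_def = F[THEN conjunct2, THEN conjunct2, THEN conjunct1, rule_format]
    and F_smooth = F[THEN conjunct2, THEN conjunct2, THEN conjunct2, THEN conjunct1, rule_format]
  show "open (snd \<kappa> ` fst \<kappa>)"
    by (rule chartD(2)[OF assms])
  show "smooth_on (snd \<kappa> ` fst \<kappa> \<times> - {0}) (\<lambda>(u, y). F_loc A F \<kappa> u y)"
    by (rule F_smooth[OF assms])
  show "(\<Sum>i\<in>UNIV. \<Sum>j\<in>UNIV. g_low (F_loc A F \<kappa>) u y $ i $ j * w $ i * w $ j) > 0"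
    if "u \<in> snd \<kappa> ` fst \<kappa>" "y \<noteq> 0" "w \<noteq> 0" for u y w
    by (rule F_pos_def[OF assms that])
  show "F_loc A F \<kappa> u (a *\<^sub>R y) = \<bar>a\<bar> * F_loc A F \<kappa> u y" if "u \<in> snd \<kappa> ` fst \<kappa>" for u y a
  proof -
    from that obtain x where x: "x \<in> fst \<kappa>" "u = snd \<kappa> x" by auto
    then have \<kappa>: "\<kappa> \<in> charts_at A x"
      using assms by (simp add: charts_at_def)
    have "tvec_of A \<kappa> x (a *\<^sub>R y) = tvec_scale a (tvec_of A \<kappa> x y)"
      using linear_cmul[OF transition_linear[OF \<kappa>]] by (auto simp: tvec_of_def tvec_scale_def fun_eq_iff)
    then show ?thesis
      using F_hom[OF charts_at_topspace[OF \<kappa>] tvec_of_tangent[OF \<kappa>]]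
      by (simp add: F_loc_def chart_inv_chart[OF assms x(1)] x(2))
  qed
  show "F_loc A F \<kappa> u y > 0" if "u \<in> snd \<kappa> ` fst \<kappa>" "y \<noteq> 0" for u y
  proof -
    from that obtain x where x: "x \<in> fst \<kappa>" "u = snd \<kappa> x" by auto
    then have \<kappa>: "\<kappa> \<in> charts_at A x"
      using assms by (simp add: charts_at_def)
    have "tvec_of A \<kappa> x y \<noteq> tvec_zero"
      using tvec_of_chart[OF \<kappa>, of y] that(2) by (auto simp: tvec_zero_def)
    then show ?thesis
      using F_pos[OF charts_at_topspace[OF \<kappa>] tvec_of_tangent[OF \<kappa>]]
      by (simp add: F_loc_def chart_inv_chart[OF assms x(1)] x(2))
  qed
qed

section \<open>Chart independence of F and of g(X, v) at v\<close>

abbreviation chart_energy :: "('a, 'n) chart \<Rightarrow> (real^'n) \<times> (real^'n) \<Rightarrow> real" where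
  "chart_energy \<kappa> \<equiv> finsler_domain.energy (F_loc A F \<kappa>)"

lemma g_inner_eq_g_form:
  assumes "x \<in> topspace M" "\<kappa> = some_chart A x"
  shows "g_inner A F x v X Y = finsler_domain.g_form (F_loc A F \<kappa>) (snd \<kappa> x) (v \<kappa>) (X \<kappa>) (Y \<kappa>)"
proof -
  interpret finsler_domain "F_loc A F \<kappa>" "snd \<kappa> ` fst \<kappa>"
    using finsler_domain_chart charts_atD[OF some_chart[OF assms(1)]] assms(2) by simp
  show ?thesis
    unfolding g_inner_def Let_def g_form_def assms(2)[symmetric] by (rule refl)
qed

lemma g_inner_scale_right: "g_inner A F x v X (tvec_scale r Y) = r * g_inner A F x v X Y"
  by (simp add: g_inner_def tvec_scale_def Let_def sum_distrib_left mult_ac)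

lemma chart_nonzero_domain:
  assumes "\<kappa> \<in> charts_at A x" "v \<in> tangent_space A x" "v \<noteq> tvec_zero"
  shows "snd \<kappa> x \<in> snd \<kappa> ` fst \<kappa>" "v \<kappa> \<noteq> 0"
  using charts_atD[OF assms(1)] tangent_nonzero[OF assms(2,3,1)] by auto

lemma g_inner_self:
  assumes "v \<in> tangent_space A x" "v \<noteq> tvec_zero" "x \<in> topspace M"
  shows "g_inner A F x v v v = (F x v)\<^sup>2"
proof -
  let ?\<kappa> = "some_chart A x"
  have \<kappa>: "?\<kappa> \<in> charts_at A x"
    using some_chart assms(3) by blast
  interpret finsler_domain "F_loc A F ?\<kappa>" "snd ?\<kappa> ` fst ?\<kappa>"
    using finsler_domain_chart charts_atD[OF \<kappa>] by simp
  show ?thesis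
    using g_low_mult_both[OF chart_nonzero_domain[OF \<kappa> assms(1,2)]] F_loc_chart[OF assms(1) \<kappa>]
    by (simp add: g_inner_eq_g_form[OF assms(3) refl] g_form_def)
qed

lemma F_positive:
  assumes "v \<in> tangent_space A x" "v \<noteq> tvec_zero" "x \<in> topspace M"
  shows "F x v > 0"
  using finsler assms by (simp add: finsler_manifold_def)

text \<open>The left-hand side does not mention the chart, so the right-hand side is the same in all charts.\<close>

lemma F_line_has_vector_derivative:
  assumes "v \<in> tangent_space A x" "v \<noteq> tvec_zero" "X \<in> tangent_space A x" "\<kappa> \<in> charts_at A x"
  shows "((\<lambda>a. (F x (tvec_add v (tvec_scale a X)))\<^sup>2 / 2) has_vector_derivative
    dderiv (0, X \<kappa>) (chart_energy \<kappa>) (snd \<kappa> x, v \<kappa>)) (at 0)"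
proof -
  interpret finsler_domain "F_loc A F \<kappa>" "snd \<kappa> ` fst \<kappa>"
    using finsler_domain_chart charts_atD[OF assms(4)] by simp
  have "((\<lambda>a::real. (snd \<kappa> x, v \<kappa> + a *\<^sub>R X \<kappa>)) has_vector_derivative (0, X \<kappa>)) (at 0)"
    by (intro has_vector_derivative_Pair) (auto intro!: derivative_eq_intros)
  from has_vector_derivative_compose_frechet[OF _ this, of energy]
  have "((\<lambda>a. energy (snd \<kappa> x, v \<kappa> + a *\<^sub>R X \<kappa>)) has_vector_derivative
      dderiv (0, X \<kappa>) energy (snd \<kappa> x, v \<kappa>)) (at 0)"
    using energy_differentiable(1)[OF chart_nonzero_domain[OF assms(4,1,2)]] by simp
  moreover have "energy (snd \<kappa> x, v \<kappa> + a *\<^sub>R X \<kappa>) = (F x (tvec_add v (tvec_scale a X)))\<^sup>2 / 2" for a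
    using F_loc_chart[OF tangent_add[OF assms(1) tangent_scale[OF assms(3)]] assms(4), of a]
    by (simp add: energy_def tvec_add_def tvec_scale_def)
  ultimately show ?thesis by simp
qed

text \<open>\<open>g_inner\<close> is tied to \<open>some_chart\<close>, but both charts compute the
  derivative of the same chart-free function on the line through v in the direction X. Uniqueness of
  derivatives takes the place of the transformation law of the metric.\<close>

lemma g_inner_velocity:
  assumes "v \<in> tangent_space A x" "v \<noteq> tvec_zero" "X \<in> tangent_space A x" "\<kappa> \<in> charts_at A x"
  shows "g_inner A F x v X v = dderiv (0, X \<kappa>) (chart_energy \<kappa>) (snd \<kappa> x, v \<kappa>)"
proof -
  let ?\<kappa> = "some_chart A x"
  have x: "x \<in> topspace M"
    using charts_at_topspace assms(4) by blast
  have \<kappa>: "?\<kappa> \<in> charts_at A x"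
    using some_chart x by blast
  interpret finsler_domain "F_loc A F ?\<kappa>" "snd ?\<kappa> ` fst ?\<kappa>"
    using finsler_domain_chart charts_atD[OF \<kappa>] by simp
  have "g_inner A F x v X v = dderiv (0, X ?\<kappa>) energy (snd ?\<kappa> x, v ?\<kappa>)"
    using g_form_velocity[OF chart_nonzero_domain[OF \<kappa> assms(1,2)]]
    by (simp add: g_inner_eq_g_form[OF x refl])
  then show ?thesis
    using vector_derivative_unique_at[OF F_line_has_vector_derivative[OF assms(1-3) \<kappa>]
        F_line_has_vector_derivative[OF assms]] by simp
qed

lemma velocity_tangent:
  assumes "curve_differentiable A T c t"
  shows "velocity A T c t \<in> tangent_space A (c t)"
proof (rule tangent_spaceI)
  fix \<kappa> \<kappa>' assume \<kappa>: "\<kappa> \<in> charts_at A (c t)" "\<kappa>' \<in> charts_at A (c t)"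
  have "(transition \<kappa> \<kappa>' has_derivative frechet_derivative (transition \<kappa> \<kappa>') (at (snd \<kappa> (c t)))) (at (snd \<kappa> (c t)))"
    by (rule transition_has_derivative[OF \<kappa>])
  then have "transition \<kappa> \<kappa>' differentiable (at (snd \<kappa> (c t)))"
    unfolding differentiable_def by blast
  then have "((\<lambda>\<tau>. transition \<kappa> \<kappa>' (snd \<kappa> (c \<tau>))) has_vector_derivative
      frechet_derivative (transition \<kappa> \<kappa>') (at (snd \<kappa> (c t))) (velocity A T c t \<kappa>)) (at t within T)"
    using has_vector_derivative_compose_frechet[OF _ velocity_eq_vector_derivative[OF assms \<kappa>(1)]] by blast
  then have "((\<lambda>\<tau>. snd \<kappa>' (c \<tau>)) has_vector_derivative
      frechet_derivative (transition \<kappa> \<kappa>') (at (snd \<kappa> (c t))) (velocity A T c t \<kappa>)) (at t within T)"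
    unfolding has_vector_derivative_def
  proof (rule has_derivative_transform_eventually)
    have "\<forall>\<^sub>F \<tau> in at t within T. c \<tau> \<in> fst \<kappa>"
      using assms \<kappa>(1) by (simp add: curve_differentiable_def)
    then show "\<forall>\<^sub>F \<tau> in at t within T. transition \<kappa> \<kappa>' (snd \<kappa> (c \<tau>)) = snd \<kappa>' (c \<tau>)"
      by (rule eventually_mono) (simp add: transition_chart charts_atD[OF \<kappa>(1)])
    show "transition \<kappa> \<kappa>' (snd \<kappa> (c t)) = snd \<kappa>' (c t)"
      by (simp add: transition_chart charts_atD[OF \<kappa>(1)])
    show "t \<in> T"
      using assms by (simp add: curve_differentiable_def)
  qed
  then have "velocity A T c t \<kappa>' = frechet_derivative (transition \<kappa> \<kappa>') (at (snd \<kappa> (c t))) (velocity A T c t \<kappa>)"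
    using assms by (intro velocity_eqI \<kappa>(2)) (simp_all add: curve_differentiable_def)
  then show "frechet_derivative (transition \<kappa> \<kappa>') (at (snd \<kappa> (c t))) (velocity A T c t \<kappa>) = velocity A T c t \<kappa>'"
    by (rule sym)
qed (simp add: velocity_def)

end

section \<open>One smooth piece of a variation\<close>

locale variation_piece = finsler M A F
  for M :: "'a topology" and A :: "('a, 'n::finite) chart set" and F :: "('a, 'n) finsler_fun" +
  fixes \<Gamma> :: "real \<Rightarrow> real \<Rightarrow> 'a" and \<epsilon> a b :: real
  assumes eps: "\<epsilon> > 0" and ab: "a < b" "{a..b} \<subseteq> {0..1}"
    and smooth_\<Gamma>: "smooth_map M A ({-\<epsilon><..<\<epsilon>} \<times> {a..b}) (\<lambda>(s, t). \<Gamma> s t)"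
    and regular: "\<And>s t. s \<in> {-\<epsilon><..<\<epsilon>} \<Longrightarrow> t \<in> {a..b} \<Longrightarrow> velocity A {a..b} (\<Gamma> s) t \<noteq> tvec_zero"
begin

abbreviation (input) I :: "real set" where "I \<equiv> {-\<epsilon><..<\<epsilon>}"

text \<open>Taken within \<open>{a..b}\<close>, hence one-sided and meaningful at both ends of the
  piece, where \<open>cdot\<close> may not be.\<close>

definition V :: "real \<Rightarrow> real \<Rightarrow> ('a, 'n) tvec" where
  "V s t = velocity A {a..b} (\<Gamma> s) t"

definition Y :: "real \<Rightarrow> real \<Rightarrow> ('a, 'n) tvec" where
  "Y s t = velocity A I (\<lambda>\<sigma>. \<Gamma> \<sigma> t) s"

section \<open>Existence and tangency of the velocities in t and in s\<close>

lemma within_nontrivial: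
  "t \<in> {a..b} \<Longrightarrow> at t within {a..b} \<noteq> bot" "s \<in> I \<Longrightarrow> at s within I \<noteq> bot"
  using ab(1) at_within_open[of s I] by (simp_all add: trivial_limit_within islimpt_Icc)

lemma topspace_\<Gamma>: "s \<in> I \<Longrightarrow> t \<in> {a..b} \<Longrightarrow> \<Gamma> s t \<in> topspace M"
  using smooth_\<Gamma> unfolding smooth_map_def by (metis (no_types, lifting) SigmaI case_prod_conv image_subset_iff)

lemma V_differentiable: "s \<in> I \<Longrightarrow> t \<in> {a..b} \<Longrightarrow> curve_differentiable A {a..b} (\<Gamma> s) t"
  by (rule smooth_map_curve_differentiable[OF smooth_\<Gamma> _ within_nontrivial(1), where \<gamma> = "\<lambda>\<tau>. (s, \<tau>)" and d = "(0, 1)"])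
    (auto intro!: has_vector_derivative_Pair derivative_eq_intros)

lemma Y_differentiable: "s \<in> I \<Longrightarrow> t \<in> {a..b} \<Longrightarrow> curve_differentiable A I (\<lambda>\<sigma>. \<Gamma> \<sigma> t) s"
  by (rule smooth_map_curve_differentiable[OF smooth_\<Gamma> _ within_nontrivial(2), where \<gamma> = "\<lambda>\<sigma>. (\<sigma>, t)" and d = "(1, 0)"])
    (auto intro!: has_vector_derivative_Pair derivative_eq_intros)

lemma V_tangent: "s \<in> I \<Longrightarrow> t \<in> {a..b} \<Longrightarrow> V s t \<in> tangent_space A (\<Gamma> s t)"
  unfolding V_def by (rule velocity_tangent[OF V_differentiable])

lemma Y_tangent: "s \<in> I \<Longrightarrow> t \<in> {a..b} \<Longrightarrow> Y s t \<in> tangent_space A (\<Gamma> s t)"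
  unfolding Y_def by (rule velocity_tangent[OF Y_differentiable])

lemma V_nonzero: "s \<in> I \<Longrightarrow> t \<in> {a..b} \<Longrightarrow> V s t \<noteq> tvec_zero"
  unfolding V_def by (rule regular)

text \<open>The extension h lives on an open set, so its mixed second derivatives exist and commute
  even on the edges t = a and t = b. The clauses on \<open>V\<close> and \<open>Y\<close> link h
  back to the geometry.\<close>

definition local_rep :: "('a, 'n) chart \<Rightarrow> (real \<times> real) set \<Rightarrow> (real \<times> real \<Rightarrow> real^'n) \<Rightarrow> bool" where
  "local_rep \<kappa> W h \<longleftrightarrow> \<kappa> \<in> A \<and> open W \<and> smooth_on W h \<and> (\<forall>s\<in>I. \<forall>t\<in>{a..b}. (s, t) \<in> W \<longrightarrow>
     \<kappa> \<in> charts_at A (\<Gamma> s t) \<and> h (s, t) = snd \<kappa> (\<Gamma> s t) \<and>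
     V s t \<kappa> = dderiv (0, 1) h (s, t) \<and> Y s t \<kappa> = dderiv (1, 0) h (s, t))"

text \<open>Off the strip the values of h are arbitrary. Its derivatives in s and t at points of the
  strip are nevertheless those of \<Gamma>, because derivatives within the two intervals are
  unique.\<close>

lemma local_rep_exists:
  assumes "s0 \<in> I" "t0 \<in> {a..b}" "\<kappa> \<in> charts_at A (\<Gamma> s0 t0)"
  shows "\<exists>W h. (s0, t0) \<in> W \<and> local_rep \<kappa> W h"
proof -
  have \<kappa>: "\<kappa> \<in> A"
    using charts_atD[OF assms(3)] by simp
  have "\<exists>W h. open W \<and> (s0, t0) \<in> W \<and> smooth_on W h \<and>
      (\<forall>z\<in>W \<inter> (I \<times> {a..b}). (\<lambda>(s, t). \<Gamma> s t) z \<in> fst \<kappa> \<and> h z = snd \<kappa> ((\<lambda>(s, t). \<Gamma> s t) z))"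
    using smooth_\<Gamma> assms unfolding smooth_map_def by (auto dest!: bspec[where x = "(s0, t0)"])
  then obtain W h where W: "open W" "(s0, t0) \<in> W" "smooth_on W h"
    and h: "\<And>s t. (s, t) \<in> W \<Longrightarrow> s \<in> I \<Longrightarrow> t \<in> {a..b} \<Longrightarrow> \<Gamma> s t \<in> fst \<kappa> \<and> h (s, t) = snd \<kappa> (\<Gamma> s t)"
    by (metis (no_types, lifting) IntI SigmaI case_prod_conv)
  have "Ck_on 1 W h"
    using W(3) by (simp add: smooth_on_def)
  then have diff: "h differentiable (at z)" if "z \<in> W" for z
    using that by simp
  have "V s t \<kappa> = dderiv (0, 1) h (s, t) \<and> Y s t \<kappa> = dderiv (1, 0) h (s, t)"
    if st: "s \<in> I" "t \<in> {a..b}" "(s, t) \<in> W" for s t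
  proof
    have ch: "\<kappa> \<in> charts_at A (\<Gamma> s t)"
      using \<kappa> h st by (simp add: charts_at_def)
    have "((\<lambda>\<tau>. (s, \<tau>)) has_vector_derivative (0, 1)) (at t within {a..b})"
      by (auto intro!: has_vector_derivative_Pair derivative_eq_intros)
    from has_vector_derivative_line_extension(1)[OF W(1) st(3) diff[OF st(3)] this st(2), of "\<lambda>\<tau>. snd \<kappa> (\<Gamma> s \<tau>)"]
    show "V s t \<kappa> = dderiv (0, 1) h (s, t)"
      unfolding V_def using h st by (intro velocity_eqI ch within_nontrivial) auto
    have "((\<lambda>\<sigma>. (\<sigma>, t)) has_vector_derivative (1, 0)) (at s within I)"
      by (auto intro!: has_vector_derivative_Pair derivative_eq_intros)
    from has_vector_derivative_line_extension(1)[where \<gamma> = "\<lambda>\<sigma>. (\<sigma>, t)", OF W(1) st(3) diff[OF st(3)] this st(1), of "\<lambda>\<sigma>. snd \<kappa> (\<Gamma> \<sigma> t)"]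
    show "Y s t \<kappa> = dderiv (1, 0) h (s, t)"
      unfolding Y_def using h st by (intro velocity_eqI ch within_nontrivial) auto
  qed
  then have "local_rep \<kappa> W h"
    unfolding local_rep_def using \<kappa> W h by (simp add: charts_at_def)
  with W(2) show ?thesis by blast
qed

section \<open>The variation in one chart\<close>

context
  fixes \<kappa> W h
  assumes rep: "local_rep \<kappa> W h"
begin

lemma rep_chart: "\<kappa> \<in> A" and rep_open: "open W" and rep_Ck: "Ck_on k W h" "Ck_on k W (dderiv v h)"
  "Ck_on k W (dderiv w (dderiv v h))"
proof -
  show "\<kappa> \<in> A" "open W" and *: "Ck_on k W h" for k
    using rep by (simp_all add: local_rep_def smooth_on_def)
  show **: "Ck_on k W (dderiv v h)" for k v
    using *[of "Suc k"] unfolding Ck_on.simps by blast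
  show "Ck_on k W (dderiv w (dderiv v h))"
    using **[of "Suc k" v] unfolding Ck_on.simps by blast
qed

interpretation finsler_domain "F_loc A F \<kappa>" "snd \<kappa> ` fst \<kappa>"
  by (rule finsler_domain_chart[OF rep_chart])

text \<open>The lift of the variation to the tangent bundle in coordinates: base point and velocity,
  both read off from h.\<close>

abbreviation z :: "real \<times> real \<Rightarrow> (real^'n) \<times> (real^'n)" where
  "z \<sigma> \<equiv> (h \<sigma>, dderiv (0, 1) h \<sigma>)"

lemma rep_point:
  assumes "(s, t) \<in> W" "s \<in> I" "t \<in> {a..b}"
  shows "\<kappa> \<in> charts_at A (\<Gamma> s t)" "h (s, t) = snd \<kappa> (\<Gamma> s t)"
    "V s t \<kappa> = dderiv (0, 1) h (s, t)" "Y s t \<kappa> = dderiv (1, 0) h (s, t)"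
    "h (s, t) \<in> snd \<kappa> ` fst \<kappa>" "dderiv (0, 1) h (s, t) \<noteq> 0"
    "F_loc A F \<kappa> (h (s, t)) (dderiv (0, 1) h (s, t)) = F (\<Gamma> s t) (V s t)"
proof -
  show *: "\<kappa> \<in> charts_at A (\<Gamma> s t)" "h (s, t) = snd \<kappa> (\<Gamma> s t)"
    "V s t \<kappa> = dderiv (0, 1) h (s, t)" "Y s t \<kappa> = dderiv (1, 0) h (s, t)"
    using rep assms by (simp_all add: local_rep_def)
  show "h (s, t) \<in> snd \<kappa> ` fst \<kappa>" "dderiv (0, 1) h (s, t) \<noteq> 0"
    using chart_nonzero_domain[OF *(1) V_tangent V_nonzero] assms(2,3) *(2,3) by simp_all
  show "F_loc A F \<kappa> (h (s, t)) (dderiv (0, 1) h (s, t)) = F (\<Gamma> s t) (V s t)"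
    using F_loc_chart[OF V_tangent *(1)] assms(2,3) *(2,3) by simp
qed

lemma rep_z_domain: "(s, t) \<in> W \<Longrightarrow> s \<in> I \<Longrightarrow> t \<in> {a..b} \<Longrightarrow> z (s, t) \<in> (snd \<kappa> ` fst \<kappa>) \<times> (- {0})"
  using rep_point(5,6) by simp

lemma z_has_vector_derivative:
  assumes "(\<gamma> has_vector_derivative d) (at \<tau> within T)" "\<gamma> \<tau> \<in> W"
  shows "((\<lambda>\<tau>. z (\<gamma> \<tau>)) has_vector_derivative (dderiv d h (\<gamma> \<tau>), dderiv d (dderiv (0, 1) h) (\<gamma> \<tau>))) (at \<tau> within T)"
proof (rule has_vector_derivative_Pair)
  have d: "h differentiable (at (\<gamma> \<tau>))" "dderiv (0, 1) h differentiable (at (\<gamma> \<tau>))"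
    using assms(2) rep_Ck(1)[where k = "Suc 0"] rep_Ck(2)[where k = "Suc 0" and v = "(0, 1)"]
    by (simp_all only: Ck_on.simps)
  show "((\<lambda>\<tau>. h (\<gamma> \<tau>)) has_vector_derivative dderiv d h (\<gamma> \<tau>)) (at \<tau> within T)"
    "((\<lambda>\<tau>. dderiv (0, 1) h (\<gamma> \<tau>)) has_vector_derivative dderiv d (dderiv (0, 1) h) (\<gamma> \<tau>)) (at \<tau> within T)"
    by (rule has_vector_derivative_compose_frechet[OF d(1) assms(1)] has_vector_derivative_compose_frechet[OF d(2) assms(1)])+
qed

lemma continuous_on_z: "continuous_on (W \<inter> I \<times> {a..b}) z"
  by (rule continuous_on_subset[of W])
    (auto intro!: continuous_on_Pair Ck_on_imp_continuous_on[OF rep_Ck(1)] Ck_on_imp_continuous_on[OF rep_Ck(2)])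

lemma F_powr_rep:
  assumes "(s, t) \<in> W" "s \<in> I" "t \<in> {a..b}"
  shows "F (\<Gamma> s t) (V s t) powr q = (2 * energy (z (s, t))) powr (q / 2)"
  using powr_energy[OF rep_point(5,6)[OF assms]] by (simp only: rep_point(7)[OF assms])

lemma g_inner_rep:
  assumes "(s, t) \<in> W" "s \<in> I" "t \<in> {a..b}"
  shows "g_inner A F (\<Gamma> s t) (V s t) (Y s t) (V s t) = frechet_derivative energy (at (z (s, t))) (0, dderiv (1, 0) h (s, t))"
  using g_inner_velocity[OF V_tangent V_nonzero Y_tangent rep_point(1)[OF assms]] assms(2,3)
  by (simp only: rep_point(2-4)[OF assms])

text \<open>The range of s is open, so the derivative is two-sided even for t = a or t = b. The
  direction is the s-derivative of the lift \<open>z\<close>, whose second component is a mixed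
  derivative of h.\<close>

lemma F_powr_has_derivative_rep:
  assumes "(s, t) \<in> W" "s \<in> I" "t \<in> {a..b}"
  shows "((\<lambda>\<sigma>. F (\<Gamma> \<sigma> t) (V \<sigma> t) powr q) has_real_derivative q * F (\<Gamma> s t) (V s t) powr (q - 2) *
    frechet_derivative energy (at (z (s, t))) (dderiv (1, 0) h (s, t), dderiv (1, 0) (dderiv (0, 1) h) (s, t))) (at s)"
proof -
  have "((\<lambda>\<sigma>. (\<sigma>, t)) has_vector_derivative (1, 0)) (at s)"
    by (auto intro!: has_vector_derivative_Pair derivative_eq_intros)
  from has_vector_derivative_powr_energy[OF rep_point(5,6)[OF assms] z_has_vector_derivative[OF this assms(1)] refl, of q]
  have "((\<lambda>\<sigma>. (2 * energy (z (\<sigma>, t))) powr (q / 2)) has_real_derivative q * F (\<Gamma> s t) (V s t) powr (q - 2) *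
      frechet_derivative energy (at (z (s, t))) (dderiv (1, 0) h (s, t), dderiv (1, 0) (dderiv (0, 1) h) (s, t))) (at s)"
    by (simp only: rep_point(7)[OF assms])
  then show ?thesis
  proof (rule has_field_derivative_transform_within_open)
    show "open ((\<lambda>\<sigma>. (\<sigma>, t)) -` W \<inter> I)"
      by (intro open_Int open_vimage[OF rep_open] continuous_intros open_greaterThanLessThan)
    show "(2 * energy (z (\<sigma>, t))) powr (q / 2) = F (\<Gamma> \<sigma> t) (V \<sigma> t) powr q"
      if "\<sigma> \<in> (\<lambda>\<sigma>. (\<sigma>, t)) -` W \<inter> I" for \<sigma>
      using F_powr_rep[of \<sigma> t q] that assms(3) by simp
  qed (use assms in auto)
qed

lemma continuous_on_powr_energy_rep:
  "continuous_on (W \<inter> I \<times> {a..b}) (\<lambda>\<sigma>. (2 * energy (z \<sigma>)) powr q)"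
proof (rule continuous_on_powr)
  have "continuous_on (W \<inter> I \<times> {a..b}) (\<lambda>\<sigma>. energy (z \<sigma>))"
  proof (rule continuous_on_compose2[OF Ck_on_imp_continuous_on[OF energy_Ck] continuous_on_z])
    show "z ` (W \<inter> I \<times> {a..b}) \<subseteq> snd \<kappa> ` fst \<kappa> \<times> - {0}"
      using rep_z_domain by auto
  qed
  then show "continuous_on (W \<inter> I \<times> {a..b}) (\<lambda>\<sigma>. 2 * energy (z \<sigma>))"
    by (intro continuous_intros)
  show "\<forall>\<sigma>\<in>W \<inter> I \<times> {a..b}. 2 * energy (z \<sigma>) \<noteq> 0"
    using energy_pos[OF rep_point(5,6)] by (auto simp: less_imp_neq[symmetric])
qed simp

lemma continuous_on_dderiv_energy_rep:
  assumes "continuous_on (W \<inter> I \<times> {a..b}) w"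
  shows "continuous_on (W \<inter> I \<times> {a..b}) (\<lambda>\<sigma>. frechet_derivative energy (at (z \<sigma>)) (w \<sigma>))"
proof (rule continuous_on_dderiv_compose[OF energy_Ck continuous_on_z assms])
  show "z \<sigma> \<in> snd \<kappa> ` fst \<kappa> \<times> - {0}" if "\<sigma> \<in> W \<inter> I \<times> {a..b}" for \<sigma>
    using that rep_z_domain by (cases \<sigma>) auto
qed

lemma continuous_on_rep:
  "continuous_on (W \<inter> I \<times> {a..b}) (dderiv v h)" "continuous_on (W \<inter> I \<times> {a..b}) (dderiv w (dderiv v h))"
  by (rule continuous_on_subset[of W], auto intro: Ck_on_imp_continuous_on[OF rep_Ck(2)] Ck_on_imp_continuous_on[OF rep_Ck(3)])+

lemma continuous_on_F_powr_rep:
  "continuous_on (W \<inter> I \<times> {a..b}) (\<lambda>(s, t). F (\<Gamma> s t) (V s t) powr q)"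
  by (rule continuous_on_eq[OF continuous_on_powr_energy_rep[of "q / 2"]]) (auto simp only: F_powr_rep split: prod.splits)

lemma continuous_on_momentum_rep:
  "continuous_on (W \<inter> I \<times> {a..b}) (\<lambda>(s, t). F (\<Gamma> s t) (V s t) powr q * g_inner A F (\<Gamma> s t) (V s t) (Y s t) (V s t))"
proof (rule continuous_on_eq)
  show "continuous_on (W \<inter> I \<times> {a..b}) (\<lambda>\<sigma>. (2 * energy (z \<sigma>)) powr (q / 2) *
      frechet_derivative energy (at (z \<sigma>)) (0, dderiv (1, 0) h \<sigma>))"
    by (intro continuous_on_mult continuous_on_powr_energy_rep continuous_on_dderiv_energy_rep
        continuous_on_Pair continuous_on_const continuous_on_rep)
  show "(2 * energy (z \<sigma>)) powr (q / 2) * frechet_derivative energy (at (z \<sigma>)) (0, dderiv (1, 0) h \<sigma>) =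
      (case \<sigma> of (s, t) \<Rightarrow> F (\<Gamma> s t) (V s t) powr q * g_inner A F (\<Gamma> s t) (V s t) (Y s t) (V s t))"
    if "\<sigma> \<in> W \<inter> I \<times> {a..b}" for \<sigma>
    using that by (cases \<sigma>) (simp add: F_powr_rep g_inner_rep)
qed

text \<open>Prepares the Leibniz rule for the action, which asks for joint continuity of the
  s-derivative; \<open>deriv\<close> is replaced by its explicit chart formula.\<close>

lemma continuous_on_deriv_F_powr_rep:
  "continuous_on (W \<inter> I \<times> {a..b}) (\<lambda>(s, t). deriv (\<lambda>\<sigma>. F (\<Gamma> \<sigma> t) (V \<sigma> t) powr q) s)"
proof (rule continuous_on_eq)
  show "continuous_on (W \<inter> I \<times> {a..b}) (\<lambda>\<sigma>. q * (2 * energy (z \<sigma>)) powr ((q - 2) / 2) *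
      frechet_derivative energy (at (z \<sigma>)) (dderiv (1, 0) h \<sigma>, dderiv (1, 0) (dderiv (0, 1) h) \<sigma>))"
    by (intro continuous_on_mult continuous_on_powr_energy_rep continuous_on_dderiv_energy_rep
        continuous_on_Pair continuous_on_const continuous_on_rep)
  show "q * (2 * energy (z \<sigma>)) powr ((q - 2) / 2) *
      frechet_derivative energy (at (z \<sigma>)) (dderiv (1, 0) h \<sigma>, dderiv (1, 0) (dderiv (0, 1) h) \<sigma>) =
      (case \<sigma> of (s, t) \<Rightarrow> deriv (\<lambda>\<sigma>. F (\<Gamma> \<sigma> t) (V \<sigma> t) powr q) s)"
    if "\<sigma> \<in> W \<inter> I \<times> {a..b}" for \<sigma>
    using that DERIV_imp_deriv[OF F_powr_has_derivative_rep] F_powr_rep by (cases \<sigma>) simp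
qed

end

lemma piece_local:
  assumes "\<And>\<kappa> W h. local_rep \<kappa> W h \<Longrightarrow> continuous_on (W \<inter> I \<times> {a..b}) f"
  shows "continuous_on (I \<times> {a..b}) f"
proof (rule continuous_on_local)
  fix x :: "real \<times> real" assume x: "x \<in> I \<times> {a..b}"
  obtain s t where st: "x = (s, t)" by (cases x)
  obtain \<kappa> where "\<kappa> \<in> charts_at A (\<Gamma> s t)"
    using charts_at_ne[OF topspace_\<Gamma>[of s t]] x st by auto
  then obtain W h where "x \<in> W" and rep: "local_rep \<kappa> W h"
    using local_rep_exists[of s t \<kappa>] x st by (metis SigmaE2)
  then show "\<exists>W. open W \<and> x \<in> W \<and> continuous_on (W \<inter> I \<times> {a..b}) f"
    using assms[OF rep] rep_open[OF rep] by blast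
qed

section \<open>Lagrangian, momentum and the derivative of the action\<close>

definition lagrangian :: "real \<Rightarrow> real \<Rightarrow> real \<Rightarrow> real" where
  "lagrangian p s t = F (\<Gamma> s t) (V s t) powr p"

definition lagrangian_ds :: "real \<Rightarrow> real \<Rightarrow> real \<Rightarrow> real" where
  "lagrangian_ds p s t = deriv (\<lambda>\<sigma>. lagrangian p \<sigma> t) s"

definition momentum :: "real \<Rightarrow> real \<Rightarrow> real \<Rightarrow> real" where
  "momentum p s t = F (\<Gamma> s t) (V s t) powr (p - 2) * g_inner A F (\<Gamma> s t) (V s t) (Y s t) (V s t)"

lemma continuous_on_lagrangian: "continuous_on (I \<times> {a..b}) (\<lambda>(s, t). lagrangian p s t)"
  unfolding lagrangian_def by (rule piece_local, rule continuous_on_F_powr_rep)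

lemma continuous_on_lagrangian_ds: "continuous_on (I \<times> {a..b}) (\<lambda>(s, t). lagrangian_ds p s t)"
  unfolding lagrangian_ds_def lagrangian_def by (rule piece_local, rule continuous_on_deriv_F_powr_rep)

lemma continuous_on_momentum: "continuous_on (I \<times> {a..b}) (\<lambda>(s, t). momentum p s t)"
  unfolding momentum_def by (rule piece_local, rule continuous_on_momentum_rep)

lemma continuous_on_slice:
  assumes "continuous_on (I \<times> {a..b}) (\<lambda>(s, t). f s t)" "s \<in> I"
  shows "continuous_on {a..b} (f s)"
proof -
  have "continuous_on {a..b} (\<lambda>t. (s, t))"
    by (intro continuous_intros)
  from continuous_on_compose2[OF assms(1) this] show ?thesis
    using assms(2) by (simp add: image_subset_iff)
qed

lemma lagrangian_has_derivative:
  assumes "s \<in> I" "t \<in> {a..b}"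
  shows "((\<lambda>\<sigma>. lagrangian p \<sigma> t) has_real_derivative lagrangian_ds p s t) (at s)"
proof -
  obtain \<kappa> where "\<kappa> \<in> charts_at A (\<Gamma> s t)"
    using charts_at_ne[OF topspace_\<Gamma>[OF assms]] by blast
  then obtain W h where "(s, t) \<in> W" "local_rep \<kappa> W h"
    using local_rep_exists[OF assms] by blast
  note d = F_powr_has_derivative_rep[OF this(2,1) assms, of p]
  show ?thesis
    unfolding lagrangian_ds_def lagrangian_def DERIV_imp_deriv[OF d] by (rule d)
qed

lemma action_has_derivative:
  "((\<lambda>s. integral {a..b} (lagrangian p s)) has_real_derivative integral {a..b} (lagrangian_ds p 0)) (at 0)"
proof -
  have 0: "0 \<in> I"
    using eps by simp
  have "((\<lambda>s. integral (cbox a b) (lagrangian p s)) has_real_derivative integral (cbox a b) (lagrangian_ds p 0)) (at 0 within I)"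
  proof (rule leibniz_rule_field_derivative)
    show "((\<lambda>s. lagrangian p s t) has_real_derivative lagrangian_ds p s t) (at s within I)"
      if "s \<in> I" "t \<in> cbox a b" for s t
      using lagrangian_has_derivative[of s t p] that by (simp add: has_field_derivative_at_within)
    show "lagrangian p s integrable_on cbox a b" if "s \<in> I" for s
      using integrable_continuous_real[OF continuous_on_slice[OF continuous_on_lagrangian[of p] that]] by simp
    show "continuous_on (I \<times> cbox a b) (\<lambda>(s, t). lagrangian_ds p s t)"
      using continuous_on_lagrangian_ds by simp
  qed (use 0 in simp_all)
  then show ?thesis
    using at_within_open[OF 0] by simp
qed

section \<open>The central curve, s = 0\<close>

context
  fixes c :: "real \<Rightarrow> 'a" and X :: "real \<Rightarrow> ('a, 'n) tvec" and p :: real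
  assumes c: "\<And>t. t \<in> {0..1} \<Longrightarrow> \<Gamma> 0 t = c t"
    and X: "\<And>t. t \<in> {0..1} \<Longrightarrow> X t = variation_field A \<epsilon> \<Gamma> t"
    and p: "p \<noteq> 0"
begin

lemma zero_in_I: "0 \<in> I"
  using eps by simp

lemma interior_at_within:
  assumes "t \<in> {a<..<b}"
  shows "at t within {0..1} = at t" "at t within {a..b} = at t" "t \<in> {0..1}" "t \<in> {a..b}"
proof -
  have "t \<in> interior {a..b}" "t \<in> interior {0..1}"
    using assms ab(2) interior_mono[OF ab(2)] by (auto simp: interior_atLeastAtMost_real)
  then show "at t within {0..1} = at t" "at t within {a..b} = at t" "t \<in> {0..1}" "t \<in> {a..b}"
    using at_within_interior interior_subset by blast+
qed

text \<open>Inside the open piece the derivatives within \<open>{0..1}\<close> and within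
  \<open>{a..b}\<close> are both two-sided. The separate variable \<open>c'\<close> allows the lemma
  to be applied to c, which is known to agree with \<open>\<Gamma> 0\<close> on
  \<open>{0..1}\<close> only.\<close>

lemma cdot_curve_eq_V:
  assumes "t \<in> {a<..<b}" "\<And>t. t \<in> {0..1} \<Longrightarrow> \<Gamma> s t = c' t"
  shows "cdot A c' t = V s t"
proof -
  note t = interior_at_within[OF assms(1)]
  have *: "vector_derivative (\<lambda>\<tau>. snd \<kappa> (c' \<tau>)) (at t) = vector_derivative (\<lambda>\<tau>. snd \<kappa> (\<Gamma> s \<tau>)) (at t)" for \<kappa>
  proof (rule vector_derivative_cong_eq)
    have "\<forall>\<^sub>F \<tau> in nhds t. \<tau> \<in> {a<..<b}"
      using assms(1) by (intro eventually_nhds_in_open) auto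
    then show "\<forall>\<^sub>F \<tau> in nhds t. \<tau> \<in> UNIV \<longrightarrow> snd \<kappa> (c' \<tau>) = snd \<kappa> (\<Gamma> s \<tau>)"
      by (rule eventually_mono) (use interior_at_within(3) assms(2) in simp)
  qed simp_all
  show ?thesis
    unfolding V_def velocity_def t by (simp only: * assms(2)[OF t(3)])
qed

lemma cdot_eq_V: "t \<in> {a<..<b} \<Longrightarrow> cdot A c t = V 0 t"
  by (rule cdot_curve_eq_V) (simp_all add: c)

lemma X_eq_Y: "t \<in> {a..b} \<Longrightarrow> X t = Y 0 t"
  using X ab(2) unfolding variation_field_def Y_def by blast

lemma speed_eq:
  assumes "t \<in> {a<..<b}"
  shows "speed A F c t = F (\<Gamma> 0 t) (V 0 t)"
proof -
  note t = interior_at_within[OF assms]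
  note VF = V_tangent[OF zero_in_I t(4)] V_nonzero[OF zero_in_I t(4)] topspace_\<Gamma>[OF zero_in_I t(4)]
  show ?thesis
    using g_inner_self[OF VF] F_positive[OF VF]
    by (simp add: speed_def norm_along_def g_along_def cdot_eq_V[OF assms] c[OF t(3), symmetric])
qed

lemma jump_integrand_eq:
  assumes "t \<in> {a<..<b}"
  shows "g_along A F c t (X t) (tvec_scale (speed A F c t powr (p - 2)) (cdot A c t)) = momentum p 0 t"
  using interior_at_within[OF assms]
  by (simp add: momentum_def g_along_def g_inner_scale_right cdot_eq_V[OF assms] speed_eq[OF assms] X_eq_Y c)

lemma p_energy_integrand_eq:
  assumes "t \<in> {a<..<b}" "s \<in> I"
  shows "g_along A F (\<Gamma> s) t (cdot A (\<Gamma> s) t) (cdot A (\<Gamma> s) t) powr (p / 2) = lagrangian p s t"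
proof -
  note t = interior_at_within[OF assms(1)]
  note VF = V_tangent[OF assms(2) t(4)] V_nonzero[OF assms(2) t(4)] topspace_\<Gamma>[OF assms(2) t(4)]
  have "(F (\<Gamma> s t) (V s t))\<^sup>2 = F (\<Gamma> s t) (V s t) powr 2"
    using F_positive[OF VF] by simp
  then show ?thesis
    using cdot_curve_eq_V[OF assms(1), of s "\<Gamma> s"]
    by (simp add: g_along_def g_inner_self[OF VF] powr_powr lagrangian_def)
qed

lemma cdot_has_vector_derivative_rep:
  assumes rep: "local_rep \<kappa> W h" and t: "t \<in> {a<..<b}" "(0, t) \<in> W"
  shows "((\<lambda>\<tau>. cdot A c \<tau> \<kappa>) has_vector_derivative dderiv (0, 1) (dderiv (0, 1) h) (0, t)) (at t)"
proof -
  have "((\<lambda>\<tau>. (0, \<tau>)) has_vector_derivative (0, 1)) (at t)"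
    by (auto intro!: has_vector_derivative_Pair derivative_eq_intros)
  from bounded_linear.has_vector_derivative[OF bounded_linear_snd z_has_vector_derivative[OF rep this t(2)]]
  have "((\<lambda>\<tau>. dderiv (0, 1) h (0, \<tau>)) has_vector_derivative dderiv (0, 1) (dderiv (0, 1) h) (0, t)) (at t)"
    by simp
  then show ?thesis
  proof (rule has_vector_derivative_transform_within_open)
    show "open ((\<lambda>\<tau>. (0, \<tau>)) -` W \<inter> {a<..<b})"
      by (intro open_Int open_vimage[OF rep_open[OF rep]] continuous_intros open_greaterThanLessThan)
    show "dderiv (0, 1) h (0, \<tau>) = cdot A c \<tau> \<kappa>" if "\<tau> \<in> (\<lambda>\<tau>. (0, \<tau>)) -` W \<inter> {a<..<b}" for \<tau>
      using that rep_point(3)[OF rep, of 0 \<tau>] zero_in_I interior_at_within(4)[of \<tau>] cdot_eq_V[of \<tau>] by simp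
  qed (use t in simp_all)
qed

lemma cdot_isCont:
  assumes "t \<in> {a<..<b}" "\<kappa> \<in> charts_at A (c t)"
  shows "isCont (\<lambda>\<tau>. cdot A c \<tau> \<kappa>) t"
proof -
  note t = interior_at_within[OF assms(1)]
  have "\<kappa> \<in> charts_at A (\<Gamma> 0 t)"
    using assms(2) c[OF t(3)] by simp
  then obtain W h where "(0, t) \<in> W" "local_rep \<kappa> W h"
    using local_rep_exists[OF zero_in_I t(4)] by blast
  then show ?thesis
    using cdot_has_vector_derivative_rep assms(1) has_vector_derivative_continuous by blast
qed

text \<open>The pointwise first variation formula. The computation takes place in the chart that
  \<open>variation_integrand\<close> uses at \<open>c t\<close>, so the covariant derivative is read
  in that chart alone.\<close>

lemma momentum_has_derivative:
  assumes t: "t \<in> {a<..<b}"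
  shows "(momentum p 0 has_real_derivative variation_integrand A F p c X t + lagrangian_ds p 0 t / p) (at t)"
proof -
  note t01 = interior_at_within[OF t]
  define \<kappa> where "\<kappa> = some_chart A (c t)"
  have ct: "c t = \<Gamma> 0 t"
    using c t01(3) by simp
  have top: "c t \<in> topspace M"
    using topspace_\<Gamma>[OF zero_in_I t01(4)] ct by simp
  have \<kappa>: "\<kappa> \<in> charts_at A (c t)"
    unfolding \<kappa>_def by (rule some_chart[OF top])
  then have "\<kappa> \<in> charts_at A (\<Gamma> 0 t)"
    by (simp only: ct)
  then obtain W h where W: "(0, t) \<in> W" and rep: "local_rep \<kappa> W h"
    using local_rep_exists[OF zero_in_I t01(4)] by blast
  interpret finsler_domain "F_loc A F \<kappa>" "snd \<kappa> ` fst \<kappa>"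
    by (rule finsler_domain_chart[OF rep_chart[OF rep]])
  let ?z = "\<lambda>\<tau>. (h (0, \<tau>), dderiv (0, 1) h (0, \<tau>))"
  let ?T = "(\<lambda>\<tau>. (0, \<tau>)) -` W \<inter> {a<..<b}"
  define u y where "u = h (0, t)" and "y = dderiv (0, 1) h (0, t)"
  define ac w where "ac = dderiv (0, 1) (dderiv (0, 1) h) (0, t)" and "w = dderiv (1, 0) h (0, t)"
  define w' where "w' = dderiv (0, 1) (dderiv (1, 0) h) (0, t)"
  note pt = rep_point[OF rep W zero_in_I t01(4)]
  have T: "open ?T" "t \<in> ?T"
    using t W by (auto intro!: open_Int open_vimage[OF rep_open[OF rep]] continuous_intros)
  have uy: "u \<in> snd \<kappa> ` fst \<kappa>" "y \<noteq> 0" "F_loc A F \<kappa> u y = F (\<Gamma> 0 t) (V 0 t)" "u = snd \<kappa> (c t)" "V 0 t \<kappa> = y" "Y 0 t \<kappa> = w"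
    using pt ct by (simp_all add: u_def y_def w_def)
  have l: "((\<lambda>\<tau>. (0, \<tau>)) has_vector_derivative (0, 1)) (at t)"
    by (auto intro!: has_vector_derivative_Pair derivative_eq_intros)
  have z: "(?z has_vector_derivative (y, ac)) (at t)"
    using z_has_vector_derivative[OF rep l W] by (simp add: y_def ac_def)
  have "dderiv (1, 0) h differentiable (at (0, t))"
    using rep_Ck(2)[OF rep, where k = "Suc 0" and v = "(1, 0)"] W by (simp only: Ck_on.simps)
  from has_vector_derivative_compose_frechet[where z = "\<lambda>\<tau>. (0, \<tau>)", OF this l]
  have w: "((\<lambda>\<tau>. dderiv (1, 0) h (0, \<tau>)) has_vector_derivative w') (at t)"
    by (simp add: w'_def)
  have "z \<tau> \<in> snd \<kappa> ` fst \<kappa> \<times> - {0}" if "\<tau> \<in> ?T" "z = ?z" for \<tau> z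
    using that rep_z_domain[OF rep, of 0 \<tau>] zero_in_I interior_at_within(4)[of \<tau>] by simp
  from momentum_has_vector_derivative[OF uy(1,2) T this[OF _ refl] z _ w, of p]
  have "((\<lambda>\<tau>. (2 * energy (?z \<tau>)) powr ((p - 2) / 2) * frechet_derivative energy (at (?z \<tau>)) (0, dderiv (1, 0) h (0, \<tau>)))
     has_real_derivative F_loc A F \<kappa> u y powr (p - 4) * g_form u y w ((F_loc A F \<kappa> u y)\<^sup>2 *\<^sub>R acceleration u y ac
         + ((p - 2) * g_form u y (acceleration u y ac) y) *\<^sub>R y)
     + F_loc A F \<kappa> u y powr (p - 2) * dderiv (w, w') energy (u, y)) (at t)"
    by (simp add: u_def y_def w_def)
  then have "(momentum p 0 has_real_derivative F_loc A F \<kappa> u y powr (p - 4) * g_form u y w ((F_loc A F \<kappa> u y)\<^sup>2 *\<^sub>R acceleration u y ac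
         + ((p - 2) * g_form u y (acceleration u y ac) y) *\<^sub>R y)
     + F_loc A F \<kappa> u y powr (p - 2) * dderiv (w, w') energy (u, y)) (at t)"
  proof (rule has_field_derivative_transform_within_open[OF _ T])
    fix \<tau> assume "\<tau> \<in> ?T"
    then have \<tau>: "(0, \<tau>) \<in> W" "\<tau> \<in> {a..b}"
      using interior_at_within(4)[of \<tau>] by auto
    \<comment> \<open>At \<tau> the metric is evaluated in a chart chosen for that time;
      \<open>g_inner_rep\<close> carries its value over to the fixed \<kappa>.\<close>
    show "(2 * energy (?z \<tau>)) powr ((p - 2) / 2) * frechet_derivative energy (at (?z \<tau>)) (0, dderiv (1, 0) h (0, \<tau>))
        = momentum p 0 \<tau>"
      unfolding momentum_def using F_powr_rep[OF rep \<tau>(1) zero_in_I \<tau>(2)] g_inner_rep[OF rep \<tau>(1) zero_in_I \<tau>(2)] by simp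
  qed
  \<comment> \<open>\<open>w'\<close> is the t-derivative of the variation field, while the
    s-derivative of the Lagrangian contains the s-derivative of the velocity; the two mixed
    derivatives of h agree. The division by p removes the factor produced by the power.\<close>
  moreover have "F_loc A F \<kappa> u y powr (p - 2) * dderiv (w, w') energy (u, y) = lagrangian_ds p 0 t / p"
  proof -
    have "w' = dderiv (1, 0) (dderiv (0, 1) h) (0, t)"
      unfolding w'_def by (rule dderiv_commute[OF rep_open[OF rep] W rep_Ck(1)[OF rep]])
    then show ?thesis
      using DERIV_imp_deriv[OF F_powr_has_derivative_rep[OF rep W zero_in_I t01(4), of p]] p
      by (simp add: lagrangian_ds_def lagrangian_def pt(7) w_def u_def y_def)
  qed
  moreover have "F_loc A F \<kappa> u y powr (p - 4) * g_form u y w ((F_loc A F \<kappa> u y)\<^sup>2 *\<^sub>R acceleration u y ac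
      + ((p - 2) * g_form u y (acceleration u y ac) y) *\<^sub>R y) = variation_integrand A F p c X t"
  proof -
    have "vector_derivative (\<lambda>\<tau>. cdot A c \<tau> \<kappa>) (at t within {0..1}) = ac"
      unfolding t01(1) ac_def by (rule vector_derivative_at[OF cdot_has_vector_derivative_rep[OF rep t W]])
    then have "covariant_deriv A F c (cdot A c) t \<kappa> = acceleration u y ac"
      by (simp only: covariant_deriv_def acceleration_def Let_def \<kappa> if_True cdot_eq_V[OF t] uy(5) uy(4)[symmetric])
    then show ?thesis
      by (simp only: variation_integrand_def Let_def g_along_def g_inner_eq_g_form[OF top \<kappa>_def] cdot_eq_V[OF t]
          speed_eq[OF t] X_eq_Y[OF t01(4)] tvec_add_def tvec_scale_def uy(4)[symmetric] uy(3,5,6))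
  qed
  ultimately show ?thesis by simp
qed

lemma continuous_on_momentum_0: "continuous_on {a..b} (momentum p 0)"
  by (rule continuous_on_slice[OF continuous_on_momentum zero_in_I])

text \<open>The fundamental theorem is used with the derivative in the open interval and the
  momentum continuous up to the ends. Integrability comes with it: the integrand is the derivative
  of the momentum minus a continuous function.\<close>

lemma variation_integrand_has_integral:
  "(variation_integrand A F p c X has_integral
     momentum p 0 b - momentum p 0 a - integral {a..b} (lagrangian_ds p 0) / p) {a..b}"
proof -
  have 1: "((\<lambda>t. variation_integrand A F p c X t + lagrangian_ds p 0 t / p) has_integral momentum p 0 b - momentum p 0 a) {a..b}"
    using momentum_has_derivative ab(1)
    by (intro fundamental_theorem_of_calculus_interior continuous_on_momentum_0)
      (auto simp: has_real_derivative_iff_has_vector_derivative)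
  have "(lagrangian_ds p 0 has_integral integral {a..b} (lagrangian_ds p 0)) {a..b}"
    using integrable_continuous_real[OF continuous_on_slice[OF continuous_on_lagrangian_ds zero_in_I]] by blast
  from has_integral_diff[OF 1 has_integral_divide[OF this, of p]] show ?thesis
    by simp
qed

text \<open>\<open>jump_term\<close> is built from one-sided limits, and the momentum of the piece
  extends the scalar continuously from the open interval to the ends.\<close>

lemma jump_integrand_limits:
  defines "f \<equiv> \<lambda>t. g_along A F c t (X t) (tvec_scale (speed A F c t powr (p - 2)) (cdot A c t))"
  shows "(f \<longlongrightarrow> momentum p 0 a) (at_right a)" "(f \<longlongrightarrow> momentum p 0 b) (at_left b)"
proof -
  have "(momentum p 0 \<longlongrightarrow> momentum p 0 a) (at_right a)"
    using continuous_on_momentum_0 ab(1) by (rule continuous_on_Icc_at_rightD)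
  moreover have "\<forall>\<^sub>F t in at_right a. momentum p 0 t = f t"
    using eventually_at_right_real[OF ab(1)] by (rule eventually_mono) (simp add: f_def jump_integrand_eq)
  ultimately show "(f \<longlongrightarrow> momentum p 0 a) (at_right a)"
    by (rule Lim_transform_eventually)
  have "(momentum p 0 \<longlongrightarrow> momentum p 0 b) (at_left b)"
    using continuous_on_momentum_0 ab(1) by (rule continuous_on_Icc_at_leftD)
  moreover have "\<forall>\<^sub>F t in at_left b. momentum p 0 t = f t"
    using eventually_at_left_real[OF ab(1)] by (rule eventually_mono) (simp add: f_def jump_integrand_eq)
  ultimately show "(f \<longlongrightarrow> momentum p 0 b) (at_left b)"
    by (rule Lim_transform_eventually)
qed

text \<open>Turns continuity of \<open>cdot\<close> at a subdivision point into equality of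
  \<open>V\<close> for the two adjacent pieces.\<close>

lemma cdot_tendsto_V:
  assumes t: "t \<in> {a..b}" and "\<kappa> \<in> charts_at A (c t)"
  shows "((\<lambda>\<tau>. cdot A c \<tau> \<kappa>) \<longlongrightarrow> V 0 t \<kappa>) (at t within {a<..<b})"
proof -
  have "c t = \<Gamma> 0 t"
    using c ab(2) t by (metis subsetD)
  then have "\<kappa> \<in> charts_at A (\<Gamma> 0 t)"
    using assms(2) by (simp only:)
  then obtain W h where W: "(0, t) \<in> W" and rep: "local_rep \<kappa> W h"
    using local_rep_exists[OF zero_in_I t] by blast
  have "isCont (dderiv (0, 1) h) (0, t)"
    using Ck_on_imp_continuous_on[OF rep_Ck(2)[OF rep]] rep_open[OF rep] W by (simp add: continuous_on_eq_continuous_at)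
  moreover have l: "((\<lambda>\<tau>. (0, \<tau>)) \<longlongrightarrow> (0, t)) (at t within {a<..<b})"
    by (intro tendsto_intros)
  ultimately have "((\<lambda>\<tau>. dderiv (0, 1) h (0, \<tau>)) \<longlongrightarrow> dderiv (0, 1) h (0, t)) (at t within {a<..<b})"
    by (rule isCont_tendsto_compose)
  moreover have "\<forall>\<^sub>F \<tau> in at t within {a<..<b}. dderiv (0, 1) h (0, \<tau>) = cdot A c \<tau> \<kappa>"
  proof -
    have "\<forall>\<^sub>F \<tau> in at t within {a<..<b}. (0, \<tau>) \<in> W"
      using l rep_open[OF rep] W by (rule topological_tendstoD)
    moreover have "\<forall>\<^sub>F \<tau> in at t within {a<..<b}. \<tau> \<in> {a<..<b}"
      by (simp add: eventually_at_filter)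
    ultimately show ?thesis
    proof eventually_elim
      case (elim \<tau>)
      then show ?case
        using rep_point(3)[OF rep elim(1) zero_in_I interior_at_within(4)[OF elim(2)]] cdot_eq_V[OF elim(2)] by simp
    qed
  qed
  ultimately show ?thesis
    using rep_point(3)[OF rep W zero_in_I t] by (simp add: Lim_transform_eventually)
qed

end

end

section \<open>Assembling the pieces\<close>

text \<open>All coordinate expressions of the constant path in s are constant, so
  \<open>Y 0 t\<close> is zero.\<close>

lemma (in variation_piece) momentum_fixed_point:
  assumes "t \<in> {a..b}" "\<And>s. s \<in> {-\<epsilon><..<\<epsilon>} \<Longrightarrow> \<Gamma> s t = x"
  shows "momentum p 0 t = 0"
proof -
  have 0: "0 \<in> {-\<epsilon><..<\<epsilon>}"
    using eps by simp
  have *: "vector_derivative (\<lambda>\<sigma>. snd \<kappa> (\<Gamma> \<sigma> t)) (at 0 within {-\<epsilon><..<\<epsilon>}) = 0" for \<kappa>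
  proof (rule vector_derivative_within[OF within_nontrivial(2)[OF 0]])
    show "((\<lambda>\<sigma>. snd \<kappa> (\<Gamma> \<sigma> t)) has_vector_derivative 0) (at 0 within {-\<epsilon><..<\<epsilon>})"
      by (rule has_vector_derivative_transform[OF 0 _ has_vector_derivative_const[of "snd \<kappa> x"]])
        (simp add: assms(2))
  qed
  have "Y 0 t = (\<lambda>\<kappa>. 0)"
    unfolding Y_def velocity_def by (simp only: * if_cancel)
  then show ?thesis
    by (simp add: momentum_def g_inner_def Let_def)
qed

section \<open>Subdivisions of the unit interval\<close>

lemma subdivision_mono:
  assumes "subdivision \<tau> r" "i < j" "j \<le> r"
  shows "\<tau> i < \<tau> j"
  using assms(2,3)
proof (induction j)
  case (Suc j)
  have "\<tau> j < \<tau> (Suc j)"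
    using assms(1) Suc.prems by (simp add: subdivision_def)
  then show ?case
    using Suc by (cases "i = j") auto
qed simp

lemma subdivision_piece:
  assumes "subdivision \<tau> r" "k < r"
  shows "\<tau> k < \<tau> (Suc k)" "{\<tau> k..\<tau> (Suc k)} \<subseteq> {0..1}"
proof -
  show "\<tau> k < \<tau> (Suc k)"
    using assms by (simp add: subdivision_def)
  have "\<tau> 0 \<le> \<tau> k" "\<tau> (Suc k) \<le> \<tau> r"
    using subdivision_mono[OF assms(1), of 0 k] subdivision_mono[OF assms(1), of "Suc k" r] assms(2)
    by (cases "k = 0"; cases "Suc k = r"; simp)+
  then show "{\<tau> k..\<tau> (Suc k)} \<subseteq> {0..1}"
    using assms(1) by (simp add: subdivision_def)
qed

lemma subdivision_locate_right:
  assumes "subdivision \<tau> r" "0 \<le> t" "t < 1"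
  shows "\<exists>j<r. \<tau> j \<le> t \<and> t < \<tau> (Suc j)"
proof -
  have "t < \<tau> r" "\<not> t < \<tau> 0"
    using assms by (simp_all add: subdivision_def)
  \<comment> \<open>The least such k marks the first subdivision point beyond t, so t lies in piece
    \<open>k - 1\<close>; k is positive because t is not before \<open>\<tau> 0\<close>.\<close>
  then obtain k where "k \<le> r" "\<forall>i<k. \<not> t < \<tau> i" "t < \<tau> k"
    using ex_least_nat_le[of "\<lambda>k. t < \<tau> k" r] by blast
  with \<open>\<not> t < \<tau> 0\<close> show ?thesis
    by (intro exI[of _ "k - 1"]) (cases k; auto simp: not_less)
qed

lemma subdivision_locate_left:
  assumes "subdivision \<tau> r" "0 < t" "t \<le> 1"
  shows "\<exists>j<r. \<tau> j < t \<and> t \<le> \<tau> (Suc j)"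
proof -
  have "t \<le> \<tau> r" "\<not> t \<le> \<tau> 0"
    using assms by (simp_all add: subdivision_def)
  then obtain k where "k \<le> r" "\<forall>i<k. \<not> t \<le> \<tau> i" "t \<le> \<tau> k"
    using ex_least_nat_le[of "\<lambda>k. t \<le> \<tau> k" r] by blast
  with \<open>\<not> t \<le> \<tau> 0\<close> show ?thesis
    by (intro exI[of _ "k - 1"]) (cases k; auto simp: not_le)
qed

lemma has_integral_subdivision:
  fixes f :: "real \<Rightarrow> real"
  assumes \<tau>: "subdivision \<tau> r" and f: "\<And>k. k < r \<Longrightarrow> (f has_integral J k) {\<tau> k..\<tau> (Suc k)}"
  shows "(f has_integral (\<Sum>k<r. J k)) {0..1}"
proof -
  have "n \<le> r \<Longrightarrow> (f has_integral (\<Sum>k<n. J k)) {\<tau> 0..\<tau> n}" for n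
  proof (induction n)
    case (Suc n)
    have "\<tau> 0 \<le> \<tau> n"
      using subdivision_mono[OF \<tau>, of 0 n] Suc.prems by (cases "n = 0") auto
    then show ?case
      using has_integral_combine[of "\<tau> 0" "\<tau> n" "\<tau> (Suc n)" f] Suc f[of n] subdivision_piece(1)[OF \<tau>, of n]
      by simp
  qed (use has_integral_refl(1)[of f "\<tau> 0"] in simp)
  from this[of r] show ?thesis
    using \<tau> by (simp add: subdivision_def)
qed

text \<open>\<open>Omega\<close> grants regularity along a subdivision of its own, unrelated to
  \<open>{a..b}\<close>. A short interval at t inside both \<open>{a..b}\<close> and one of its
  pieces links the two velocities.\<close>

lemma Omega_velocity_nonzero:
  assumes c: "c \<in> Omega M A x0 x1" and ab: "a < b" "{a..b} \<subseteq> {0..1}" and t: "t \<in> {a..b}"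
    and diff: "curve_differentiable A {a..b} c t"
  shows "velocity A {a..b} c t \<noteq> tvec_zero"
proof -
  obtain \<sigma> r where \<sigma>: "subdivision \<sigma> r"
    and smooth: "\<And>k. k < r \<Longrightarrow> smooth_map M A {\<sigma> k..\<sigma> (Suc k)} c"
    and nz: "\<And>k t. k < r \<Longrightarrow> t \<in> {\<sigma> k..\<sigma> (Suc k)} \<Longrightarrow> velocity A {\<sigma> k..\<sigma> (Suc k)} c t \<noteq> tvec_zero"
    using c unfolding Omega_def by blast
  \<comment> \<open>t is an endpoint of the short interval, which is taken on the side where there
    is room: to the right if t < b, to the left if t = b.\<close>
  have "\<exists>j p q. j < r \<and> p < q \<and> t \<in> {p..q} \<and> {p..q} \<subseteq> {a..b} \<and> {p..q} \<subseteq> {\<sigma> j..\<sigma> (Suc j)}"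
  proof (cases "t < b")
    case True
    then obtain j where "j < r" "\<sigma> j \<le> t" "t < \<sigma> (Suc j)"
      using subdivision_locate_right[OF \<sigma>, of t] ab t by fastforce
    then show ?thesis
      using True t by (intro exI[of _ j] exI[of _ t] exI[of _ "min b (\<sigma> (Suc j))"]) auto
  next
    case False
    then obtain j where "j < r" "\<sigma> j < t" "t \<le> \<sigma> (Suc j)"
      using subdivision_locate_left[OF \<sigma>, of t] ab t by fastforce
    then show ?thesis
      using False t ab by (intro exI[of _ j] exI[of _ "max a (\<sigma> j)"] exI[of _ t]) auto
  qed
  then obtain j p q where j: "j < r" and pq: "p < q" "t \<in> {p..q}" "{p..q} \<subseteq> {a..b}" "{p..q} \<subseteq> {\<sigma> j..\<sigma> (Suc j)}"
    by blast
  have nontrivial: "at t within {p..q} \<noteq> bot" "at t within {\<sigma> j..\<sigma> (Suc j)} \<noteq> bot"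
    using pq subdivision_piece(1)[OF \<sigma> j] by (auto simp: trivial_limit_within islimpt_Icc)
  have "curve_differentiable A {\<sigma> j..\<sigma> (Suc j)} c t"
    using pq(2,4) nontrivial(2)
    by (intro smooth_map_curve_differentiable[OF smooth[OF j], where \<gamma> = "\<lambda>\<tau>. \<tau>" and d = 1])
      (auto intro!: derivative_eq_intros)
  from velocity_subset[OF this pq(4) nontrivial(1)]
  have "velocity A {a..b} c t = velocity A {\<sigma> j..\<sigma> (Suc j)} c t"
    using velocity_subset[OF diff pq(3) nontrivial(1)] by simp
  then show ?thesis
    using nz[OF j, of t] pq(2,4) by auto
qed

theorem mainTheorem1:
  fixes M :: "'a topology"
    and A :: "('a, 'n::finite) chart set"
    and F :: "('a, 'n) finsler_fun"
    and x0 x1 :: 'a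
    and p \<epsilon> :: real
    and c :: "real \<Rightarrow> 'a"
    and \<Gamma> :: "real \<Rightarrow> real \<Rightarrow> 'a"
    and X :: "real \<Rightarrow> ('a, 'n) tvec"
  assumes "finsler_manifold M A F"
    and "x0 \<in> topspace M" and "x1 \<in> topspace M"
    and "p \<noteq> 0"
    and "c \<in> Omega M A x0 x1"
    and "variation M A x0 x1 c \<epsilon> \<Gamma>"
    and "\<And>t. t \<in> {0..1} \<Longrightarrow> X t = variation_field A \<epsilon> \<Gamma> t"
  shows "(\<lambda>s. p_energy A F p (\<Gamma> s)) differentiable (at 0) \<and>
         variation_integrand A F p c X integrable_on {0..1} \<and>
         1 / p * deriv (\<lambda>s. p_energy A F p (\<Gamma> s)) 0 =
           - (\<Sum>t\<in>velocity_jumps A c. jump_term A F p c X t)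
           - integral {0..1} (variation_integrand A F p c X)"
proof -
  have eps: "\<epsilon> > 0" and \<Gamma>_Omega: "\<And>s. s \<in> {-\<epsilon><..<\<epsilon>} \<Longrightarrow> \<Gamma> s \<in> Omega M A x0 x1"
    and c: "\<And>t. t \<in> {0..1} \<Longrightarrow> \<Gamma> 0 t = c t"
    using assms(6) by (auto simp: variation_def)
  \<comment> \<open>This subdivision belongs to the variation and so serves every s at once.\<close>
  obtain \<tau> r where \<tau>: "subdivision \<tau> r"
    and smooth: "\<And>k. k < r \<Longrightarrow> smooth_map M A ({-\<epsilon><..<\<epsilon>} \<times> {\<tau> k..\<tau> (Suc k)}) (\<lambda>(s, t). \<Gamma> s t)"
    using assms(6) unfolding variation_def by blast
  have r: "r > 0"
    using \<tau> by (cases r) (auto simp: subdivision_def)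
  interpret finsler M A F
    by (unfold_locales) (rule assms(1))
  have piece: "variation_piece M A F \<Gamma> \<epsilon> (\<tau> k) (\<tau> (Suc k))" if k: "k < r" for k
  proof
    note \<tau>k = subdivision_piece[OF \<tau> k]
    show "\<epsilon> > 0" "\<tau> k < \<tau> (Suc k)" "{\<tau> k..\<tau> (Suc k)} \<subseteq> {0..1}"
      "smooth_map M A ({-\<epsilon><..<\<epsilon>} \<times> {\<tau> k..\<tau> (Suc k)}) (\<lambda>(s, t). \<Gamma> s t)"
      using eps \<tau>k smooth[OF k] by simp_all
    fix s t assume s: "s \<in> {-\<epsilon><..<\<epsilon>}" and t: "t \<in> {\<tau> k..\<tau> (Suc k)}"
    have "at t within {\<tau> k..\<tau> (Suc k)} \<noteq> bot"
      using t \<tau>k(1) by (simp add: trivial_limit_within islimpt_Icc)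
    then have "curve_differentiable A {\<tau> k..\<tau> (Suc k)} (\<Gamma> s) t"
      using s t
      by (intro smooth_map_curve_differentiable[OF smooth[OF k], where \<gamma> = "\<lambda>\<tau>. (s, \<tau>)" and d = "(0, 1)"])
        (auto intro!: has_vector_derivative_Pair derivative_eq_intros)
    then show "velocity A {\<tau> k..\<tau> (Suc k)} (\<Gamma> s) t \<noteq> tvec_zero"
      by (rule Omega_velocity_nonzero[OF \<Gamma>_Omega[OF s] \<tau>k t])
  qed
  note pieceX = variation_piece.variation_integrand_has_integral[OF piece c assms(7,4)]
  define L where "L k = variation_piece.lagrangian A F \<Gamma> (\<tau> k) (\<tau> (Suc k)) p" for k
  define J where "J k = integral {\<tau> k..\<tau> (Suc k)} (variation_piece.lagrangian_ds A F \<Gamma> (\<tau> k) (\<tau> (Suc k)) p 0)" for k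
  \<comment> \<open>The values of \<open>m k\<close> at \<open>\<tau> k\<close> and
    \<open>\<tau> (Suc k)\<close> are one-sided momenta; adjacent pieces may disagree at their
    common point.\<close>
  define m where "m k = variation_piece.momentum A F \<Gamma> \<epsilon> (\<tau> k) (\<tau> (Suc k)) p 0" for k

  have energy: "p_energy A F p (\<Gamma> s) = (\<Sum>k<r. integral {\<tau> k..\<tau> (Suc k)} (L k s))" if s: "s \<in> {-\<epsilon><..<\<epsilon>}" for s
    unfolding p_energy_def
  proof (rule integral_unique, rule has_integral_subdivision[OF \<tau>])
    fix k assume k: "k < r"
    interpret P: variation_piece M A F \<Gamma> \<epsilon> "\<tau> k" "\<tau> (Suc k)"
      by (rule piece[OF k])
    show "((\<lambda>t. g_along A F (\<Gamma> s) t (cdot A (\<Gamma> s) t) (cdot A (\<Gamma> s) t) powr (p / 2)) has_integral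
        integral {\<tau> k..\<tau> (Suc k)} (L k s)) {\<tau> k..\<tau> (Suc k)}"
    \<comment> \<open>At the two ends of a piece the integrand contains a possibly meaningless
      \<open>cdot\<close>; these points are discarded.\<close>
    proof (rule has_integral_spike_finite)
      show "(L k s has_integral integral {\<tau> k..\<tau> (Suc k)} (L k s)) {\<tau> k..\<tau> (Suc k)}"
        unfolding L_def
        using integrable_continuous_real[OF P.continuous_on_slice[OF P.continuous_on_lagrangian s]] by blast
      show "g_along A F (\<Gamma> s) t (cdot A (\<Gamma> s) t) (cdot A (\<Gamma> s) t) powr (p / 2) = L k s t"
        if "t \<in> {\<tau> k..\<tau> (Suc k)} - {\<tau> k, \<tau> (Suc k)}" for t
        unfolding L_def using that by (intro P.p_energy_integrand_eq[OF c assms(7,4) _ s]) auto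
    qed simp
  qed
  have "((\<lambda>s. \<Sum>k<r. integral {\<tau> k..\<tau> (Suc k)} (L k s)) has_real_derivative (\<Sum>k<r. J k)) (at 0)"
    unfolding L_def J_def using variation_piece.action_has_derivative[OF piece] by (intro DERIV_sum) auto
  then have deriv: "((\<lambda>s. p_energy A F p (\<Gamma> s)) has_real_derivative (\<Sum>k<r. J k)) (at 0)"
    by (rule has_field_derivative_transform_within_open[where S = "{-\<epsilon><..<\<epsilon>}"]) (use eps energy in auto)

  have integral: "(variation_integrand A F p c X has_integral (\<Sum>k<r. m k (\<tau> (Suc k)) - m k (\<tau> k) - J k / p)) {0..1}"
    unfolding m_def J_def by (rule has_integral_subdivision[OF \<tau> pieceX])

  \<comment> \<open>The right limit comes from the piece that starts at the point, the left limit
    from the piece that ends there.\<close>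
  have jump: "jump_term A F p c X (\<tau> (Suc k)) = m (Suc k) (\<tau> (Suc k)) - m k (\<tau> (Suc k))"
    if k: "Suc k < r" for k
    unfolding jump_term_def Let_def m_def
    using tendsto_Lim[OF trivial_limit_at_right_real variation_piece.jump_integrand_limits(1)[OF piece[OF k] c assms(7,4)]]
      tendsto_Lim[OF trivial_limit_at_left_real variation_piece.jump_integrand_limits(2)[OF piece[OF Suc_lessD[OF k]] c assms(7,4)]]
    by simp

  \<comment> \<open>The formula sums over true discontinuities only. At other subdivision points
    both one-sided velocities have the components of \<open>cdot\<close> in one chart, hence
    coincide as tangent vectors.\<close>
  have no_jump: "m (Suc k) (\<tau> (Suc k)) = m k (\<tau> (Suc k))"
    if k: "Suc k < r" and cont: "\<tau> (Suc k) \<notin> velocity_jumps A c" for k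
  proof -
    let ?t = "\<tau> (Suc k)"
    define \<kappa> where "\<kappa> = some_chart A (c ?t)"
    interpret P: variation_piece M A F \<Gamma> \<epsilon> "\<tau> k" ?t
      by (rule piece[OF Suc_lessD[OF k]])
    interpret Q: variation_piece M A F \<Gamma> \<epsilon> ?t "\<tau> (Suc (Suc k))"
      by (rule piece[OF k])
    have t: "?t \<in> {\<tau> k..?t}" "?t \<in> {?t..\<tau> (Suc (Suc k))}" "?t \<in> {0<..<1}"
      using P.ab Q.ab by auto
    have zero: "0 \<in> {-\<epsilon><..<\<epsilon>}"
      using eps by simp
    have ct: "c ?t = \<Gamma> 0 ?t"
      using c t(3) by simp
    have \<kappa>: "\<kappa> \<in> charts_at A (c ?t)"
      unfolding \<kappa>_def using some_chart P.topspace_\<Gamma>[OF zero t(1)] ct by simp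
    have "isCont (\<lambda>\<tau>. cdot A c \<tau> \<kappa>) ?t"
      using cont t(3) unfolding velocity_jumps_def \<kappa>_def by blast
    then have lim: "((\<lambda>\<tau>. cdot A c \<tau> \<kappa>) \<longlongrightarrow> cdot A c ?t \<kappa>) (at ?t within S)" for S
      unfolding isCont_def by (rule tendsto_within_subset) simp
    have "P.V 0 ?t \<kappa> = cdot A c ?t \<kappa>"
      by (rule tendsto_unique[OF _ P.cdot_tendsto_V[OF c assms(7,4) t(1) \<kappa>] lim])
        (use P.ab(1) in \<open>simp add: trivial_limit_within islimpt_greaterThanLessThan2\<close>)
    moreover have "Q.V 0 ?t \<kappa> = cdot A c ?t \<kappa>"
      by (rule tendsto_unique[OF _ Q.cdot_tendsto_V[OF c assms(7,4) t(2) \<kappa>] lim])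
        (use Q.ab(1) in \<open>simp add: trivial_limit_within islimpt_greaterThanLessThan1\<close>)
    ultimately have "P.V 0 ?t \<kappa> = Q.V 0 ?t \<kappa>"
      by simp
    moreover have "\<kappa> \<in> charts_at A (\<Gamma> 0 ?t)"
      using \<kappa> by (simp only: ct)
    ultimately have "P.V 0 ?t = Q.V 0 ?t"
      using tvec_of_tangent_chart[OF P.V_tangent[OF zero t(1)]] tvec_of_tangent_chart[OF Q.V_tangent[OF zero t(2)]]
      by metis
    \<comment> \<open>\<open>Y\<close> does not depend on the piece, so the two momenta could differ
      only through \<open>V\<close>.\<close>
    then show ?thesis
      unfolding m_def P.momentum_def Q.momentum_def by (simp only:)
  qed

  \<comment> \<open>The interior subdivision points are \<open>\<tau> (Suc k)\<close> with
    \<open>k < r - 1\<close>; at all other points of (0,1) the velocity is continuous.\<close>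
  have jumps_subset: "velocity_jumps A c \<subseteq> (\<lambda>k. \<tau> (Suc k)) ` {..<r - 1}"
  proof
    fix t assume t: "t \<in> velocity_jumps A c"
    then have t01: "0 < t" "t < 1" and disc: "\<not> isCont (\<lambda>\<tau>. cdot A c \<tau> (some_chart A (c t))) t"
      by (auto simp: velocity_jumps_def)
    obtain j where j: "j < r" "\<tau> j \<le> t" "t < \<tau> (Suc j)"
      using subdivision_locate_right[OF \<tau>, of t] t01 by auto
    interpret P: variation_piece M A F \<Gamma> \<epsilon> "\<tau> j" "\<tau> (Suc j)"
      by (rule piece[OF j(1)])
    have zero: "0 \<in> {-\<epsilon><..<\<epsilon>}"
      using eps by simp
    have "some_chart A (c t) \<in> charts_at A (c t)"
      using some_chart P.topspace_\<Gamma>[OF zero, of t] c[of t] t01 j by simp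
    from P.cdot_isCont[OF c assms(7,4) _ this] have "\<not> \<tau> j < t"
      using disc j(3) by auto
    then have tj: "t = \<tau> j"
      using j(2) by simp
    then have "j \<noteq> 0"
      using t01(1) \<tau> by (intro notI) (simp add: subdivision_def)
    with tj show "t \<in> (\<lambda>k. \<tau> (Suc k)) ` {..<r - 1}"
      using j(1) by (intro image_eqI[of _ _ "j - 1"]) auto
  qed
  have inj: "inj_on (\<lambda>k. \<tau> (Suc k)) {..<r - 1}"
  proof (rule linorder_inj_onI')
    fix i j assume "i \<in> {..<r - 1}" "j \<in> {..<r - 1}" "i < j"
    then show "\<tau> (Suc i) \<noteq> \<tau> (Suc j)"
      using subdivision_mono[OF \<tau>, of "Suc i" "Suc j"] by force
  qed
  \<comment> \<open>Enlarging the index set to all interior subdivision points adds only terms that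
    vanish by \<open>no_jump\<close>.\<close>
  have "(\<Sum>t\<in>velocity_jumps A c. jump_term A F p c X t) = (\<Sum>t\<in>(\<lambda>k. \<tau> (Suc k)) ` {..<r - 1}. jump_term A F p c X t)"
    by (rule sum.mono_neutral_left) (use jumps_subset jump no_jump in \<open>auto simp: less_diff_conv\<close>)
  also have "\<dots> = (\<Sum>k<r - 1. m (Suc k) (\<tau> (Suc k)) - m k (\<tau> (Suc k)))"
    by (subst sum.reindex[OF inj], rule sum.cong) (auto simp: jump less_diff_conv)
  finally have jumps: "(\<Sum>t\<in>velocity_jumps A c. jump_term A F p c X t) =
      (\<Sum>k<r - 1. m (Suc k) (\<tau> (Suc k)) - m k (\<tau> (Suc k)))" .

  have m_start: "m 0 (\<tau> 0) = 0"
    unfolding m_def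
  proof (rule variation_piece.momentum_fixed_point[OF piece[OF r]])
    show "\<tau> 0 \<in> {\<tau> 0..\<tau> (Suc 0)}"
      using subdivision_piece(1)[OF \<tau> r] by simp
    show "\<Gamma> s (\<tau> 0) = x0" if "s \<in> {-\<epsilon><..<\<epsilon>}" for s
      using \<Gamma>_Omega[OF that] \<tau> by (simp add: Omega_def subdivision_def)
  qed
  have m_end: "m (r - 1) (\<tau> r) = 0"
    unfolding m_def
  proof (rule variation_piece.momentum_fixed_point[OF piece])
    show "\<tau> r \<in> {\<tau> (r - 1)..\<tau> (Suc (r - 1))}"
      using subdivision_piece(1)[OF \<tau>, of "r - 1"] r by simp
    show "\<Gamma> s (\<tau> r) = x1" if "s \<in> {-\<epsilon><..<\<epsilon>}" for s
      using \<Gamma>_Omega[OF that] \<tau> by (simp add: Omega_def subdivision_def)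
  qed (use r in simp)
  \<comment> \<open>Shifting the index in the sum of the initial values pairs the two momenta at
    each interior point. The unpaired terms \<open>m 0 (\<tau> 0)\<close> and
    \<open>m (r - 1) (\<tau> r)\<close> vanish because all curves share their end points.\<close>
  have "(\<Sum>k<r. m k (\<tau> (Suc k)) - m k (\<tau> k)) = - (\<Sum>k<r - 1. m (Suc k) (\<tau> (Suc k)) - m k (\<tau> (Suc k)))"
  proof -
    obtain q where q: "r = Suc q"
      using r by (cases r) auto
    have "(\<Sum>k<r. m k (\<tau> (Suc k))) = (\<Sum>k<q. m k (\<tau> (Suc k)))"
      using m_end by (simp add: q)
    moreover have "(\<Sum>k<r. m k (\<tau> k)) = (\<Sum>k<q. m (Suc k) (\<tau> (Suc k)))"
      using m_start by (simp only: q sum.lessThan_Suc_shift add_0)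
    ultimately show ?thesis
      by (simp add: q sum_subtractf)
  qed
  then have "(\<Sum>k<r. m k (\<tau> (Suc k)) - m k (\<tau> k) - J k / p) =
      - (\<Sum>t\<in>velocity_jumps A c. jump_term A F p c X t) - 1 / p * (\<Sum>k<r. J k)"
    by (simp add: jumps sum_subtractf sum_divide_distrib)
  then have "integral {0..1} (variation_integrand A F p c X) =
      - (\<Sum>t\<in>velocity_jumps A c. jump_term A F p c X t) - 1 / p * deriv (\<lambda>s. p_energy A F p (\<Gamma> s)) 0"
    using integral_unique[OF integral] DERIV_imp_deriv[OF deriv] by (simp only:)
  moreover have "(\<lambda>s. p_energy A F p (\<Gamma> s)) differentiable (at 0)"
    using deriv real_differentiable_def by blast
  moreover have "variation_integrand A F p c X integrable_on {0..1}"
    using integral by (rule has_integral_integrable)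
  ultimately show ?thesis
    by simp
qed

end
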